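(* Let $(M^n,g,\xi,\lambda,\rho)$ be a compact almost Ricci-Bourguignon soliton with scalar curvature $S$. Then $$\int_M\left(\operatorname{Ric}(\xi,\xi)-\|\varphi\|^2+\xi\Bigl((n-1)(\lambda+\rho S)-\frac12 S\Bigr)\right)=0.$$
   Context: Manifolds are smooth and without boundary. An almost Ricci-Bourguignon (almost RB) soliton $(M^n,g,\xi,\lambda,\rho)$ is an $n$-dimensional Riemannian manifold $(M^n,g)$ with a smooth vector field $\xi$ (the potential field), a smooth function $\lambda$ on $M$ (the soliton function) and a real constant $\rho$ such that $\operatorname{Ric}+\frac12\mathcal{L}_\xi g=(\lambda+\rho S)g$, where $\operatorname{Ric}$ is the Ricci tensor, $S$ the scalar curvature and $\mathcal{L}_\xi$ the Lie derivative. Let $\eta$ be the 1-form dual to $\xi$; $\varphi$ is the skew-symmetric operator defined by $\frac12 d\eta(X,Y)=g(\varphi X,Y)$ (with $d\eta(X,Y)=g(\nabla_X\xi,Y)-g(\nabla_Y\xi,X)$), so that $\nabla_X\xi=(\lambda+\rho S)X-QX+\varphi X$, where $Q$ is the Ricci operator, $\operatorname{Ric}(X,Y)=g(QX,Y)$. Its norm is $\|\varphi\|^2=\sum_i g(\varphi e_i,\varphi e_i)$ for a local orthonormal frame $\{e_i\}$. For a function $h$, $\xi(h)$ denotes the derivative of $h$ along $\xi$. Integrals are with respect to the Riemannian volume. *)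

theory Defs
  imports "HOL-Analysis.Analysis"
begin

section \<open>Smooth maps\<close>

fun Ck_on :: "nat \<Rightarrow> 'b::real_normed_vector set \<Rightarrow> ('b \<Rightarrow> 'c::real_normed_vector) \<Rightarrow> bool" where
  "Ck_on 0 S f \<longleftrightarrow> continuous_on S f"
| "Ck_on (Suc k) S f \<longleftrightarrow>
     (\<forall>u\<in>S. f differentiable (at u)) \<and> (\<forall>v. Ck_on k S (\<lambda>u. frechet_derivative f (at u) v))"

text \<open>Meant for open \<open>S\<close> in finite dimension.\<close>

definition smooth_on :: "'b::real_normed_vector set \<Rightarrow> ('b \<Rightarrow> 'c::real_normed_vector) \<Rightarrow> bool" where
  "smooth_on S f \<longleftrightarrow> (\<forall>k. Ck_on k S f)"


section \<open>Smooth manifolds\<close>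

text \<open>
  A manifold of dimension \<open>n = CARD('n)\<close> is a Hausdorff, second countable type \<open>'a\<close> with a smooth
  atlas; the atlas need not be maximal, it represents the smooth structure it generates. A chart
  is a pair of an open set \<open>U\<close> and a coordinate map, of which only the values on \<open>U\<close> matter.
\<close>

type_synonym ('a, 'n) chart = "'a set \<times> ('a \<Rightarrow> real ^ 'n)"

definition chart_dom :: "('a, 'n) chart \<Rightarrow> 'a set" where
  "chart_dom c = fst c"

definition chart_map :: "('a, 'n) chart \<Rightarrow> 'a \<Rightarrow> real ^ 'n" where
  "chart_map c = snd c"

definition chart_img :: "('a, 'n) chart \<Rightarrow> (real ^ 'n) set" where
  "chart_img c = chart_map c ` chart_dom c"

definition chart_inv :: "('a, 'n) chart \<Rightarrow> real ^ 'n \<Rightarrow> 'a" where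
  "chart_inv c = inv_into (chart_dom c) (chart_map c)"

definition transition :: "('a, 'n) chart \<Rightarrow> ('a, 'n) chart \<Rightarrow> real ^ 'n \<Rightarrow> real ^ 'n" where
  "transition c d = (\<lambda>u. chart_map d (chart_inv c u))"

definition overlap :: "('a, 'n) chart \<Rightarrow> ('a, 'n) chart \<Rightarrow> (real ^ 'n) set" where
  "overlap c d = chart_map c ` (chart_dom c \<inter> chart_dom d)"

definition smooth_atlas ::
  "('a::{t2_space, second_countable_topology}, 'n::finite) chart set \<Rightarrow> bool" where
  "smooth_atlas \<A> \<longleftrightarrow>
     (\<forall>c\<in>\<A>. open (chart_dom c) \<and> open (chart_img c) \<and>
        homeomorphism (chart_dom c) (chart_img c) (chart_map c) (chart_inv c)) \<and>
     (\<Union>c\<in>\<A>. chart_dom c) = UNIV \<and>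
     (\<forall>c\<in>\<A>. \<forall>d\<in>\<A>. smooth_on (overlap c d) (transition c d))"

definition chart_at :: "('a, 'n) chart set \<Rightarrow> 'a \<Rightarrow> ('a, 'n) chart" where
  "chart_at \<A> p = (SOME c. c \<in> \<A> \<and> p \<in> chart_dom c)"

definition smooth_function ::
  "('a, 'n::finite) chart set \<Rightarrow> ('a \<Rightarrow> real) \<Rightarrow> bool" where
  "smooth_function \<A> h \<longleftrightarrow> (\<forall>c\<in>\<A>. smooth_on (chart_img c) (\<lambda>u. h (chart_inv c u)))"

text \<open>
  Tensor fields are given by their components in each chart of the atlas, as functions of the
  coordinates, subject to the usual transformation law under change of charts.
\<close>

type_synonym ('a, 'n) vfield = "('a, 'n) chart \<Rightarrow> real ^ 'n \<Rightarrow> real ^ 'n"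

type_synonym ('a, 'n) metric = "('a, 'n) chart \<Rightarrow> real ^ 'n \<Rightarrow> real ^ 'n ^ 'n"

definition smooth_vector_field ::
  "('a, 'n::finite) chart set \<Rightarrow> ('a, 'n) vfield \<Rightarrow> bool" where
  "smooth_vector_field \<A> X \<longleftrightarrow>
     (\<forall>c\<in>\<A>. smooth_on (chart_img c) (X c)) \<and>
     (\<forall>c\<in>\<A>. \<forall>d\<in>\<A>. \<forall>u\<in>overlap c d.
        X d (transition c d u) = frechet_derivative (transition c d) (at u) (X c u))"

definition ip :: "real ^ 'n ^ 'n \<Rightarrow> real ^ 'n \<Rightarrow> real ^ 'n::finite \<Rightarrow> real" where
  "ip M v w = v \<bullet> (M *v w)"

definition riemannian_metric ::
  "('a, 'n::finite) chart set \<Rightarrow> ('a, 'n) metric \<Rightarrow> bool" where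
  "riemannian_metric \<A> g \<longleftrightarrow>
     (\<forall>c\<in>\<A>. smooth_on (chart_img c) (g c) \<and>
        (\<forall>u\<in>chart_img c. (\<forall>v w. ip (g c u) v w = ip (g c u) w v) \<and>
                        (\<forall>v. v \<noteq> 0 \<longrightarrow> ip (g c u) v v > 0))) \<and>
     (\<forall>c\<in>\<A>. \<forall>d\<in>\<A>. \<forall>u\<in>overlap c d. \<forall>v w.
        ip (g c u) v w =
        ip (g d (transition c d u)) (frechet_derivative (transition c d) (at u) v)
                                    (frechet_derivative (transition c d) (at u) w))"


section \<open>Riemannian geometry in a chart\<close>

text \<open>
  Here \<open>G\<close> is the matrix of a metric on an open subset of \<open>\<real>\<^sup>n\<close>, \<open>X, Y, Z\<close> are vector fields there
  and \<open>u\<close> is a point of it. Tensors are evaluated on vectors \<open>v, w\<close> through their constant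
  extensions, which have vanishing Lie brackets.
\<close>

text \<open>The vector metrically dual to a linear form \<open>\<alpha>\<close>.\<close>

definition sharp :: "real ^ 'n ^ 'n \<Rightarrow> (real ^ 'n \<Rightarrow> real) \<Rightarrow> real ^ 'n::finite" where
  "sharp M \<alpha> = (THE w. \<forall>z. ip M w z = \<alpha> z)"

text \<open>Koszul's formula for constant vector fields; the components are the Christoffel symbols.\<close>

definition christoffel ::
  "(real ^ 'n \<Rightarrow> real ^ 'n ^ 'n) \<Rightarrow> real ^ 'n \<Rightarrow> real ^ 'n \<Rightarrow> real ^ 'n \<Rightarrow> real ^ 'n::finite" where
  "christoffel G u v w = sharp (G u) (\<lambda>z. 1/2 *
     (frechet_derivative (\<lambda>y. ip (G y) w z) (at u) v
    + frechet_derivative (\<lambda>y. ip (G y) v z) (at u) w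
    - frechet_derivative (\<lambda>y. ip (G y) v w) (at u) z))"

text \<open>\<open>nabla G X Y\<close> is the Levi-Civita covariant derivative of \<open>Y\<close> in direction \<open>X\<close>.\<close>

definition nabla ::
  "(real ^ 'n \<Rightarrow> real ^ 'n ^ 'n) \<Rightarrow> (real ^ 'n \<Rightarrow> real ^ 'n) \<Rightarrow> (real ^ 'n \<Rightarrow> real ^ 'n) \<Rightarrow>
   real ^ 'n \<Rightarrow> real ^ 'n::finite" where
  "nabla G X Y u = frechet_derivative Y (at u) (X u) + christoffel G u (X u) (Y u)"

definition lie_bracket ::
  "(real ^ 'n \<Rightarrow> real ^ 'n) \<Rightarrow> (real ^ 'n \<Rightarrow> real ^ 'n) \<Rightarrow> real ^ 'n \<Rightarrow> real ^ 'n::finite" where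
  "lie_bracket X Y u = frechet_derivative Y (at u) (X u) - frechet_derivative X (at u) (Y u)"

definition riemann ::
  "(real ^ 'n \<Rightarrow> real ^ 'n ^ 'n) \<Rightarrow> (real ^ 'n \<Rightarrow> real ^ 'n) \<Rightarrow> (real ^ 'n \<Rightarrow> real ^ 'n) \<Rightarrow>
   (real ^ 'n \<Rightarrow> real ^ 'n) \<Rightarrow> real ^ 'n \<Rightarrow> real ^ 'n::finite" where
  "riemann G X Y Z u =
     nabla G X (nabla G Y Z) u - nabla G Y (nabla G X Z) u - nabla G (lie_bracket X Y) Z u"

text \<open>
  \<open>Ric(v, w)\<close> is the trace of the endomorphism sending \<open>z\<close> to \<open>R(z, v) w\<close>; with this sign the
  Ricci tensor of a round sphere is positive.
\<close>

definition ricci ::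
  "(real ^ 'n \<Rightarrow> real ^ 'n ^ 'n) \<Rightarrow> real ^ 'n \<Rightarrow> real ^ 'n \<Rightarrow> real ^ 'n::finite \<Rightarrow> real" where
  "ricci G u v w = (\<Sum>k\<in>UNIV. riemann G (\<lambda>_. axis k 1) (\<lambda>_. v) (\<lambda>_. w) u $ k)"

definition ricci_operator ::
  "(real ^ 'n \<Rightarrow> real ^ 'n ^ 'n) \<Rightarrow> real ^ 'n \<Rightarrow> real ^ 'n \<Rightarrow> real ^ 'n::finite" where
  "ricci_operator G u v = sharp (G u) (ricci G u v)"

definition scalar_local ::
  "(real ^ 'n \<Rightarrow> real ^ 'n ^ 'n) \<Rightarrow> real ^ 'n::finite \<Rightarrow> real" where
  "scalar_local G u = (\<Sum>k\<in>UNIV. ricci_operator G u (axis k 1) $ k)"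

definition lie_derivative ::
  "(real ^ 'n \<Rightarrow> real ^ 'n) \<Rightarrow> (real ^ 'n \<Rightarrow> real ^ 'n ^ 'n) \<Rightarrow>
   (real ^ 'n \<Rightarrow> real ^ 'n) \<Rightarrow> (real ^ 'n \<Rightarrow> real ^ 'n) \<Rightarrow> real ^ 'n::finite \<Rightarrow> real" where
  "lie_derivative \<xi> G X Y u =
     frechet_derivative (\<lambda>y. ip (G y) (X y) (Y y)) (at u) (\<xi> u)
     - ip (G u) (lie_bracket \<xi> X u) (Y u) - ip (G u) (X u) (lie_bracket \<xi> Y u)"

text \<open>The exterior derivative of the 1-form \<open>\<eta>\<close> dual to \<open>\<xi>\<close>, normalised without a factor 1/2.\<close>

definition d_eta ::
  "(real ^ 'n \<Rightarrow> real ^ 'n ^ 'n) \<Rightarrow> (real ^ 'n \<Rightarrow> real ^ 'n) \<Rightarrow>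
   real ^ 'n \<Rightarrow> real ^ 'n \<Rightarrow> real ^ 'n::finite \<Rightarrow> real" where
  "d_eta G \<xi> u v w = ip (G u) (nabla G (\<lambda>_. v) \<xi> u) w - ip (G u) (nabla G (\<lambda>_. w) \<xi> u) v"

definition phi ::
  "(real ^ 'n \<Rightarrow> real ^ 'n ^ 'n) \<Rightarrow> (real ^ 'n \<Rightarrow> real ^ 'n) \<Rightarrow>
   real ^ 'n \<Rightarrow> real ^ 'n \<Rightarrow> real ^ 'n::finite" where
  "phi G \<xi> u v = sharp (G u) (\<lambda>w. 1/2 * d_eta G \<xi> u v w)"

definition orthonormal_frame :: "real ^ 'n ^ 'n \<Rightarrow> ('n \<Rightarrow> real ^ 'n::finite) \<Rightarrow> bool" where
  "orthonormal_frame M e \<longleftrightarrow> (\<forall>i j. ip M (e i) (e j) = (if i = j then 1 else 0))"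

text \<open>The value does not depend on the orthonormal frame chosen.\<close>

definition operator_norm_sq :: "real ^ 'n ^ 'n \<Rightarrow> (real ^ 'n \<Rightarrow> real ^ 'n::finite) \<Rightarrow> real" where
  "operator_norm_sq M T =
     (let e = (SOME e. orthonormal_frame M e) in \<Sum>i\<in>UNIV. ip M (T (e i)) (T (e i)))"


section \<open>Global quantities\<close>

text \<open>Chart-independent quantities at \<open>p\<close> are evaluated in the chart \<open>chart_at \<A> p\<close>.\<close>

definition ricci_field ::
  "('a, 'n::finite) chart set \<Rightarrow> ('a, 'n) metric \<Rightarrow> ('a, 'n) vfield \<Rightarrow> ('a, 'n) vfield \<Rightarrow> 'a \<Rightarrow> real" where
  "ricci_field \<A> g X Y p =
     (let c = chart_at \<A> p; u = chart_map c p in ricci (g c) u (X c u) (Y c u))"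

definition scalar_curvature ::
  "('a, 'n::finite) chart set \<Rightarrow> ('a, 'n) metric \<Rightarrow> 'a \<Rightarrow> real" where
  "scalar_curvature \<A> g p = (let c = chart_at \<A> p in scalar_local (g c) (chart_map c p))"

definition phi_norm_sq ::
  "('a, 'n::finite) chart set \<Rightarrow> ('a, 'n) metric \<Rightarrow> ('a, 'n) vfield \<Rightarrow> 'a \<Rightarrow> real" where
  "phi_norm_sq \<A> g \<xi> p =
     (let c = chart_at \<A> p; u = chart_map c p in operator_norm_sq (g c u) (phi (g c) (\<xi> c) u))"

definition deriv_along ::
  "('a, 'n::finite) chart set \<Rightarrow> ('a, 'n) vfield \<Rightarrow> ('a \<Rightarrow> real) \<Rightarrow> 'a \<Rightarrow> real" where
  "deriv_along \<A> \<xi> h p =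
     (let c = chart_at \<A> p; u = chart_map c p
      in frechet_derivative (\<lambda>y. h (chart_inv c y)) (at u) (\<xi> c u))"

text \<open>The unique Borel measure with density \<open>sqrt (det g)\<close> in every chart.\<close>

definition riemannian_volume ::
  "('a::{t2_space, second_countable_topology}, 'n::finite) chart set \<Rightarrow> ('a, 'n) metric \<Rightarrow> 'a measure" where
  "riemannian_volume \<A> g = (THE \<mu>. sets \<mu> = sets borel \<and>
     (\<forall>c\<in>\<A>. \<forall>B\<in>sets borel. B \<subseteq> chart_dom c \<longrightarrow>
        emeasure \<mu> B = (\<integral>\<^sup>+u\<in>chart_map c ` B. ennreal (sqrt (det (g c u))) \<partial>lborel)))"

definition almost_RB_soliton ::
  "('a::{t2_space, second_countable_topology}, 'n::finite) chart set \<Rightarrow>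
   ('a, 'n) metric \<Rightarrow> ('a, 'n) vfield \<Rightarrow> ('a \<Rightarrow> real) \<Rightarrow> real \<Rightarrow> bool" where
  "almost_RB_soliton \<A> g \<xi> lam \<rho> \<longleftrightarrow>
     smooth_atlas \<A> \<and> riemannian_metric \<A> g \<and> smooth_vector_field \<A> \<xi> \<and> smooth_function \<A> lam \<and>
     (\<forall>c\<in>\<A>. \<forall>p\<in>chart_dom c. \<forall>v w.
        ricci (g c) (chart_map c p) v w
        + 1/2 * lie_derivative (\<xi> c) (g c) (\<lambda>_. v) (\<lambda>_. w) (chart_map c p)
        = (lam p + \<rho> * scalar_curvature \<A> g p) * ip (g c (chart_map c p)) v w)"

end

theory Submission
  imports Defs
begin

text \<open>
  Write \<open>f = \<lambda> + \<rho>S\<close>, \<open>A = \<nabla>\<xi>\<close>, \<open>Q\<close> for the Ricci operator and \<open>A\<^sup>*\<close> for the adjoint. The soliton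
  equation says \<open>Q = f - (A + A\<^sup>*)/2\<close>, so \<open>\<phi> = (A - A\<^sup>*)/2 = A - f + Q\<close>. Commuting covariant derivatives
  gives \<open>div(A\<xi>) = tr A\<^sup>2 + \<xi>(tr A) + Ric(\<xi>,\<xi>)\<close>, the contracted second Bianchi identity gives
  \<open>div(Q\<xi>) = tr(QA) + \<xi>(S)/2\<close>, and \<open>tr A = nf - S\<close>. Since \<open>\<phi>\<close> is skew and \<open>f - Q\<close> self-adjoint,
  \<open>tr(\<phi>(f - Q)) = 0\<close>, and adding up shows that the integrand is exactly \<open>div(\<phi>\<xi>)\<close>. Its integral
  vanishes by a partition of unity and the divergence theorem in charts.

  The scalar curvature is independent of the chart because \<open>S = nf - div \<xi>\<close>, where \<open>f\<close> is a global
  function; so only the covariant differential of a vector field, and not the curvature tensor, has to be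
  transformed between charts.
\<close>

section \<open>Smooth maps\<close>

text \<open>The obstacle is to pass from tensor identities at a point to an integral over a manifold
  that is known only through charts. Tensor calculus is therefore done with matrices: one matrix
  \<open>Gam i\<close> of Christoffel symbols per coordinate direction, so that the curvature
  contains a commutator, the Bianchi identity rests on cancelling triple products, and contractions
  become traces. Since \<phi> is skew, its squared norm is minus the trace of its square, which
  removes the arbitrarily chosen frame. The volume is a definite description, so its existence and
  uniqueness have to be proved before anything can be integrated: compactness reduces both to
  finitely many charts, which agree on overlaps by the change of variables formula. The weights h of
  the partition of unity are differentiated only once, in div(hW) = h div W + dh(W) with W =
  \<phi>\<xi>, so weights of class C1 suffice; the terms dh(W) add up to zero because the weights
  add up to 1.\<close>

lemma Ck_on_cong_imp:
  assumes "open S" "\<And>u. u \<in> S \<Longrightarrow> f u = g u" "Ck_on k S f"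
  shows "Ck_on k S g"
  using assms(2,3)
proof (induction k arbitrary: f g)
  case 0
  then show ?case using continuous_on_cong by fastforce
next
  case (Suc k)
  have d: "(g has_derivative frechet_derivative f (at u)) (at u)" if "u \<in> S" for u
    using Suc.prems that frechet_derivative_works
    by (metis Ck_on.simps(2) assms(1) has_derivative_transform_within_open)
  have e: "frechet_derivative g (at u) = frechet_derivative f (at u)" if "u \<in> S" for u
    using d[OF that] frechet_derivative_at by metis
  show ?case
    using Suc.IH[of "\<lambda>u. frechet_derivative f (at u) v" "\<lambda>u. frechet_derivative g (at u) v" for v] Suc.prems d e
    by (auto simp: differentiable_def)
qed

lemma Ck_on_cong:
  assumes "open S" "\<And>u. u \<in> S \<Longrightarrow> f u = g u"
  shows "Ck_on k S f \<longleftrightarrow> Ck_on k S g"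
  using Ck_on_cong_imp[OF assms(1)] assms(2) by metis

lemma Ck_on_SucD: "Ck_on (Suc k) S f \<Longrightarrow> Ck_on k S f"
proof (induction k arbitrary: f)
  case 0
  then show ?case
    by (auto intro!: differentiable_imp_continuous_on simp: differentiable_on_def differentiable_at_withinI)
next
  case (Suc k)
  then show ?case by simp
qed

lemma Ck_on_const: "Ck_on k S (\<lambda>_. c)"
  by (induction k arbitrary: c) auto

text \<open>By uniqueness of the derivative, any explicitly known family \<open>f'\<close> can stand
  in for \<open>frechet_derivative\<close>. The closure rules below rest on this, with
  \<open>f'\<close> supplied by the differentiation rule of the operation.\<close>

lemma Ck_on_Suc_has_derivativeI:
  assumes "open S" "\<And>u. u \<in> S \<Longrightarrow> (f has_derivative f' u) (at u)" "\<And>v. Ck_on k S (\<lambda>u. f' u v)"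
  shows "Ck_on (Suc k) S f"
proof -
  have "f' u v = frechet_derivative f (at u) v" if "u \<in> S" for u v
    using assms(2)[OF that] frechet_derivative_at by metis
  then have "Ck_on k S (\<lambda>u. frechet_derivative f (at u) v)" for v
    by (intro Ck_on_cong_imp[OF assms(1) _ assms(3)[of v]]) auto
  then show ?thesis
    using assms(2) by (auto simp: differentiable_def)
qed

lemma Ck_on_Suc_has_derivative:
  "Ck_on (Suc k) S f \<Longrightarrow> u \<in> S \<Longrightarrow> (f has_derivative frechet_derivative f (at u)) (at u)"
  by (simp add: frechet_derivative_works[symmetric])

lemma Ck_on_bounded_linear:
  assumes "open S" "bounded_linear L" "Ck_on k S f"
  shows "Ck_on k S (\<lambda>u. L (f u))"
  using assms(3)
proof (induction k arbitrary: f)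
  case 0
  then show ?case using assms(2) by (simp add: linear_continuous_on_compose bounded_linear.linear bounded_linear.continuous_on)
next
  case (Suc k)
  show ?case
    by (rule Ck_on_Suc_has_derivativeI[OF assms(1) bounded_linear.has_derivative[OF assms(2) Ck_on_Suc_has_derivative[OF Suc.prems]]])
      (use Suc in auto)
qed

lemma Ck_on_add:
  assumes "open S" "Ck_on k S f" "Ck_on k S g"
  shows "Ck_on k S (\<lambda>u. f u + g u)"
  using assms(2,3)
proof (induction k arbitrary: f g)
  case 0
  then show ?case by (simp add: continuous_on_add)
next
  case (Suc k)
  show ?case
    by (rule Ck_on_Suc_has_derivativeI[OF assms(1)
          has_derivative_add[OF Ck_on_Suc_has_derivative[OF Suc.prems(1)] Ck_on_Suc_has_derivative[OF Suc.prems(2)]]])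
      (use Suc in auto)
qed

text \<open>One induction serves products of functions, of matrices, and of matrices with vectors:
  the product rule yields two terms of the same bilinear shape, in which the undifferentiated factor
  is used with one order of smoothness less.\<close>

lemma Ck_on_bilinear:
  assumes "open S" "bounded_bilinear B" "Ck_on k S f" "Ck_on k S g"
  shows "Ck_on k S (\<lambda>u. B (f u) (g u))"
  using assms(3,4)
proof (induction k arbitrary: f g)
  case 0
  then show ?case using assms(2) by (simp add: bounded_bilinear.continuous_on)
next
  case (Suc k)
  show ?case
    by (rule Ck_on_Suc_has_derivativeI[OF assms(1) bounded_bilinear.FDERIV[OF assms(2)
           Ck_on_Suc_has_derivative[OF Suc.prems(1)] Ck_on_Suc_has_derivative[OF Suc.prems(2)]]])
      (use Suc Ck_on_SucD[OF Suc.prems(1)] Ck_on_SucD[OF Suc.prems(2)] in \<open>auto intro!: Ck_on_add[OF assms(1)]\<close>)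
qed

lemma smooth_on_cong:
  "open S \<Longrightarrow> (\<And>u. u \<in> S \<Longrightarrow> f u = g u) \<Longrightarrow> smooth_on S f \<longleftrightarrow> smooth_on S g"
  using Ck_on_cong unfolding smooth_on_def by metis

lemma smooth_on_const: "smooth_on S (\<lambda>_. c)"
  by (simp add: smooth_on_def Ck_on_const)

lemma smooth_on_add: "open S \<Longrightarrow> smooth_on S f \<Longrightarrow> smooth_on S g \<Longrightarrow> smooth_on S (\<lambda>u. f u + g u)"
  by (simp add: smooth_on_def Ck_on_add)

lemma smooth_on_bounded_linear:
  "open S \<Longrightarrow> bounded_linear L \<Longrightarrow> smooth_on S f \<Longrightarrow> smooth_on S (\<lambda>u. L (f u))"
  by (simp add: smooth_on_def Ck_on_bounded_linear)

lemma smooth_on_bilinear: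
  "open S \<Longrightarrow> bounded_bilinear B \<Longrightarrow> smooth_on S f \<Longrightarrow> smooth_on S g \<Longrightarrow> smooth_on S (\<lambda>u. B (f u) (g u))"
  by (simp add: smooth_on_def Ck_on_bilinear)

lemma smooth_on_minus: "open S \<Longrightarrow> smooth_on S f \<Longrightarrow> smooth_on S (\<lambda>u. - f u)"
  by (rule smooth_on_bounded_linear[OF _ bounded_linear_minus[OF bounded_linear_ident]])

lemma smooth_on_diff: "open S \<Longrightarrow> smooth_on S f \<Longrightarrow> smooth_on S g \<Longrightarrow> smooth_on S (\<lambda>u. f u - g u)"
  using smooth_on_add[of S f "\<lambda>u. - g u"] smooth_on_minus by fastforce

lemma smooth_on_sum:
  "open S \<Longrightarrow> (\<And>i. i \<in> I \<Longrightarrow> smooth_on S (f i)) \<Longrightarrow> smooth_on S (\<lambda>u. \<Sum>i\<in>I. f i u)"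
  by (induction I rule: infinite_finite_induct) (auto intro!: smooth_on_add smooth_on_const)

lemmas smooth_on_scaleR = smooth_on_bilinear[OF _ bounded_bilinear_scaleR]
lemmas smooth_on_mult = smooth_on_bilinear[OF _ bounded_bilinear_mult]

lemma smooth_on_frechet_derivative:
  "smooth_on S f \<Longrightarrow> smooth_on S (\<lambda>u. frechet_derivative f (at u) v)"
  unfolding smooth_on_def using Ck_on.simps(2) by blast

lemma smooth_on_differentiable: "smooth_on S f \<Longrightarrow> u \<in> S \<Longrightarrow> f differentiable (at u)"
  unfolding smooth_on_def using Ck_on.simps(2) by blast

lemma smooth_on_has_derivative:
  "smooth_on S f \<Longrightarrow> u \<in> S \<Longrightarrow> (f has_derivative frechet_derivative f (at u)) (at u)"
  using smooth_on_differentiable frechet_derivative_works by blast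

lemma smooth_on_continuous_on: "smooth_on S f \<Longrightarrow> continuous_on S f"
  unfolding smooth_on_def using Ck_on.simps(1) by blast

section \<open>Matrix operations as linear and bilinear maps\<close>

lemma bounded_bilinear_matrix_mult:
  "bounded_bilinear ((**) :: real^'a::finite^'b::finite \<Rightarrow> real^'c::finite^'a \<Rightarrow> real^'c^'b)"
  unfolding bilinear_conv_bounded_bilinear[symmetric] bilinear_def
  by (auto intro!: linearI simp: matrix_matrix_mult_def vec_eq_iff algebra_simps sum.distrib sum_distrib_left)

lemma bounded_bilinear_matrix_vector_mult:
  "bounded_bilinear ((*v) :: real^'a::finite^'b::finite \<Rightarrow> real^'a \<Rightarrow> real^'b)"
  unfolding bilinear_conv_bounded_bilinear[symmetric] bilinear_def
  by (auto intro!: linearI simp: matrix_vector_mult_def vec_eq_iff algebra_simps sum.distrib sum_distrib_left)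

lemmas smooth_on_matrix_mult = smooth_on_bilinear[OF _ bounded_bilinear_matrix_mult]
lemmas smooth_on_matrix_vector_mult = smooth_on_bilinear[OF _ bounded_bilinear_matrix_vector_mult]

lemma bounded_linear_transpose: "bounded_linear (transpose :: real^'a::finite^'b::finite \<Rightarrow> _)"
  unfolding linear_conv_bounded_linear[symmetric]
  by (auto intro!: linearI simp: transpose_def vec_eq_iff)

lemma bounded_linear_trace: "bounded_linear (trace :: real^'a::finite^'a \<Rightarrow> real)"
  unfolding linear_conv_bounded_linear[symmetric]
  by (auto intro!: linearI simp: trace_def sum.distrib sum_distrib_left)

lemma bounded_linear_matrix_nth: "bounded_linear (\<lambda>M :: real^'a::finite^'b::finite. M $ i $ j)"
  by (rule bounded_linear_compose[OF bounded_linear_vec_nth bounded_linear_vec_nth])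

lemma smooth_on_matrixI:
  fixes f :: "'b::real_normed_vector \<Rightarrow> real^'a::finite^'c::finite"
  assumes "open S" "\<And>i j. smooth_on S (\<lambda>u. f u $ i $ j)"
  shows "smooth_on S f"
proof -
  have "smooth_on S (\<lambda>u. \<Sum>i\<in>UNIV. \<Sum>j\<in>UNIV. f u $ i $ j *\<^sub>R (axis i (axis j 1) :: real^'a^'c))"
    using assms by (intro smooth_on_sum smooth_on_scaleR smooth_on_const) auto
  moreover have "(\<Sum>i\<in>UNIV. \<Sum>j\<in>UNIV. f u $ i $ j *\<^sub>R (axis i (axis j 1) :: real^'a^'c)) = f u" for u
  proof -
    have "(\<Sum>i\<in>UNIV. \<Sum>j\<in>UNIV. f u $ i $ j *\<^sub>R (axis i (axis j 1) :: real^'a^'c)) $ a $ b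
       = (\<Sum>i\<in>UNIV. \<Sum>j\<in>UNIV. if i = a then if j = b then f u $ i $ j else 0 else 0)" for a b
      by (auto simp: axis_def intro!: sum.cong)
    also have "\<dots> a b = f u $ a $ b" for a b
      by (subst sum.cong[OF refl, of _ _ "\<lambda>i. if i = a then f u $ a $ b else 0"]) auto
    finally show ?thesis by (simp add: vec_eq_iff)
  qed
  ultimately show ?thesis by simp
qed

section \<open>Partial derivatives and their symmetry\<close>

definition pd :: "'n::finite \<Rightarrow> (real^'n \<Rightarrow> 'c::real_normed_vector) \<Rightarrow> real^'n \<Rightarrow> 'c" where
  "pd i f u = frechet_derivative f (at u) (axis i 1)"

lemma smooth_on_pd: "smooth_on S f \<Longrightarrow> smooth_on S (pd i f)"
  using smooth_on_frechet_derivative[of S f] by (simp add: pd_def[abs_def])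

lemma pd_eqI: "(f has_derivative f') (at u) \<Longrightarrow> pd i f u = f' (axis i 1)"
  using frechet_derivative_at pd_def by metis

lemma pd_cong: "open S \<Longrightarrow> u \<in> S \<Longrightarrow> (\<And>y. y \<in> S \<Longrightarrow> f y = g y) \<Longrightarrow> f differentiable (at u) \<Longrightarrow> pd i f u = pd i g u"
  by (simp add: pd_def frechet_derivative_transform_within_open)

lemma pd_const: "pd i (\<lambda>_. c) u = 0"
  by (simp add: pd_def)

lemma pd_add: "f differentiable (at u) \<Longrightarrow> g differentiable (at u) \<Longrightarrow> pd i (\<lambda>u. f u + g u) u = pd i f u + pd i g u"
  by (rule trans[OF pd_eqI[OF has_derivative_add]]) (auto simp: pd_def frechet_derivative_works)

lemma pd_diff: "f differentiable (at u) \<Longrightarrow> g differentiable (at u) \<Longrightarrow> pd i (\<lambda>u. f u - g u) u = pd i f u - pd i g u"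
  by (rule trans[OF pd_eqI[OF has_derivative_diff]]) (auto simp: pd_def frechet_derivative_works)

lemma pd_sum: "(\<And>i. i \<in> I \<Longrightarrow> f i differentiable (at u)) \<Longrightarrow> pd j (\<lambda>u. \<Sum>i\<in>I. f i u) u = (\<Sum>i\<in>I. pd j (f i) u)"
  by (rule trans[OF pd_eqI[OF has_derivative_sum]]) (auto simp: pd_def frechet_derivative_works)

lemma pd_bounded_linear: "bounded_linear L \<Longrightarrow> f differentiable (at u) \<Longrightarrow> pd i (\<lambda>u. L (f u)) u = L (pd i f u)"
  by (rule trans[OF pd_eqI[OF bounded_linear.has_derivative]]) (auto simp: pd_def frechet_derivative_works)

lemma pd_bilinear:
  "bounded_bilinear B \<Longrightarrow> f differentiable (at u) \<Longrightarrow> g differentiable (at u) \<Longrightarrow>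
   pd i (\<lambda>u. B (f u) (g u)) u = B (f u) (pd i g u) + B (pd i f u) (g u)"
  by (rule trans[OF pd_eqI[OF bounded_bilinear.FDERIV]]) (auto simp: pd_def frechet_derivative_works)

lemma linear_sum_axis:
  fixes L :: "real^'n::finite \<Rightarrow> 'c::real_normed_vector"
  assumes "linear L"
  shows "L v = (\<Sum>i\<in>UNIV. v $ i *\<^sub>R L (axis i 1))"
proof -
  have "v = (\<Sum>i\<in>UNIV. v $ i *\<^sub>R axis i 1)"
    by (simp add: vec_eq_iff axis_def if_distrib cong: if_cong)
  then have "L v = L (\<Sum>i\<in>UNIV. v $ i *\<^sub>R axis i 1)" by simp
  then show ?thesis using assms by (simp add: linear_sum linear_cmul)
qed

lemma frechet_derivative_sum_pd:
  "f differentiable (at u) \<Longrightarrow> frechet_derivative f (at u) v = (\<Sum>i\<in>UNIV. v $ i *\<^sub>R pd i f u)"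
  unfolding pd_def by (rule linear_sum_axis) (rule linear_frechet_derivative)

text \<open>The mean value theorem, used twice, turns the second difference over a parallelogram
  with sides hv and hw into h^2 times a mixed derivative at a nearby point, in either order of v and
  w. Continuity of the mixed derivatives then lets h shrink.\<close>

lemma second_derivative_symmetric_real:
  fixes f :: "'b::real_normed_vector \<Rightarrow> real"
  assumes S: "open S" "u \<in> S" and f: "Ck_on 2 S f"
  shows "frechet_derivative (\<lambda>y. frechet_derivative f (at y) v) (at u) w
       = frechet_derivative (\<lambda>y. frechet_derivative f (at y) w) (at u) v"
proof -
  define DD where "DD v w y = frechet_derivative (\<lambda>y. frechet_derivative f (at y) v) (at y) w" for v w y
  have f': "\<And>v. Ck_on 1 S (\<lambda>u. frechet_derivative f (at u) v)"
    and df: "\<And>y. y \<in> S \<Longrightarrow> (f has_derivative frechet_derivative f (at y)) (at y)"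
    using f by (auto simp: numeral_2_eq_2 frechet_derivative_works[symmetric])
  have ddf: "((\<lambda>y. frechet_derivative f (at y) v) has_derivative (\<lambda>w. DD v w y)) (at y)" if "y \<in> S" for y v
    unfolding DD_def using f' that by (simp add: frechet_derivative_works[symmetric])
  have cont: "continuous_on S (DD v w)" for v w
    unfolding DD_def using f' by simp
  obtain r where r: "r > 0" "cball u r \<subseteq> S"
    using S open_contains_cball by blast
  have line: "((\<lambda>s. F (a + s *\<^sub>R v)) has_real_derivative F' v) (at s)"
    if "(F has_derivative F') (at (a + s *\<^sub>R v))" for F :: "'b \<Rightarrow> real" and F' a s v
  proof -
    have "((\<lambda>s. F (a + s *\<^sub>R v)) has_derivative (\<lambda>h. F' (h *\<^sub>R v))) (at s)"
      by (rule has_derivative_compose[of "\<lambda>s. a + s *\<^sub>R v" "\<lambda>h. h *\<^sub>R v" s UNIV F F'])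
         (auto intro!: derivative_eq_intros simp: that)
    moreover have "F' (h *\<^sub>R v) = F' v * h" for h
      using has_derivative_linear[OF that] by (simp add: linear_cmul)
    ultimately show ?thesis by (simp add: has_field_derivative_def)
  qed
  \<comment> \<open>The second difference of \<open>f\<close> over a small parallelogram is symmetric in \<open>v\<close> and \<open>w\<close>.\<close>
  have key: "\<exists>x. dist x u \<le> h * (norm v + norm w) \<and>
      f (u + h *\<^sub>R v + h *\<^sub>R w) - f (u + h *\<^sub>R v) - f (u + h *\<^sub>R w) + f u = h * h * DD v w x"
    if h: "h > 0" "h * (norm v + norm w) \<le> r" for h v w
  proof -
    have near: "dist (u + s *\<^sub>R v + t *\<^sub>R w) u \<le> h * (norm v + norm w)" if "0 \<le> s" "s \<le> h" "0 \<le> t" "t \<le> h" for s t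
    proof -
      have "norm (s *\<^sub>R v + t *\<^sub>R w) \<le> s * norm v + t * norm w"
        using that by (metis abs_of_nonneg norm_scaleR norm_triangle_ineq)
      also have "\<dots> \<le> h * norm v + h * norm w"
        using that by (intro add_mono mult_right_mono) auto
      finally show ?thesis by (simp add: dist_norm algebra_simps)
    qed
    have inS: "u + s *\<^sub>R v + t *\<^sub>R w \<in> S" if "0 \<le> s" "s \<le> h" "0 \<le> t" "t \<le> h" for s t
      using near[OF that] h r by (auto simp: dist_commute)
    \<comment> \<open>The second difference is the increment of \<open>?p\<close> over [0, h]; its
      mean value in the direction \<open>v\<close> is an increment of \<open>?q\<close>, whose mean
      value is taken in the direction \<open>w\<close>.\<close>
    let ?p = "\<lambda>s. f ((u + h *\<^sub>R w) + s *\<^sub>R v) - f (u + s *\<^sub>R v)"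
    let ?p' = "\<lambda>s. frechet_derivative f (at ((u + h *\<^sub>R w) + s *\<^sub>R v)) v - frechet_derivative f (at (u + s *\<^sub>R v)) v"
    have "(?p has_real_derivative ?p' s) (at s)" if "0 \<le> s" "s \<le> h" for s
      using inS[of s h] inS[of s 0] that h
      by (intro DERIV_diff line df) (auto simp: algebra_simps)
    from MVT2[OF h(1), of ?p ?p'] this obtain s where s: "0 < s" "s < h" "?p h - ?p 0 = h * ?p' s"
      by auto
    let ?q = "\<lambda>t. frechet_derivative f (at ((u + s *\<^sub>R v) + t *\<^sub>R w)) v"
    have "(?q has_real_derivative DD v w ((u + s *\<^sub>R v) + t *\<^sub>R w)) (at t)" if "0 \<le> t" "t \<le> h" for t
      by (rule line[OF ddf]) (use inS[of s t] that s in auto)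
    from MVT2[OF h(1), of ?q "\<lambda>t. DD v w ((u + s *\<^sub>R v) + t *\<^sub>R w)"] this obtain t where t: "0 < t" "t < h"
      "?q h - ?q 0 = h * DD v w ((u + s *\<^sub>R v) + t *\<^sub>R w)" by force
    have "?p' s = ?q h - ?q 0" by (simp add: algebra_simps)
    then have "?p h - ?p 0 = h * h * DD v w (u + s *\<^sub>R v + t *\<^sub>R w)" using s t by simp
    moreover have "?p h - ?p 0 = f (u + h *\<^sub>R v + h *\<^sub>R w) - f (u + h *\<^sub>R v) - f (u + h *\<^sub>R w) + f u"
      by (simp add: algebra_simps)
    ultimately show ?thesis using near[of s t] s t by auto
  qed
  have "DD v w u = DD w v u"
  proof (rule ccontr)
    assume ne: "DD v w u \<noteq> DD w v u"
    \<comment> \<open>Half the gap: a number within \<open>e\<close> of \<open>DD v w u\<close>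
      cannot also be within \<open>e\<close> of \<open>DD w v u\<close>.\<close>
    define e where "e = \<bar>DD v w u - DD w v u\<bar> / 2"
    have e: "e > 0" using ne by (simp add: e_def)
    have "isCont (DD v w) u" "isCont (DD w v) u"
      using cont S by (auto simp: continuous_on_eq_continuous_at)
    then obtain d1 d2 where d: "d1 > 0" "\<And>x. dist x u < d1 \<Longrightarrow> \<bar>DD v w x - DD v w u\<bar> < e"
      "d2 > 0" "\<And>x. dist x u < d2 \<Longrightarrow> \<bar>DD w v x - DD w v u\<bar> < e"
      using e unfolding continuous_at_eps_delta by (auto simp: dist_real_def) metis
    \<comment> \<open>Keeps the parallelogram strictly within the radii \<open>r\<close>,
      \<open>d1\<close> and \<open>d2\<close>; the \<open>+ 1\<close> makes the denominator positive
      even for \<open>v = w = 0\<close>.\<close>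
    define h where "h = min r (min d1 d2) / (2 * (norm v + norm w + 1))"
    have n1: "norm v + norm w + 1 > 0" by (smt (verit) norm_ge_zero)
    have h: "h > 0" using r d n1 by (simp add: h_def)
    have "h * (norm v + norm w) < h * (2 * (norm v + norm w + 1))"
      using h n1 by (intro mult_strict_left_mono) auto
    also have "\<dots> = min r (min d1 d2)" using n1 by (simp add: h_def)
    finally have hl: "h * (norm v + norm w) < min r (min d1 d2)" .
    obtain x where x: "dist x u \<le> h * (norm v + norm w)"
      "f (u + h *\<^sub>R v + h *\<^sub>R w) - f (u + h *\<^sub>R v) - f (u + h *\<^sub>R w) + f u = h * h * DD v w x"
      using key[of h v w] h hl by auto
    obtain y where y: "dist y u \<le> h * (norm w + norm v)"
      "f (u + h *\<^sub>R w + h *\<^sub>R v) - f (u + h *\<^sub>R w) - f (u + h *\<^sub>R v) + f u = h * h * DD w v y"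
      using key[of h w v] h hl by (auto simp: add.commute)
    have "u + h *\<^sub>R w + h *\<^sub>R v = u + h *\<^sub>R v + h *\<^sub>R w" by (simp add: algebra_simps)
    then have "h * h * DD v w x = h * h * DD w v y" using x(2) y(2) by (simp only:)
    then have "DD v w x = DD w v y" using h by simp
    moreover have "\<bar>DD v w x - DD v w u\<bar> < e" "\<bar>DD w v y - DD w v u\<bar> < e"
      using d(2)[of x] d(4)[of y] x(1) y(1) hl by (auto simp: add.commute)
    ultimately show False by (simp add: e_def abs_if split: if_splits)
  qed
  then show ?thesis by (simp add: DD_def)
qed

text \<open>The mean value theorem is real valued, so the symmetry is lifted through the coordinates
  of the target. Vector values are needed for transition maps, matrix values for the metric and the
  Christoffel matrices.\<close>

lemma second_derivative_symmetric:
  fixes f :: "'b::real_normed_vector \<Rightarrow> 'c::euclidean_space"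
  assumes S: "open S" "u \<in> S" and f: "smooth_on S f"
  shows "frechet_derivative (\<lambda>y. frechet_derivative f (at y) v) (at u) w
       = frechet_derivative (\<lambda>y. frechet_derivative f (at y) w) (at u) v"
proof (rule euclidean_eqI)
  fix b :: 'c assume "b \<in> Basis"
  let ?f = "\<lambda>y. f y \<bullet> b"
  have sm: "smooth_on S ?f" by (rule smooth_on_bounded_linear[OF S(1) bounded_linear_inner_left f])
  have b: "frechet_derivative (\<lambda>y. F y \<bullet> b) (at y) = (\<lambda>v. frechet_derivative F (at y) v \<bullet> b)"
    if "F differentiable (at y)" for F :: "'b \<Rightarrow> 'c" and y
    using that frechet_derivative_at[OF bounded_linear.has_derivative[OF bounded_linear_inner_left]]
    unfolding frechet_derivative_works by metis
  have c: "frechet_derivative (\<lambda>y. frechet_derivative ?f (at y) v) (at u) w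
     = frechet_derivative (\<lambda>y. frechet_derivative f (at y) v) (at u) w \<bullet> b" for v w
  proof -
    have "frechet_derivative (\<lambda>y. frechet_derivative f (at y) v \<bullet> b) (at u)
        = frechet_derivative (\<lambda>y. frechet_derivative ?f (at y) v) (at u)"
      using smooth_on_differentiable[OF smooth_on_bounded_linear[OF S(1) bounded_linear_inner_left smooth_on_frechet_derivative[OF f]] S(2)]
        smooth_on_differentiable[OF f]
      by (intro frechet_derivative_transform_within_open[OF _ S]) (auto simp: b)
    then show ?thesis
      using b[OF smooth_on_differentiable[OF smooth_on_frechet_derivative[OF f] S(2)]] by metis
  qed
  show "frechet_derivative (\<lambda>y. frechet_derivative f (at y) v) (at u) w \<bullet> b
      = frechet_derivative (\<lambda>y. frechet_derivative f (at y) w) (at u) v \<bullet> b"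
    using second_derivative_symmetric_real[OF S, of ?f v w] sm c unfolding smooth_on_def by metis
qed

lemma pd_commute:
  fixes f :: "real^'n::finite \<Rightarrow> 'c::euclidean_space"
  shows "open S \<Longrightarrow> u \<in> S \<Longrightarrow> smooth_on S f \<Longrightarrow> pd i (pd j f) u = pd j (pd i f) u"
  unfolding pd_def[abs_def] by (rule second_derivative_symmetric)

section \<open>Determinants and inverse matrices\<close>

lemma det_has_derivative_mat_1:
  "(det has_derivative trace) (at (mat 1 :: real^'n::finite^'n))"
proof -
  let ?I = "mat 1 :: real^'n^'n"
  let ?P = "{p. p permutes (UNIV :: 'n set)}"
  have "((\<lambda>M :: real^'n^'n. of_int (sign p) * (\<Prod>i\<in>UNIV. M $ i $ p i)) has_derivative
     (\<lambda>N. of_int (sign p) * (\<Sum>i\<in>UNIV. N $ i $ p i * (\<Prod>j\<in>UNIV - {i}. ?I $ j $ p j)))) (at ?I)" for p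
    by (intro has_derivative_mult_right has_derivative_prod bounded_linear.has_derivative[OF bounded_linear_matrix_nth] has_derivative_ident)
  then have "(det has_derivative
     (\<lambda>N. \<Sum>p\<in>?P. of_int (sign p) * (\<Sum>i\<in>UNIV. N $ i $ p i * (\<Prod>j\<in>UNIV - {i}. ?I $ j $ p j)))) (at ?I)"
    unfolding det_def by (intro has_derivative_sum)
  moreover have "(\<Sum>p\<in>?P. of_int (sign p) * (\<Sum>i\<in>UNIV. N $ i $ p i * (\<Prod>j\<in>UNIV - {i}. ?I $ j $ p j))) = trace N" for N :: "real^'n^'n"
  proof -
    \<comment> \<open>A permutation other than \<open>id\<close> moves both \<open>a\<close> and
      \<open>p a\<close>, so after removing the factor \<open>i\<close> an off-diagonal entry of the
      identity, hence a zero, is still left.\<close>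
    have z: "(\<Prod>j\<in>UNIV - {i}. ?I $ j $ p j) = 0" if "p permutes UNIV" "p \<noteq> id" for p i
    proof -
      obtain a where a: "p a \<noteq> a" using \<open>p \<noteq> id\<close> by (metis ext id_apply)
      then have "p (p a) \<noteq> p a" using that permutes_inj by (metis injD)
      then obtain j where "j \<in> UNIV - {i}" "p j \<noteq> j" using a by (metis DiffI UNIV_I singletonD)
      then show ?thesis by (intro prod_zero bexI[of _ j]) (auto simp: mat_def)
    qed
    have "(\<Sum>p\<in>?P. of_int (sign p) * (\<Sum>i\<in>UNIV. N $ i $ p i * (\<Prod>j\<in>UNIV - {i}. ?I $ j $ p j)))
      = (\<Sum>p\<in>?P. if p = id then trace N else 0)"
    proof (rule sum.cong[OF refl])
      fix p assume "p \<in> ?P"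
      then show "of_int (sign p) * (\<Sum>i\<in>UNIV. N $ i $ p i * (\<Prod>j\<in>UNIV - {i}. ?I $ j $ p j)) = (if p = id then trace N else 0)"
        using z[of p] by (cases "p = id") (simp add: trace_def mat_def, simp del: prod_zero_iff)
    qed
    also have "\<dots> = trace N" by (simp add: permutes_id)
    finally show ?thesis .
  qed
  ultimately show ?thesis by (simp only: )
qed

lemma invertible_matrix_inv:
  fixes M :: "real^'n::finite^'n"
  assumes "det M \<noteq> 0"
  shows "M ** matrix_inv M = mat 1" "matrix_inv M ** M = mat 1"
  using assms someI_ex[of "\<lambda>A'. M ** A' = mat 1 \<and> A' ** M = mat 1"]
  unfolding invertible_det_nz[symmetric] invertible_def matrix_inv_def by auto

text \<open>Jacobi's formula, carried from the identity matrix to \<open>M\<close> by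
  multiplicativity of the determinant.\<close>

lemma det_has_derivative:
  fixes M :: "real^'n::finite^'n"
  assumes "det M \<noteq> 0"
  shows "(det has_derivative (\<lambda>N. det M * trace (matrix_inv M ** N))) (at M)"
proof -
  have "((\<lambda>X. det M * det (matrix_inv M ** X)) has_derivative (\<lambda>N. det M * trace (matrix_inv M ** N))) (at M)"
  proof -
    have "((\<lambda>X. matrix_inv M ** X) has_derivative (\<lambda>N. matrix_inv M ** N)) (at M)"
      by (rule bounded_linear.has_derivative[OF bounded_bilinear.bounded_linear_right[OF bounded_bilinear_matrix_mult] has_derivative_ident])
    from has_derivative_compose[OF this, of det trace] show ?thesis
      by (intro has_derivative_mult_right) (simp add: invertible_matrix_inv assms det_has_derivative_mat_1)
  qed
  moreover have "det M * det (matrix_inv M ** X) = det X" for X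
    by (simp add: det_mul[symmetric] matrix_mul_assoc invertible_matrix_inv[OF assms])
  ultimately show ?thesis by simp
qed

lemma det_differentiable: "(det :: real^'n::finite^'n \<Rightarrow> real) differentiable (at M)"
proof -
  have "((\<lambda>M :: real^'n^'n. of_int (sign p) * (\<Prod>i\<in>UNIV. M $ i $ p i)) has_derivative
     (\<lambda>N. of_int (sign p) * (\<Sum>i\<in>UNIV. N $ i $ p i * (\<Prod>j\<in>UNIV - {i}. M $ j $ p j)))) (at M)" for p
    by (intro has_derivative_mult_right has_derivative_prod bounded_linear.has_derivative[OF bounded_linear_matrix_nth] has_derivative_ident)
  then have "(det has_derivative
     (\<lambda>N. \<Sum>p\<in>{p. p permutes (UNIV :: 'n set)}. of_int (sign p) * (\<Sum>i\<in>UNIV. N $ i $ p i * (\<Prod>j\<in>UNIV - {i}. M $ j $ p j)))) (at M)"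
    unfolding det_def by (intro has_derivative_sum)
  then show ?thesis by (auto simp: differentiable_def)
qed

text \<open>Cramer's rule: it shows the entries of the inverse to be quotients of determinants, so
  that the inverse is known to be differentiable before its derivative is computed.\<close>

lemma matrix_inv_nth:
  fixes M :: "real^'n::finite^'n"
  assumes "det M \<noteq> 0"
  shows "matrix_inv M $ k $ l = det (\<chi> i j. if j = k then axis l 1 $ i else M $ i $ j) / det M"
proof -
  have "M *v (matrix_inv M *v axis l 1) = axis l 1"
    by (simp add: matrix_vector_mul_assoc invertible_matrix_inv[OF assms])
  then have "matrix_inv M *v axis l 1 = (\<chi> k. det (\<chi> i j. if j = k then axis l 1 $ i else M $ i $ j) / det M)"
    using cramer[OF assms] by blast
  moreover have "matrix_inv M $ k $ l = (matrix_inv M *v axis l 1) $ k"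
    by (simp add: matrix_vector_mult_basis column_def)
  ultimately show ?thesis by simp
qed

lemma differentiable_vecI:
  fixes f :: "'b::real_normed_vector \<Rightarrow> 'c::euclidean_space^'a::finite"
  assumes "\<And>i. (\<lambda>u. f u $ i) differentiable (at x)"
  shows "f differentiable (at x)"
proof -
  have "bounded_linear (\<lambda>c. axis i c :: 'c^'a)" for i
    unfolding linear_conv_bounded_linear[symmetric]
    by (auto intro!: linearI simp: vec_eq_iff axis_def)
  then have "(\<lambda>u. axis i (f u $ i) :: 'c^'a) differentiable (at x)" for i
    using assms[of i] bounded_linear.has_derivative unfolding differentiable_def by blast
  then have "(\<lambda>u. \<Sum>i\<in>UNIV. axis i (f u $ i) :: 'c^'a) differentiable (at x)"
    by (intro differentiable_sum) auto
  moreover have "(\<Sum>i\<in>UNIV. axis i (f u $ i) :: 'c^'a) = f u" for u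
    by (simp add: vec_eq_iff axis_def if_distrib cong: if_cong)
  ultimately show ?thesis by simp
qed

lemma differentiable_matrix_inv:
  fixes G :: "'b::real_normed_vector \<Rightarrow> real^'n::finite^'n"
  assumes S: "open S" "x \<in> S" and G: "G differentiable (at x)" and "\<And>u. u \<in> S \<Longrightarrow> det (G u) \<noteq> 0"
  shows "(\<lambda>u. matrix_inv (G u)) differentiable (at x)"
proof -
  have detG: "(\<lambda>u. det (F u)) differentiable (at x)" if "F differentiable (at x)" for F :: "'b \<Rightarrow> real^'n^'n"
    using differentiable_chain_at[OF that det_differentiable] by (simp add: o_def)
  have Gij: "(\<lambda>u. G u $ i $ j) differentiable (at x)" for i j
    using bounded_linear.has_derivative[OF bounded_linear_matrix_nth] G unfolding differentiable_def by blast
  have "(\<lambda>u. (\<chi> i j. if j = k then axis l 1 $ i else G u $ i $ j) :: real^'n^'n) differentiable (at x)" for k l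
  proof (intro differentiable_vecI)
    fix i j
    show "(\<lambda>u. ((\<chi> i j. if j = k then axis l 1 $ i else G u $ i $ j) :: real^'n^'n) $ i $ j) differentiable (at x)"
      by (cases "j = k") (simp_all add: Gij)
  qed
  then have *: "(\<lambda>u. det (\<chi> i j. if j = k then axis l 1 $ i else G u $ i $ j) / det (G u)) differentiable (at x)" for k l
    using assms by (intro differentiable_divide detG) auto
  have "(\<lambda>u. matrix_inv (G u) $ k $ l) differentiable (at x)" for k l
  proof -
    obtain F' where "((\<lambda>u. det (\<chi> i j. if j = k then axis l 1 $ i else G u $ i $ j) / det (G u)) has_derivative F') (at x)"
      using * unfolding differentiable_def by blast
    then have "((\<lambda>u. matrix_inv (G u) $ k $ l) has_derivative F') (at x)"
      by (rule has_derivative_transform_within_open[OF _ S]) (simp add: matrix_inv_nth assms)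
    then show ?thesis unfolding differentiable_def by blast
  qed
  then show ?thesis by (intro differentiable_vecI)
qed

text \<open>Differentiate \<open>G u ** matrix_inv (G u) = mat 1\<close> and solve for the
  derivative of the inverse.\<close>

lemma matrix_inv_has_derivative:
  fixes G :: "'b::real_normed_vector \<Rightarrow> real^'n::finite^'n"
  assumes S: "open S" "x \<in> S" and G: "(G has_derivative G') (at x)" and nz: "\<And>u. u \<in> S \<Longrightarrow> det (G u) \<noteq> 0"
  shows "((\<lambda>u. matrix_inv (G u)) has_derivative (\<lambda>v. - (matrix_inv (G x) ** G' v ** matrix_inv (G x)))) (at x)"
proof -
  obtain H' where H': "((\<lambda>u. matrix_inv (G u)) has_derivative H') (at x)"
    using differentiable_matrix_inv[where G = G, OF S _ nz] G unfolding differentiable_def by blast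
  have "((\<lambda>u. G u ** matrix_inv (G u)) has_derivative (\<lambda>v. G x ** H' v + G' v ** matrix_inv (G x))) (at x)"
    by (rule bounded_bilinear.FDERIV[OF bounded_bilinear_matrix_mult G H'])
  moreover have "((\<lambda>u. G u ** matrix_inv (G u)) has_derivative (\<lambda>v. 0)) (at x)"
    by (rule has_derivative_transform_within_open[OF has_derivative_const[of "mat 1"] S])
      (simp add: invertible_matrix_inv nz)
  ultimately have "(\<lambda>v. G x ** H' v + G' v ** matrix_inv (G x)) = (\<lambda>v. 0)"
    by (rule has_derivative_unique)
  then have eq: "G x ** H' v + G' v ** matrix_inv (G x) = 0" for v
    by (rule fun_cong)
  have "H' v = - (matrix_inv (G x) ** G' v ** matrix_inv (G x))" for v
  proof -
    have "H' v = matrix_inv (G x) ** (G x ** H' v)"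
      by (simp add: matrix_mul_assoc invertible_matrix_inv nz S)
    also have "G x ** H' v = - (G' v ** matrix_inv (G x))" using eq[of v] by (simp add: add_eq_0_iff2)
    finally show ?thesis
      by (simp add: matrix_mul_assoc bounded_bilinear.minus_right[OF bounded_bilinear_matrix_mult])
  qed
  then show ?thesis using H' by presburger
qed

text \<open>Bootstrapping: the derivative of the inverse is a product of the inverse itself with
  derivatives of \<open>G\<close>, so each order of smoothness of the inverse gives the
  next.\<close>

lemma smooth_on_matrix_inv:
  fixes G :: "'b::real_normed_vector \<Rightarrow> real^'n::finite^'n"
  assumes S: "open S" and G: "smooth_on S G" and nz: "\<And>u. u \<in> S \<Longrightarrow> det (G u) \<noteq> 0"
  shows "smooth_on S (\<lambda>u. matrix_inv (G u))"
  unfolding smooth_on_def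
proof
  fix k
  note d = matrix_inv_has_derivative[OF S _ smooth_on_has_derivative[OF G] nz]
  show "Ck_on k S (\<lambda>u. matrix_inv (G u))"
  proof (induction k)
    case 0
    have "continuous (at x) (\<lambda>u. matrix_inv (G u))" if "x \<in> S" for x
      using d[OF that that] has_derivative_continuous by blast
    then show ?case by (simp add: continuous_at_imp_continuous_on)
  next
    case (Suc k)
    have "Ck_on k S (\<lambda>u. frechet_derivative G (at u) v)" for v
      using G unfolding smooth_on_def by (metis Ck_on.simps(2))
    then have "Ck_on k S (\<lambda>u. - (matrix_inv (G u) ** frechet_derivative G (at u) v ** matrix_inv (G u)))" for v
      using Suc S by (intro Ck_on_bounded_linear[OF S bounded_linear_minus[OF bounded_linear_ident]]
          Ck_on_bilinear[OF S bounded_bilinear_matrix_mult])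
    then show ?case
      by (intro Ck_on_Suc_has_derivativeI[OF S d])
  qed
qed

text \<open>On the segment from the identity to \<open>M\<close> the form stays positive definite,
  so the determinant has no zero there and keeps the sign of its value 1 at the identity.\<close>

lemma pos_def_det_pos:
  fixes M :: "real^'n::finite^'n"
  assumes "\<And>v. v \<noteq> 0 \<Longrightarrow> ip M v v > 0"
  shows "det M > 0"
proof -
  define N where "N t = (1 - t) *\<^sub>R mat 1 + t *\<^sub>R M" for t :: real
  have nz: "det (N t) \<noteq> 0" if "0 \<le> t" "t \<le> 1" for t
  proof
    assume "det (N t) = 0"
    then have "\<not> invertible (N t)" by (simp add: invertible_det_nz)
    then obtain v where v: "v \<noteq> 0" "N t *v v = 0"
      unfolding invertible_left_inverse matrix_left_invertible_ker by blast
    have "v \<bullet> (N t *v v) = (1 - t) * (v \<bullet> v) + t * ip M v v"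
      by (simp add: N_def ip_def matrix_vector_mult_add_rdistrib scaleR_matrix_vector_assoc[symmetric] inner_add_right)
    moreover have "\<dots> > 0"
    proof (cases "t = 0")
      case False
      then have "t * ip M v v > 0" using that assms[OF v(1)] by simp
      moreover have "(1 - t) * (v \<bullet> v) \<ge> 0" using that by simp
      ultimately show ?thesis by linarith
    qed (use v in simp)
    ultimately show False using v by simp
  qed
  have cd: "isCont (det :: real^'n^'n \<Rightarrow> real) X" for X
    using differentiable_imp_continuous_within[OF det_differentiable] by blast
  have "continuous_on {0..1} (\<lambda>t. det (N t))"
    unfolding N_def by (intro continuous_at_imp_continuous_on ballI isCont_o2[OF _ cd] continuous_intros)
  then have "\<not> det (N 1) \<le> 0"
    using IVT2'[of "\<lambda>t. det (N t)" 1 0 0] nz by (force simp: N_def)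
  then show ?thesis by (simp add: N_def)
qed

section \<open>Change of variables\<close>

text \<open>The change-of-variables theorems of HOL-Analysis need a well-ordered index type; \<open>'n idx\<close> is a
  well-ordered copy of \<open>'n\<close>.\<close>

typedef ('n::finite) idx = "{..<CARD('n)}" by (rule exI[of _ 0]) simp
instantiation idx :: (finite) wellorder begin
definition "less_eq_idx (a::'a idx) (b::'a idx) \<longleftrightarrow> Rep_idx a \<le> Rep_idx b"
definition "less_idx (a::'a idx) (b::'a idx) \<longleftrightarrow> Rep_idx a < Rep_idx b"
instance
proof
  fix P :: "'a idx \<Rightarrow> bool" and a
  assume h: "\<And>x. (\<And>y. y < x \<Longrightarrow> P y) \<Longrightarrow> P x"
  show "P a"
    by (induction a rule: measure_induct_rule[of Rep_idx]) (use h less_idx_def in blast)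
qed (auto simp: less_eq_idx_def less_idx_def Rep_idx_inject)
end
instance idx :: (finite) finite
proof
  show "finite (UNIV :: 'a idx set)"
    by (rule finite_imageD[of Rep_idx]) (auto intro: finite_subset[of _ "{..<CARD('a)}"] simp: inj_on_def Rep_idx_inject Rep_idx[simplified])
qed

text \<open>Conjugation by \<open>b\<close> matches the permutations of the two index types and
  preserves signs.\<close>

lemma det_reindex:
  fixes M :: "real^'b::finite^'b" and b :: "'a::finite \<Rightarrow> 'b"
  assumes b: "bij b"
  shows "det (\<chi> i j. M $ b i $ b j) = det M"
proof -
  note mp = map_permutation_permutes[of _ UNIV UNIV]
  have bi: "bij (inv b)" using b by (rule bij_imp_bij_inv)
  have ii: "inv (inv b) = b" using b by (rule inv_inv_eq)
  have e: "map_permutation UNIV c p = c \<circ> p \<circ> inv c" if "bij c" for c :: "'c \<Rightarrow> 'd" and p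
    using that by (auto simp: map_permutation_def restrict_id_def fun_eq_iff bij_is_surj)
  show ?thesis
    unfolding det_def
  proof (rule sum.reindex_bij_witness[where i = "map_permutation UNIV (inv b)" and j = "map_permutation UNIV b"], goal_cases)
    case (1 p)
    then show ?case using b by (auto simp: e b bi ii fun_eq_iff bij_is_inj)
  next
    case (2 p)
    then show ?case using mp b by auto
  next
    case (3 p)
    then show ?case using b by (auto simp: e b bi ii fun_eq_iff bij_is_surj surj_f_inv_f)
  next
    case (4 p)
    then show ?case using mp bi by auto
  next
    case (5 p)
    have "sign (map_permutation UNIV b p) = sign p"
      using 5 b by (intro sign_map_permutation) (auto simp: bij_is_inj)
    moreover have "(\<Prod>i\<in>UNIV. M $ i $ map_permutation UNIV b p i) = (\<Prod>i\<in>UNIV. M $ b i $ b (p i))"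
      using prod.reindex_bij_betw[OF b, of "\<lambda>i. M $ i $ map_permutation UNIV b p i"] b
      by (simp add: e bij_is_inj)
    ultimately show ?case by simp
  qed
qed

lemma prod_Basis_cart: "(\<Prod>b\<in>Basis. (v :: real^'n::finite) \<bullet> b) = (\<Prod>i\<in>UNIV. v $ i)"
proof -
  have B: "(Basis :: (real^'n) set) = range (\<lambda>i. axis i 1)" by (auto simp: Basis_vec_def)
  have "inj (\<lambda>i. axis i 1 :: real^'n)" by (auto simp: inj_def axis_eq_axis)
  then show ?thesis unfolding B by (subst prod.reindex) (auto simp: inner_axis)
qed

text \<open>Renaming coordinates sends boxes to boxes with the same side lengths, and Lebesgue
  measure is determined by its values on boxes.\<close>

lemma distr_lborel_permute:
  fixes b :: "'a::finite \<Rightarrow> 'b::finite"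
  assumes b: "bij b"
  shows "distr lborel borel (\<lambda>x :: real^'b. (\<chi> i. x $ b i) :: real^'a) = lborel"
proof (rule lborel_eqI[symmetric])
  let ?P = "\<lambda>x :: real^'b. (\<chi> i. x $ b i) :: real^'a"
  have m: "?P \<in> borel \<rightarrow>\<^sub>M borel"
    by (intro borel_measurable_continuous_onI continuous_intros)
  fix l u :: "real^'a" assume lu: "\<And>i. i \<in> Basis \<Longrightarrow> l \<bullet> i \<le> u \<bullet> i"
  define l' u' where "l' = (\<chi> i. l $ inv b i)" "u' = (\<chi> i. u $ inv b i)"
  have all: "(\<forall>i. Q (inv b i) i) \<longleftrightarrow> (\<forall>i. Q i (b i))" for Q
    by (metis b bij_inv_eq_iff)
  have "l $ i \<le> u $ i" for i
    using lu[of "axis i 1"] by (simp add: inner_axis axis_in_Basis_iff)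
  then have le: "l' \<bullet> i \<le> u' \<bullet> i" if "i \<in> Basis" for i
    using that by (auto simp: Basis_vec_def inner_axis l'_u'_def)
  have "?P -` box l u = box l' u'"
    using b by (auto simp: box_def Basis_vec_def inner_axis l'_u'_def set_eq_iff bij_is_inj) (metis b bij_inv_eq_iff)+
  then have "emeasure (distr lborel borel ?P) (box l u) = emeasure lborel (box l' u')"
    using m by (simp add: emeasure_distr)
  also have "\<dots> = (\<Prod>i\<in>Basis. (u' - l') \<bullet> i)"
    using le by (simp add: emeasure_lborel_box)
  also have "(\<Prod>i\<in>Basis. (u' - l') \<bullet> i) = (\<Prod>i\<in>UNIV. (u - l) $ inv b i)"
    by (simp add: prod_Basis_cart l'_u'_def)
  also have "\<dots> = (\<Prod>i\<in>Basis. (u - l) \<bullet> i)"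
    using prod.reindex_bij_betw[OF bij_imp_bij_inv[OF b], of "\<lambda>i. (u - l) $ i"] by (simp add: prod_Basis_cart)
  finally show "emeasure (distr lborel borel ?P) (box l u) = (\<Prod>i\<in>Basis. (u - l) \<bullet> i)" .
qed simp

text \<open>The formula for absolutely integrable functions is transported along the renaming
  \<open>P\<close> of coordinates, which changes neither Lebesgue measure nor Jacobian determinants.
  Finiteness of the integral over \<open>S\<close> is what makes the nonnegative integrand
  absolutely integrable.\<close>

lemma nn_integral_change_of_variables:
  fixes g h :: "real^'n::finite \<Rightarrow> real^'n" and f F :: "real^'n \<Rightarrow> real"
  assumes S: "S \<in> sets borel" and T: "T \<in> sets borel"
    and der_g: "\<And>x. x \<in> S \<Longrightarrow> (g has_derivative g' x) (at x within S)"
    and der_h: "\<And>y. y \<in> T \<Longrightarrow> (h has_derivative h' y) (at y within T)"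
    and hg: "\<And>x. x \<in> S \<Longrightarrow> g x \<in> T \<and> h (g x) = x"
    and gh: "\<And>y. y \<in> T \<Longrightarrow> h y \<in> S \<and> g (h y) = y"
    and id: "\<And>y. y \<in> T \<Longrightarrow> h' y \<circ> g' (h y) = id"
    and f: "(\<lambda>y. indicator T y * f y) \<in> borel_measurable borel" and f0: "\<And>y. y \<in> T \<Longrightarrow> 0 \<le> f y"
    and F: "(\<lambda>x. indicator S x * F x) \<in> borel_measurable borel"
    and Ff: "\<And>x. x \<in> S \<Longrightarrow> F x = \<bar>det (matrix (g' x))\<bar> * f (g x)"
    and fin: "(\<integral>\<^sup>+x. ennreal (indicator S x * F x) \<partial>lborel) < \<infinity>"
  shows "(\<integral>\<^sup>+y. ennreal (indicator T y * f y) \<partial>lborel) = (\<integral>\<^sup>+x. ennreal (indicator S x * F x) \<partial>lborel)"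
proof -
  obtain q :: "'n idx \<Rightarrow> 'n" where q: "bij q"
  proof -
    have "card (UNIV :: 'n idx set) = CARD('n)"
      using card_image[of Rep_idx "UNIV :: 'n idx set"]
      by (simp add: inj_on_def Rep_idx_inject type_definition.Rep_range[OF type_definition_idx])
    then show thesis using that finite_same_card_bij[of "UNIV :: 'n idx set" "UNIV :: 'n set"] by auto
  qed
  define P where "P x = (\<chi> i. x $ inv q i)" for x :: "real^'n idx"
  define P' where "P' y = (\<chi> i. y $ q i)" for y :: "real^'n"
  have PP': "P (P' y) = y" "P' (P x) = x" for x y
    using q by (auto simp: P_def P'_def vec_eq_iff bij_is_surj surj_f_inv_f bij_is_inj)
  have lP: "bounded_linear P" "bounded_linear P'"
    unfolding linear_conv_bounded_linear[symmetric] by (auto intro!: linearI simp: P_def P'_def vec_eq_iff)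
  have mP: "P \<in> borel \<rightarrow>\<^sub>M borel"
    by (intro borel_measurable_continuous_onI linear_continuous_on lP)
  have tr: "(\<integral>\<^sup>+x. \<phi> (P x) \<partial>lborel) = (\<integral>\<^sup>+x. \<phi> x \<partial>lborel)" if "\<phi> \<in> borel_measurable borel" for \<phi> :: "real^'n \<Rightarrow> ennreal"
  proof -
    have "distr lborel borel P = lborel"
      using distr_lborel_permute[OF bij_imp_bij_inv[OF q]] by (simp add: P_def[abs_def])
    then show ?thesis using nn_integral_distr[of P lborel borel \<phi>] mP that by simp
  qed
  let ?S = "P -` S" and ?T = "P -` T"
  define I where "I = enn2real (\<integral>\<^sup>+x. ennreal (indicator S x * F x) \<partial>lborel)"
  have I: "(\<integral>\<^sup>+x. ennreal (indicator S x * F x) \<partial>lborel) = ennreal I" "I \<ge> 0"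
    using fin by (auto simp: I_def less_top)
  have F0: "F x \<ge> 0" if "x \<in> S" for x using that Ff f0 hg by simp
  have FI: "((\<lambda>x. F (P x)) has_integral I) ?S"
  proof -
    have "(\<integral>\<^sup>+x. ennreal (indicator S (P x) * F (P x)) \<partial>lborel) = ennreal I"
      using tr[of "\<lambda>x. ennreal (indicator S x * F x)"] F I by simp
    then have "((\<lambda>x. indicator S (P x) * F (P x)) has_integral I) UNIV"
      using F F0 I measurable_compose[OF mP F] by (intro nn_integral_has_integral) (auto simp: indicator_def)
    then show ?thesis
      unfolding has_integral_restrict_UNIV[of ?S "\<lambda>x. F (P x)" I, symmetric]
      by (rule back_subst[where P = "\<lambda>k. (k has_integral I) UNIV"]) (auto simp: indicator_def)
  qed
  let ?g = "\<lambda>x. P' (g (P x))" and ?g' = "\<lambda>x v. P' (g' (P x) (P v))"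
  have der: "((\<lambda>x. P' (k (P x))) has_derivative (\<lambda>v. P' (k' (P v)))) (at x within P -` A)"
    if "(k has_derivative k') (at (P x) within A)" for k :: "real^'n \<Rightarrow> real^'n" and k' x A
  proof -
    have "((\<lambda>x. k (P x)) has_derivative (\<lambda>v. k' (P v))) (at x within P -` A)"
      by (rule has_derivative_in_compose[of P])
        (auto intro: bounded_linear_imp_has_derivative[OF lP(1)] has_derivative_subset[OF that])
    then show ?thesis by (rule bounded_linear.has_derivative[OF lP(2)])
  qed
  have detg: "det (matrix (?g' x)) = det (matrix (g' (P x)))" for x
  proof -
    have "P (axis j 1) = axis (q j) 1" for j
      using q by (auto simp: P_def vec_eq_iff axis_def bij_is_inj bij_is_surj surj_f_inv_f)
    then have "matrix (?g' x) = (\<chi> i j. matrix (g' (P x)) $ q i $ q j)"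
      by (simp add: matrix_def P'_def)
    then show ?thesis using det_reindex[OF q] by metis
  qed
  have "(\<lambda>x. \<bar>det (matrix (?g' x))\<bar> * f (P (?g x))) absolutely_integrable_on ?S \<and>
        integral ?S (\<lambda>x. \<bar>det (matrix (?g' x))\<bar> * f (P (?g x))) = I"
  proof -
    have "((\<lambda>x. \<bar>det (matrix (?g' x))\<bar> * f (P (?g x))) has_integral I) ?S"
      using FI by (rule has_integral_eq[rotated]) (simp add: detg PP' Ff)
    then show ?thesis
      using f0 hg by (auto simp: PP' has_integral_iff intro!: nonnegative_absolutely_integrable_1)
  qed
  then have "(\<lambda>y. f (P y)) absolutely_integrable_on ?T \<and> integral ?T (\<lambda>y. f (P y)) = I"
  proof (subst (asm) cov_invertible_real[where S = ?S and T = ?T and g = ?g and g' = ?g' and f = "\<lambda>y. f (P y)"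
        and h = "\<lambda>y. P' (h (P y))" and h' = "\<lambda>y v. P' (h' (P y) (P v))"], goal_cases)
    case (1 x)
    then show ?case using der der_g by simp
  next
    case (2 y)
    then show ?case using der der_h by simp
  next
    case (5 y)
    then show ?case using id[of "P y"] by (auto simp: PP' fun_eq_iff)
  qed (use hg gh in \<open>auto simp: PP'\<close>)
  then have "((\<lambda>y. f (P y)) has_integral I) ?T"
    using absolutely_integrable_on_def has_integral_iff by blast
  then have "((\<lambda>y. indicator T (P y) * f (P y)) has_integral I) UNIV"
    unfolding has_integral_restrict_UNIV[of ?T "\<lambda>x. f (P x)" I, symmetric]
    by (rule back_subst[where P = "\<lambda>k. (k has_integral I) UNIV"]) (auto simp: indicator_def)
  then have "(\<integral>\<^sup>+y. ennreal (indicator T (P y) * f (P y)) \<partial>lborel) = ennreal I"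
    using f f0 measurable_compose[OF mP f] by (intro nn_integral_has_integral_lborel) (auto simp: indicator_def)
  then show ?thesis using tr[of "\<lambda>x. ennreal (indicator T x * f x)"] f I by simp
qed

section \<open>Metrics in a chart\<close>

lemma ip_axis: "ip M (axis i 1) (axis j 1) = M $ i $ j"
  by (simp add: ip_def inner_axis' matrix_vector_mult_basis column_def)

lemma ip_transpose: "ip M v w = ip (transpose M) w v"
  by (simp add: ip_def dot_lmul_matrix[symmetric] inner_commute)

lemma ip_eq_iff: "(\<forall>v w. ip M v w = ip N v w) \<longleftrightarrow> M = N"
  by (metis ip_axis vec_eq_iff)

lemma ip_matrix_left: "ip M (A *v v) w = ip (transpose A ** M) v w"
  by (metis dot_lmul_matrix ip_def matrix_vector_mul_assoc transpose_transpose vector_transpose_matrix)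

lemma ip_matrix_right: "ip M v (A *v w) = ip (M ** A) v w"
  by (simp add: ip_def matrix_vector_mul_assoc)

lemma ip_add_matrix: "ip (M + N) v w = ip M v w + ip N v w"
  by (simp add: ip_def matrix_vector_mult_add_rdistrib inner_add_right)

lemma ip_diff_matrix: "ip (M - N) v w = ip M v w - ip N v w"
  by (simp add: ip_def matrix_vector_mult_diff_rdistrib inner_diff_right)

lemma ip_scaleR_matrix: "ip (c *\<^sub>R M) v w = c * ip M v w"
  by (simp add: ip_def scaleR_matrix_vector_assoc[symmetric])

lemma bounded_linear_ip_matrix: "bounded_linear (\<lambda>M. ip M v w)"
  unfolding linear_conv_bounded_linear[symmetric]
  by (auto intro!: linearI simp: ip_add_matrix ip_scaleR_matrix)

lemma bounded_bilinear_ip: "bounded_bilinear (ip M)"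
  unfolding bilinear_conv_bounded_bilinear[symmetric] bilinear_def ip_def
  by (auto intro!: linearI simp: inner_add_left inner_add_right matrix_vector_right_distrib
      matrix_vector_mult_scaleR)

lemmas ip_add_left = bounded_bilinear.add_left[OF bounded_bilinear_ip]
lemmas ip_add_right = bounded_bilinear.add_right[OF bounded_bilinear_ip]
lemmas ip_diff_left = bounded_bilinear.diff_left[OF bounded_bilinear_ip]
lemmas ip_diff_right = bounded_bilinear.diff_right[OF bounded_bilinear_ip]
lemmas ip_scaleR_left = bounded_bilinear.scaleR_left[OF bounded_bilinear_ip]
lemmas ip_scaleR_right = bounded_bilinear.scaleR_right[OF bounded_bilinear_ip]
lemmas ip_sum_left = bounded_bilinear.sum_left[OF bounded_bilinear_ip]

lemma sharp_eqI:
  assumes "\<And>v. v \<noteq> 0 \<Longrightarrow> ip M v v > 0" "\<And>z. ip M w z = \<alpha> z"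
  shows "sharp M \<alpha> = w"
  unfolding sharp_def
proof (rule the_equality)
  fix w' assume w': "\<forall>z. ip M w' z = \<alpha> z"
  then have "ip M (w' - w) (w' - w) = 0" using assms(2) by (simp add: ip_diff_left)
  then show "w' = w" using assms(1)[of "w' - w"] by force
qed (use assms in blast)

text \<open>The dual vector is the inverse of the transposed matrix applied to the coefficients of
  the form; the transpose appears because the unknown sits in the first slot of \<open>ip M\<close>
  and symmetry of \<open>M\<close> is not assumed.\<close>

lemma ip_sharp:
  fixes M :: "real^'n::finite^'n"
  assumes pos: "\<And>v. v \<noteq> 0 \<Longrightarrow> ip M v v > 0" and lin: "linear \<alpha>"
  shows "ip M (sharp M \<alpha>) z = \<alpha> z"
proof -
  have "det (transpose M) \<noteq> 0" using pos_def_det_pos[OF pos] by simp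
  define a where "a = (\<chi> i. \<alpha> (axis i 1))"
  have "\<alpha> z = a \<bullet> z" for z
    using linear_sum_axis[OF lin, of z] by (simp add: a_def inner_vec_def mult.commute)
  moreover have "ip M (matrix_inv (transpose M) *v a) z = a \<bullet> z" for z
    by (subst ip_transpose)
      (simp add: ip_def matrix_vector_mul_assoc invertible_matrix_inv[OF \<open>det (transpose M) \<noteq> 0\<close>] inner_commute)
  ultimately have "sharp M \<alpha> = matrix_inv (transpose M) *v a" "ip M (matrix_inv (transpose M) *v a) z = \<alpha> z"
    by (intro sharp_eqI pos, simp_all)
  then show ?thesis by simp
qed


lemma ip_nondegenerate:
  assumes "\<And>v. v \<noteq> 0 \<Longrightarrow> ip M v v > 0" "\<And>z. ip M a z = ip M b z"
  shows "a = b"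
  using sharp_eqI[of M a "ip M b"] sharp_eqI[of M b "ip M b"] assms by metis

lemma transpose_add: "transpose (A + B) = transpose A + transpose (B :: real^'a::finite^'b::finite)"
  by (rule linear_add[OF bounded_linear.linear[OF bounded_linear_transpose]])

lemma transpose_diff: "transpose (A - B) = transpose A - transpose (B :: real^'a::finite^'b::finite)"
  by (rule linear_diff[OF bounded_linear.linear[OF bounded_linear_transpose]])

lemmas matrix_mult_distribs =
  bounded_bilinear.add_left[OF bounded_bilinear_matrix_mult] bounded_bilinear.add_right[OF bounded_bilinear_matrix_mult]
  bounded_bilinear.diff_left[OF bounded_bilinear_matrix_mult] bounded_bilinear.diff_right[OF bounded_bilinear_matrix_mult]
  bounded_bilinear.minus_left[OF bounded_bilinear_matrix_mult] bounded_bilinear.minus_right[OF bounded_bilinear_matrix_mult]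
  bounded_bilinear.scaleR_left[OF bounded_bilinear_matrix_mult] bounded_bilinear.scaleR_right[OF bounded_bilinear_matrix_mult]

lemmas matrix_vector_distribs =
  bounded_bilinear.add_left[OF bounded_bilinear_matrix_vector_mult] bounded_bilinear.add_right[OF bounded_bilinear_matrix_vector_mult]
  bounded_bilinear.diff_left[OF bounded_bilinear_matrix_vector_mult] bounded_bilinear.diff_right[OF bounded_bilinear_matrix_vector_mult]
  bounded_bilinear.minus_left[OF bounded_bilinear_matrix_vector_mult] bounded_bilinear.minus_right[OF bounded_bilinear_matrix_vector_mult]
  bounded_bilinear.scaleR_left[OF bounded_bilinear_matrix_vector_mult] bounded_bilinear.scaleR_right[OF bounded_bilinear_matrix_vector_mult]
  bounded_bilinear.sum_left[OF bounded_bilinear_matrix_vector_mult] bounded_bilinear.sum_right[OF bounded_bilinear_matrix_vector_mult]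

lemmas pd_matrix_mult = pd_bilinear[OF bounded_bilinear_matrix_mult]
lemmas pd_matrix_vector_mult = pd_bilinear[OF bounded_bilinear_matrix_vector_mult]
lemmas pd_scaleR = pd_bilinear[OF bounded_bilinear_scaleR]
lemmas pd_transpose = pd_bounded_linear[OF bounded_linear_transpose]

text \<open>The domain is an arbitrary open set so that the locale applies both to the image of a
  chart and to the overlap of two charts.\<close>

locale chart_metric =
  fixes U :: "(real^'n::finite) set" and G :: "real^'n \<Rightarrow> real^'n^'n"
  assumes open_U: "open U" and smooth_G: "smooth_on U G"
    and ip_commute: "\<And>u v w. u \<in> U \<Longrightarrow> ip (G u) v w = ip (G u) w v"
    and ip_pos: "\<And>u v. u \<in> U \<Longrightarrow> v \<noteq> 0 \<Longrightarrow> ip (G u) v v > 0"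
begin

abbreviation "H u \<equiv> matrix_inv (G u)"

lemma det_G_pos: "u \<in> U \<Longrightarrow> det (G u) > 0"
  by (rule pos_def_det_pos) (rule ip_pos)

lemma det_G_neq_0: "u \<in> U \<Longrightarrow> det (G u) \<noteq> 0"
  using det_G_pos by force

lemma G_H: "u \<in> U \<Longrightarrow> G u ** H u = mat 1" and H_G: "u \<in> U \<Longrightarrow> H u ** G u = mat 1"
  using invertible_matrix_inv det_G_neq_0 by blast+

lemma transpose_G: "u \<in> U \<Longrightarrow> transpose (G u) = G u"
  unfolding ip_eq_iff[symmetric] using ip_commute ip_transpose by metis

lemma transpose_H: "u \<in> U \<Longrightarrow> transpose (H u) = H u"
  by (metis G_H H_G matrix_mul_assoc matrix_mul_lid matrix_mul_rid matrix_transpose_mul transpose_G transpose_mat)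

lemma smooth_H: "smooth_on U H"
  using smooth_on_matrix_inv[OF open_U smooth_G det_G_neq_0] .

lemma pd_H: "u \<in> U \<Longrightarrow> pd i H u = - (H u ** pd i G u ** H u)"
  by (rule trans[OF pd_eqI[OF matrix_inv_has_derivative[OF open_U _ smooth_on_has_derivative[OF smooth_G] det_G_neq_0]]])
    (auto simp: pd_def)

lemma frechet_derivative_ip:
  "u \<in> U \<Longrightarrow> frechet_derivative (\<lambda>y. ip (G y) v w) (at u) z = ip (frechet_derivative G (at u) z) v w"
  using frechet_derivative_at[OF bounded_linear.has_derivative[OF bounded_linear_ip_matrix smooth_on_has_derivative[OF smooth_G]]]
  by metis

lemma linear_dG: "u \<in> U \<Longrightarrow> linear (frechet_derivative G (at u))"
  using linear_frechet_derivative smooth_on_differentiable smooth_G by blast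

lemma ip_dG_commute:
  assumes "u \<in> U" shows "ip (frechet_derivative G (at u) z) v w = ip (frechet_derivative G (at u) z) w v"
proof -
  have "(\<lambda>y. ip (G y) v w) differentiable (at u)"
    using bounded_linear.has_derivative[OF bounded_linear_ip_matrix smooth_on_has_derivative[OF smooth_G assms]]
    unfolding differentiable_def by blast
  then have "frechet_derivative (\<lambda>y. ip (G y) v w) (at u) = frechet_derivative (\<lambda>y. ip (G y) w v) (at u)"
    by (rule frechet_derivative_transform_within_open[OF _ open_U assms ip_commute])
  then show ?thesis using frechet_derivative_ip[OF assms] by metis
qed

text \<open>The formula can be read off the definition only because its right side is linear in
  \<open>z\<close>: \<open>sharp\<close> represents linear forms.\<close>

lemma koszul:
  assumes u: "u \<in> U"
  shows "2 * ip (G u) (christoffel G u v w) z =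
    ip (frechet_derivative G (at u) v) w z + ip (frechet_derivative G (at u) w) v z - ip (frechet_derivative G (at u) z) v w"
proof -
  have "linear (\<lambda>z. 1/2 * (ip (frechet_derivative G (at u) v) w z + ip (frechet_derivative G (at u) w) v z
      - ip (frechet_derivative G (at u) z) v w))"
    using linear_dG[OF u] by (auto intro!: linearI simp: linear_add linear_cmul ip_add_right ip_scaleR_right
        ip_add_matrix ip_scaleR_matrix field_simps)
  then show ?thesis
    unfolding christoffel_def frechet_derivative_ip[OF u] by (subst ip_sharp[OF ip_pos[OF u]]) auto
qed

lemma christoffel_commute:
  assumes u: "u \<in> U" shows "christoffel G u v w = christoffel G u w v"
proof (rule ip_nondegenerate[OF ip_pos[OF u]])
  show "ip (G u) (christoffel G u v w) z = ip (G u) (christoffel G u w v) z" for z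
    using koszul[OF u, of v w z] koszul[OF u, of w v z] ip_dG_commute[OF u, of z v w] by linarith
qed

lemma linear_christoffel_right:
  assumes u: "u \<in> U" shows "linear (christoffel G u v)"
proof (rule linearI)
  fix a b and c :: real
  note ko = koszul[OF u] linear_add[OF linear_dG[OF u]] linear_cmul[OF linear_dG[OF u]]
  have "2 * ip (G u) (christoffel G u v (a + b)) z = 2 * ip (G u) (christoffel G u v a + christoffel G u v b) z" for z
    by (simp only: distrib_left ip_add_left ko ip_add_right ip_add_matrix)
  then show "christoffel G u v (a + b) = christoffel G u v a + christoffel G u v b"
    by (intro ip_nondegenerate[OF ip_pos[OF u]]) auto
  have "2 * ip (G u) (christoffel G u v (c *\<^sub>R a)) z = 2 * ip (G u) (c *\<^sub>R christoffel G u v a) z" for z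
  proof -
    have "2 * ip (G u) (c *\<^sub>R christoffel G u v a) z = c * (2 * ip (G u) (christoffel G u v a) z)"
      by (simp add: ip_scaleR_left)
    then show ?thesis
      by (simp only: ko ip_scaleR_left ip_scaleR_right ip_scaleR_matrix real_scaleR_def) (simp add: algebra_simps)
  qed
  then show "christoffel G u v (c *\<^sub>R a) = c *\<^sub>R christoffel G u v a"
    by (intro ip_nondegenerate[OF ip_pos[OF u]]) auto
qed

text \<open>The entry in row k and column j is the Christoffel symbol with upper index k and lower
  indices i, j. Contractions of these symbols thus become matrix products.\<close>

definition Gam :: "'n \<Rightarrow> real^'n \<Rightarrow> real^'n^'n" where
  "Gam i u = matrix (christoffel G u (axis i 1))"

lemma Gam_vector: "u \<in> U \<Longrightarrow> Gam i u *v w = christoffel G u (axis i 1) w"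
  unfolding Gam_def using matrix_works linear_christoffel_right by (simp add: matrix_works)

lemma Gam_commute: "u \<in> U \<Longrightarrow> Gam i u $ k $ j = Gam j u $ k $ i"
  by (simp add: Gam_def matrix_def christoffel_commute[of u "axis i 1"])

lemma christoffel_Gam: "u \<in> U \<Longrightarrow> christoffel G u v w = (\<Sum>i\<in>UNIV. v $ i *\<^sub>R (Gam i u *v w))"
  using linear_sum_axis[OF linear_christoffel_right, of u w v]
  by (simp add: Gam_vector christoffel_commute[of u _ w])

text \<open>The metric is parallel. Adding Koszul's formula with the last two vectors exchanged
  cancels everything but the derivative in direction i.\<close>

lemma pd_G:
  assumes u: "u \<in> U" shows "pd i G u = transpose (Gam i u) ** G u + G u ** Gam i u"
proof -
  have "2 * ip (pd i G u) v w = 2 * ip (G u) (christoffel G u (axis i 1) v) w + 2 * ip (G u) (christoffel G u (axis i 1) w) v" for v w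
    unfolding koszul[OF u] using ip_dG_commute[OF u, of _ v w] by (simp add: pd_def)
  then have "ip (pd i G u) v w = ip (G u) (christoffel G u (axis i 1) v) w + ip (G u) v (christoffel G u (axis i 1) w)" for v w
    using ip_commute[OF u, of v "christoffel G u (axis i 1) w"] by (simp add: distrib_left[symmetric] del: distrib_left_numeral)
  then have "ip (pd i G u) v w = ip (transpose (Gam i u) ** G u + G u ** Gam i u) v w" for v w
    unfolding Gam_vector[OF u, symmetric] ip_matrix_left ip_matrix_right ip_add_matrix .
  then show ?thesis
    unfolding ip_eq_iff[symmetric] by blast
qed

text \<open>\<open>christoffel\<close> is a definite description, so smoothness is obtained from an
  explicit formula: \<open>K\<close> is the right side of Koszul's formula, and solving for the
  symbols multiplies it by the inverse metric.\<close>

lemma smooth_Gam: "smooth_on U (Gam i)"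
proof -
  define K where "K u = (\<chi> z j. (1/2) *\<^sub>R (pd i G u $ j $ z + pd j G u $ i $ z - pd z G u $ i $ j))" for u
  have ent: "smooth_on U (\<lambda>u. pd a G u $ b $ c)" for a b c
    by (rule smooth_on_bounded_linear[OF open_U bounded_linear_matrix_nth smooth_on_pd[OF smooth_G]])
  have "smooth_on U K"
    unfolding K_def
    by (intro smooth_on_matrixI open_U)
      (simp del: real_scaleR_def, intro smooth_on_scaleR smooth_on_const smooth_on_diff smooth_on_add open_U ent)
  moreover have "H u ** K u = Gam i u" if u: "u \<in> U" for u
  proof -
    have "ip (G u) (axis z 1) (Gam i u *v axis j 1) = K u $ z $ j" for z j
      using koszul[OF u, of "axis i 1" "axis j 1" "axis z 1"]
      by (simp add: Gam_vector[OF u] ip_commute[OF u, of "axis z 1"] K_def pd_def[symmetric] ip_axis)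
    then have "G u ** Gam i u = K u"
      by (simp add: ip_matrix_right ip_axis vec_eq_iff)
    then show ?thesis by (metis H_G[OF u] matrix_mul_assoc matrix_mul_lid)
  qed
  moreover have "smooth_on U (\<lambda>u. H u ** K u)"
    using calculation(1) by (intro smooth_on_matrix_mult open_U smooth_H)
  ultimately show ?thesis using smooth_on_cong[OF open_U] by (metis (no_types, lifting))
qed

end

section \<open>Curvature\<close>

context chart_metric begin

lemmas differentiable_U = smooth_on_differentiable[where S = U]

definition cov :: "'n \<Rightarrow> (real^'n \<Rightarrow> real^'n) \<Rightarrow> real^'n \<Rightarrow> real^'n" where
  "cov i V u = pd i V u + Gam i u *v V u"

text \<open>\<open>Dm V u\<close> is the matrix of \<open>v \<mapsto> \<nabla>\<^sub>v V\<close>, with column \<open>i\<close> equal to \<open>cov i V = \<nabla>\<^sub>i V\<close>.\<close>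

definition Dm :: "(real^'n \<Rightarrow> real^'n) \<Rightarrow> real^'n \<Rightarrow> real^'n^'n" where
  "Dm V u = (\<chi> k i. cov i V u $ k)"

definition divergence :: "(real^'n \<Rightarrow> real^'n) \<Rightarrow> real^'n \<Rightarrow> real" where
  "divergence V u = (\<Sum>k\<in>UNIV. cov k V u $ k)"

text \<open>The endomorphism R(\<partial>i, \<partial>j) of two coordinate fields, as the curvature
  of the connection with matrices \<open>Gam i\<close>.\<close>

definition Riem :: "'n \<Rightarrow> 'n \<Rightarrow> real^'n \<Rightarrow> real^'n^'n" where
  "Riem i j u = pd i (Gam j) u - pd j (Gam i) u + Gam i u ** Gam j u - Gam j u ** Gam i u"

definition Ric :: "real^'n \<Rightarrow> real^'n^'n" where
  "Ric u = (\<chi> j m. \<Sum>k\<in>UNIV. Riem k j u $ k $ m)"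

text \<open>The transpose places the argument of the Ricci operator in the first slot of the Ricci
  tensor, so the identification with \<open>ricci_operator\<close> does not have to wait for the
  symmetry of that tensor.\<close>

definition Q :: "real^'n \<Rightarrow> real^'n^'n" where
  "Q u = H u ** transpose (Ric u)"

lemma divergence_trace: "divergence V u = trace (Dm V u)"
  by (simp add: divergence_def Dm_def trace_def)

lemma Dm_vector: "Dm V u *v v = (\<Sum>i\<in>UNIV. v $ i *\<^sub>R cov i V u)"
  by (simp add: Dm_def matrix_vector_mult_def vec_eq_iff mult.commute)

lemma nabla_Dm:
  assumes "u \<in> U" "V differentiable (at u)"
  shows "nabla G X V u = Dm V u *v X u"
  using assms by (simp add: nabla_def frechet_derivative_sum_pd christoffel_Gam Dm_vector cov_def
      sum.distrib[symmetric] scaleR_add_right)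

lemma smooth_cov: "smooth_on U V \<Longrightarrow> smooth_on U (cov i V)"
  unfolding cov_def[abs_def]
  by (intro smooth_on_add smooth_on_matrix_vector_mult smooth_on_pd smooth_Gam open_U)

lemma smooth_Dm: "smooth_on U V \<Longrightarrow> smooth_on U (Dm V)"
  unfolding Dm_def[abs_def]
  by (intro smooth_on_matrixI open_U) (simp, intro smooth_on_bounded_linear[OF open_U bounded_linear_vec_nth] smooth_cov)

lemma smooth_divergence: "smooth_on U V \<Longrightarrow> smooth_on U (divergence V)"
  unfolding divergence_def[abs_def]
  by (intro smooth_on_sum smooth_on_bounded_linear[OF open_U bounded_linear_vec_nth] smooth_cov open_U)

lemma smooth_Riem: "smooth_on U (Riem i j)"
  unfolding Riem_def[abs_def]
  by (intro smooth_on_add smooth_on_diff smooth_on_matrix_mult smooth_on_pd smooth_Gam open_U)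

lemma smooth_Ric: "smooth_on U Ric"
  unfolding Ric_def[abs_def]
  by (intro smooth_on_matrixI open_U)
    (simp, intro smooth_on_sum open_U smooth_on_bounded_linear[OF open_U bounded_linear_matrix_nth] smooth_Riem)

lemma smooth_Q: "smooth_on U Q"
  unfolding Q_def[abs_def]
  by (intro smooth_on_matrix_mult smooth_on_bounded_linear[OF open_U bounded_linear_transpose] smooth_Ric smooth_H open_U)

lemma cov_add:
  "u \<in> U \<Longrightarrow> V differentiable (at u) \<Longrightarrow> W differentiable (at u) \<Longrightarrow> cov i (\<lambda>u. V u + W u) u = cov i V u + cov i W u"
  by (simp add: cov_def pd_add matrix_vector_distribs)

lemma cov_scaleR:
  "u \<in> U \<Longrightarrow> f differentiable (at u) \<Longrightarrow> W differentiable (at u) \<Longrightarrow>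
   cov i (\<lambda>u. f u *\<^sub>R W u) u = pd i f u *\<^sub>R W u + f u *\<^sub>R cov i W u"
  by (simp add: cov_def pd_scaleR matrix_vector_distribs scaleR_add_right)

text \<open>The Ricci identity for commuting coordinate fields. In the expansion \<open>c\<close>
  only the derivative of the Christoffel matrix and the product of two of them are not symmetric in
  i and k, and their difference is \<open>Riem k i\<close>. The index i of \<open>cov i V\<close> is
  a mere label and receives no Christoffel term.\<close>

lemma cov_commutator:
  assumes u: "u \<in> U" and V: "smooth_on U V"
  shows "cov k (cov i V) u = cov i (cov k V) u + Riem k i u *v V u"
proof -
  have c: "cov k (cov i V) u = pd k (pd i V) u + Gam i u *v pd k V u + pd k (Gam i) u *v V u
      + Gam k u *v pd i V u + (Gam k u ** Gam i u) *v V u" for i k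
  proof -
    have ci: "cov i V = (\<lambda>y. pd i V y + Gam i y *v V y)" by (simp add: cov_def fun_eq_iff)
    show ?thesis
      unfolding cov_def[of k] ci
      using u V by (simp add: pd_add pd_matrix_vector_mult differentiable_U smooth_on_pd smooth_Gam
        smooth_on_matrix_vector_mult[OF open_U] matrix_vector_distribs matrix_vector_mul_assoc)
  qed
  show ?thesis
    unfolding c Riem_def by (simp add: pd_commute[OF open_U u V] matrix_vector_distribs)
qed

text \<open>Constant fields have vanishing bracket. The inner covariant derivative has its matrix
  form only on \<open>U\<close>, which is enough to differentiate it once more since
  \<open>U\<close> is open.\<close>

lemma riemann_Riem:
  assumes u: "u \<in> U"
  shows "riemann G (\<lambda>_. axis k 1) (\<lambda>_. v) (\<lambda>_. w) u = (\<Sum>j\<in>UNIV. v $ j *\<^sub>R (Riem k j u *v w))"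
proof -
  have sm: "smooth_on U (\<lambda>y. Dm (\<lambda>_. w) y *v v)" for v
    by (intro smooth_on_matrix_vector_mult smooth_Dm smooth_on_const open_U)
  have n: "nabla G (\<lambda>_. v) (\<lambda>_. w) y = Dm (\<lambda>_. w) y *v v" if "y \<in> U" for y v
    using that by (simp add: nabla_Dm)
  have sn: "smooth_on U (nabla G (\<lambda>_. v) (\<lambda>_. w))" for v
    using sm smooth_on_cong[OF open_U n] by simp
  have covc: "cov i (\<lambda>_. w) = (\<lambda>y. Gam i y *v w)" for i
    by (simp add: cov_def[abs_def] pd_const)
  have pdn: "pd i (nabla G (\<lambda>_. v) (\<lambda>_. w)) u = (\<Sum>j\<in>UNIV. v $ j *\<^sub>R (pd i (Gam j) u *v w))" for i v
  proof -
    have "pd i (nabla G (\<lambda>_. v) (\<lambda>_. w)) u = pd i (\<lambda>y. \<Sum>j\<in>UNIV. v $ j *\<^sub>R (Gam j y *v w)) u"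
      using pd_cong[OF open_U u, of "nabla G (\<lambda>_. v) (\<lambda>_. w)"] n differentiable_U[OF sn u]
      by (simp add: Dm_vector covc)
    also have "\<dots> = (\<Sum>j\<in>UNIV. pd i (\<lambda>y. v $ j *\<^sub>R (Gam j y *v w)) u)"
      using u by (intro pd_sum differentiable_U smooth_on_scaleR smooth_on_matrix_vector_mult smooth_on_const smooth_Gam open_U)
    also have "\<dots> = (\<Sum>j\<in>UNIV. v $ j *\<^sub>R (pd i (Gam j) u *v w))"
      using u by (simp add: pd_scaleR pd_matrix_vector_mult pd_const differentiable_U smooth_Gam
          smooth_on_matrix_vector_mult[OF open_U] smooth_on_const)
    finally show ?thesis .
  qed
  have covn: "nabla G (\<lambda>_. z) (nabla G (\<lambda>_. v) (\<lambda>_. w)) u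
     = (\<Sum>i\<in>UNIV. \<Sum>j\<in>UNIV. (z $ i * v $ j) *\<^sub>R ((pd i (Gam j) u + Gam i u ** Gam j u) *v w))" for z v
  proof -
    have "nabla G (\<lambda>_. z) (nabla G (\<lambda>_. v) (\<lambda>_. w)) u = (\<Sum>i\<in>UNIV. z $ i *\<^sub>R cov i (nabla G (\<lambda>_. v) (\<lambda>_. w)) u)"
      using nabla_Dm[OF u differentiable_U[OF sn u]] by (simp add: Dm_vector)
    also have "\<dots> = (\<Sum>i\<in>UNIV. z $ i *\<^sub>R (\<Sum>j\<in>UNIV. v $ j *\<^sub>R ((pd i (Gam j) u + Gam i u ** Gam j u) *v w)))"
      unfolding cov_def pdn n[OF u] Dm_vector covc
      by (simp add: matrix_vector_distribs matrix_vector_mul_assoc sum.distrib scaleR_add_right)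
    finally show ?thesis by (simp add: scaleR_sum_right)
  qed
  have ax: "(\<Sum>i\<in>UNIV. (axis k 1 :: real^'n) $ i *\<^sub>R F i) = F k" for F :: "'n \<Rightarrow> real^'n"
    by (simp add: axis_def if_distrib[of "\<lambda>c. c *\<^sub>R _"] cong: if_cong)
  have "(\<Sum>i\<in>UNIV. \<Sum>j\<in>UNIV. ((axis k 1 :: real^'n) $ i * v $ j) *\<^sub>R M i j) = (\<Sum>j\<in>UNIV. v $ j *\<^sub>R M k j)"
    and "(\<Sum>i\<in>UNIV. \<Sum>j\<in>UNIV. (v $ i * (axis k 1 :: real^'n) $ j) *\<^sub>R M i j) = (\<Sum>j\<in>UNIV. v $ j *\<^sub>R M j k)"
    for M :: "'n \<Rightarrow> 'n \<Rightarrow> real^'n"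
    using ax[of "\<lambda>i. \<Sum>j\<in>UNIV. v $ j *\<^sub>R M i j"] ax[of "M i" for i]
    by (simp_all add: scaleR_sum_right[symmetric] scaleR_scaleR[symmetric] del: scaleR_scaleR)
  note s = this
  have "nabla G (lie_bracket (\<lambda>_. axis k 1) (\<lambda>_. v)) (\<lambda>_. w) u = 0"
    using nabla_Dm[OF u, of "\<lambda>_. w" "lie_bracket (\<lambda>_. axis k 1) (\<lambda>_. v)"] by (simp add: lie_bracket_def)
  then show ?thesis
    unfolding riemann_def covn s Riem_def
    by (simp add: sum_subtractf[symmetric] scaleR_diff_right[symmetric] matrix_vector_distribs algebra_simps)
qed

lemma ricci_Ric: "u \<in> U \<Longrightarrow> ricci G u v w = ip (Ric u) v w"
proof -
  assume u: "u \<in> U"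
  have "ricci G u v w = (\<Sum>k\<in>UNIV. \<Sum>j\<in>UNIV. \<Sum>m\<in>UNIV. v $ j * (Riem k j u $ k $ m * w $ m))"
    unfolding ricci_def riemann_Riem[OF u] by (simp add: matrix_vector_mult_def sum_distrib_left)
  also have "\<dots> = (\<Sum>j\<in>UNIV. \<Sum>k\<in>UNIV. \<Sum>m\<in>UNIV. v $ j * (Riem k j u $ k $ m * w $ m))"
    by (rule sum.swap)
  also have "\<dots> = (\<Sum>j\<in>UNIV. \<Sum>m\<in>UNIV. \<Sum>k\<in>UNIV. v $ j * (Riem k j u $ k $ m * w $ m))"
    by (intro sum.cong refl sum.swap)
  also have "\<dots> = ip (Ric u) v w"
    by (simp add: ip_def inner_vec_def matrix_vector_mult_def Ric_def sum_distrib_left sum_distrib_right)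
  finally show ?thesis .
qed

lemma ricci_operator_Q: "u \<in> U \<Longrightarrow> ricci_operator G u v = Q u *v v"
  unfolding ricci_operator_def
proof (rule sharp_eqI)
  fix z assume u: "u \<in> U"
  have "ip (G u) (Q u *v v) z = ip (Ric u) v z"
    unfolding ip_matrix_left Q_def
    by (simp add: matrix_transpose_mul transpose_H u matrix_mul_assoc[symmetric] H_G)
  then show "ip (G u) (Q u *v v) z = ricci G u v z" using u ricci_Ric by simp
qed (rule ip_pos)

lemma scalar_local_Q: "u \<in> U \<Longrightarrow> scalar_local G u = trace (Q u)"
  by (simp add: scalar_local_def ricci_operator_Q trace_def matrix_vector_mult_basis column_def)

section \<open>Symmetries of the curvature and the second Bianchi identity\<close>

lemma Riem_commute: "Riem j i u = - Riem i j u"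
  by (simp add: Riem_def)

text \<open>Second partial derivatives of the metric commute. Expanding them by \<open>pd_G\<close>
  twice, the part antisymmetric in i and j is exactly the left side.\<close>

lemma Riem_skew:
  assumes u: "u \<in> U" shows "transpose (Riem i j u) ** G u + G u ** Riem i j u = 0"
proof -
  have e: "pd i (pd j G) u = transpose (pd i (Gam j) u) ** G u + transpose (Gam i u ** Gam j u) ** G u
      + transpose (Gam j u) ** G u ** Gam i u + transpose (Gam i u) ** G u ** Gam j u
      + G u ** (Gam i u ** Gam j u) + G u ** pd i (Gam j) u" for i j
  proof -
    note sm = smooth_Gam smooth_G smooth_on_bounded_linear[OF open_U bounded_linear_transpose]
      smooth_on_matrix_mult[OF open_U] smooth_on_pd
    have "pd i (pd j G) u = pd i (\<lambda>u. transpose (Gam j u) ** G u + G u ** Gam j u) u"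
      by (rule pd_cong[OF open_U u pd_G]) (auto intro!: differentiable_U smooth_on_pd smooth_G u)
    also have "\<dots> = transpose (Gam j u) ** pd i G u + transpose (pd i (Gam j) u) ** G u
        + (G u ** pd i (Gam j) u + pd i G u ** Gam j u)"
      using u by (simp add: pd_add pd_matrix_mult pd_transpose sm differentiable_U)
    finally show ?thesis
      by (simp add: pd_G[OF u] matrix_mult_distribs matrix_transpose_mul matrix_mul_assoc)
  qed
  have "pd i (pd j G) u = pd j (pd i G) u" by (rule pd_commute[OF open_U u smooth_G])
  then show ?thesis
    unfolding e Riem_def
    by (simp add: transpose_add transpose_diff matrix_mult_distribs algebra_simps)
qed

text \<open>Raising the last index makes the skewness of the curvature an ordinary antisymmetry of matrices.\<close>

definition Rt :: "'n \<Rightarrow> 'n \<Rightarrow> real^'n \<Rightarrow> real^'n^'n" where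
  "Rt i j u = Riem i j u ** H u"

lemma smooth_Rt: "smooth_on U (Rt i j)"
  unfolding Rt_def[abs_def] by (intro smooth_on_matrix_mult smooth_Riem smooth_H open_U)

lemma Rt_commute: "Rt j i u = - Rt i j u"
  unfolding Rt_def by (subst Riem_commute) (simp add: matrix_mult_distribs)

lemma transpose_Rt:
  assumes u: "u \<in> U" shows "transpose (Rt i j u) = - Rt i j u"
proof -
  have "H u ** (transpose (Riem i j u) ** G u + G u ** Riem i j u) ** H u = 0"
    using Riem_skew[OF u] by (simp add: bounded_bilinear.zero_left[OF bounded_bilinear_matrix_mult] bounded_bilinear.zero_right[OF bounded_bilinear_matrix_mult])
  then have "H u ** transpose (Riem i j u) ** (G u ** H u) + (H u ** G u) ** Riem i j u ** H u = 0"
    by (simp add: matrix_mult_distribs matrix_mul_assoc)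
  then show ?thesis
    by (simp add: Rt_def matrix_transpose_mul transpose_H u G_H H_G eq_neg_iff_add_eq_0)
qed

lemma Rt_nth_commute: "u \<in> U \<Longrightarrow> Rt i j u $ b $ a = - Rt i j u $ a $ b"
  by (drule arg_cong[OF transpose_Rt, of _ "\<lambda>M. M $ a $ b"]) (simp add: transpose_def)

text \<open>Each bracket differentiates \<open>Riem\<close> as an endomorphism only. In the cyclic
  sum the second derivatives of \<open>Gam\<close> cancel because partial derivatives commute, and
  the triple products cancel as in the Jacobi identity.\<close>

lemma Riem_bianchi:
  assumes u: "u \<in> U"
  shows "(pd l (Riem i j) u + Gam l u ** Riem i j u - Riem i j u ** Gam l u)
    + (pd i (Riem j l) u + Gam i u ** Riem j l u - Riem j l u ** Gam i u)
    + (pd j (Riem l i) u + Gam j u ** Riem l i u - Riem l i u ** Gam j u) = 0"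
proof -
  note sm = smooth_Gam smooth_on_matrix_mult[OF open_U] smooth_on_pd smooth_on_add[OF open_U] smooth_on_diff[OF open_U]
  have e: "pd l (Riem i j) u = pd l (pd i (Gam j)) u - pd l (pd j (Gam i)) u
     + (Gam i u ** pd l (Gam j) u + pd l (Gam i) u ** Gam j u)
     - (Gam j u ** pd l (Gam i) u + pd l (Gam j) u ** Gam i u)" for i j l
    unfolding Riem_def[abs_def] using u by (simp add: pd_add pd_diff pd_matrix_mult sm differentiable_U)
  note c = pd_commute[OF open_U u smooth_Gam]
  show ?thesis
    unfolding e Riem_def c[of l i] c[of l j] c[of i j]
    by (simp add: matrix_mult_distribs matrix_mul_assoc algebra_simps)
qed

text \<open>\<open>E l i j\<close> is \<open>\<nabla>\<^sub>l\<close> of \<open>Rt i j\<close> without the Christoffel terms for the lower indices \<open>i, j\<close>: these cancel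
  in the cyclic sum, as the connection is torsion free.\<close>

definition E :: "'n \<Rightarrow> 'n \<Rightarrow> 'n \<Rightarrow> real^'n \<Rightarrow> real^'n^'n" where
  "E l i j u = pd l (Rt i j) u + Gam l u ** Rt i j u + Rt i j u ** transpose (Gam l u)"

text \<open>The inverse metric is parallel, so raising an index commutes with covariant
  differentiation; this carries the Bianchi identity from \<open>Riem\<close> to
  \<open>Rt\<close>.\<close>

lemma E_eq:
  assumes u: "u \<in> U"
  shows "E l i j u = (pd l (Riem i j) u + Gam l u ** Riem i j u - Riem i j u ** Gam l u) ** H u"
proof -
  have "pd l (Rt i j) u = Riem i j u ** pd l H u + pd l (Riem i j) u ** H u"
    unfolding Rt_def[abs_def] using u by (simp add: pd_matrix_mult smooth_Riem smooth_H differentiable_U)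
  moreover have "pd l H u = - (H u ** transpose (Gam l u) ** (G u ** H u)) - (H u ** G u) ** Gam l u ** H u"
    by (simp add: pd_H[OF u] pd_G[OF u] matrix_mult_distribs matrix_mul_assoc)
  ultimately show ?thesis
    by (simp add: E_def Rt_def G_H[OF u] H_G[OF u] matrix_mult_distribs matrix_mul_assoc)
qed

lemma E_bianchi: "u \<in> U \<Longrightarrow> E l i j u + E i j l u + E j l i u = 0"
  using Riem_bianchi[of u l i j]
  by (simp add: E_eq bounded_bilinear.add_left[OF bounded_bilinear_matrix_mult, symmetric]
      bounded_bilinear.zero_left[OF bounded_bilinear_matrix_mult])

lemma E_commute: "u \<in> U \<Longrightarrow> E l j i u = - E l i j u"
proof -
  assume u: "u \<in> U"
  have "Rt j i = (\<lambda>u. - Rt i j u)" using Rt_commute by blast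
  then show ?thesis
    using u pd_bounded_linear[OF bounded_linear_minus[OF bounded_linear_ident], of "Rt i j" u l]
    by (simp add: E_def matrix_mult_distribs smooth_Rt differentiable_U)
qed

lemma transpose_E: "u \<in> U \<Longrightarrow> transpose (E l i j u) = - E l i j u"
proof -
  assume u: "u \<in> U"
  have "transpose (pd l (Rt i j) u) = pd l (\<lambda>u. transpose (Rt i j u)) u"
    using u by (simp add: pd_transpose smooth_Rt differentiable_U)
  also have "\<dots> = pd l (\<lambda>u. - Rt i j u) u"
    using u by (intro pd_cong[OF open_U u] transpose_Rt)
      (auto intro!: differentiable_U smooth_on_bounded_linear[OF open_U bounded_linear_transpose] smooth_Rt)
  also have "\<dots> = - pd l (Rt i j) u"
    using u pd_bounded_linear[OF bounded_linear_minus[OF bounded_linear_ident], of "Rt i j" u l]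
    by (simp add: smooth_Rt differentiable_U)
  finally show ?thesis
    using u by (simp add: E_def transpose_add matrix_transpose_mul transpose_Rt matrix_mult_distribs)
qed

lemma E_nth_commute: "u \<in> U \<Longrightarrow> E l i j u $ b $ a = - E l i j u $ a $ b"
  by (drule arg_cong[OF transpose_E, of _ "\<lambda>M. M $ a $ b"]) (simp add: transpose_def)

end

section \<open>Divergence identities\<close>

text \<open>Gram-Schmidt, one index at a time: fewer than n vectors leave some \<open>x\<close>
  outside their span, and \<open>x\<close> minus its projection, normalised, is the next vector.
  Existence matters because \<open>operator_norm_sq\<close> selects its frame by
  \<open>SOME\<close>.\<close>

lemma exists_orthonormal_frame:
  fixes M :: "real^'n::finite^'n"
  assumes sym: "\<And>v w. ip M v w = ip M w v" and pos: "\<And>v. v \<noteq> 0 \<Longrightarrow> ip M v v > 0"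
  shows "\<exists>e. orthonormal_frame M e"
proof -
  have "\<exists>e :: 'n \<Rightarrow> real^'n. \<forall>i\<in>I. \<forall>j\<in>I. ip M (e i) (e j) = (if i = j then 1 else 0)" for I :: "'n set"
    using finite[of I]
  proof (induction I rule: finite_induct)
    case (insert k I)
    then obtain e :: "'n \<Rightarrow> real^'n" where e: "\<And>i j. i \<in> I \<Longrightarrow> j \<in> I \<Longrightarrow> ip M (e i) (e j) = (if i = j then 1 else 0)"
      by blast
    have "dim (span (e ` I)) \<le> card (e ` I)" by (simp add: dim_le_card')
    also have "\<dots> \<le> card I" by (simp add: card_image_le)
    also have "\<dots> < CARD('n)" using insert by (metis UNIV_I finite psubset_card_mono psubsetI subset_UNIV)
    finally have "dim (span (e ` I)) \<noteq> dim (UNIV :: (real^'n) set)" by simp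
    then have "span (e ` I) \<noteq> UNIV" by metis
    then obtain x where x: "x \<notin> span (e ` I)" by blast
    define y where "y = x - (\<Sum>i\<in>I. ip M x (e i) *\<^sub>R e i)"
    have "(\<Sum>i\<in>I. ip M x (e i) *\<^sub>R e i) \<in> span (e ` I)"
      by (intro span_sum span_scale span_base) auto
    then have "y \<noteq> 0" using x by (auto simp: y_def)
    then have yp: "ip M y y > 0" by (rule pos)
    have orth: "ip M y (e j) = 0" if "j \<in> I" for j
    proof -
      have "(\<Sum>i\<in>I. ip M x (e i) * ip M (e i) (e j)) = (\<Sum>i\<in>I. if i = j then ip M x (e i) else 0)"
        by (rule sum.cong) (auto simp: e that)
      then show ?thesis
        using insert that by (simp add: y_def ip_diff_left ip_sum_left ip_scaleR_left)
    qed
    define e' where "e' = e(k := (1 / sqrt (ip M y y)) *\<^sub>R y)"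
    have "ip M (e' k) (e' k) = 1"
      using yp by (simp add: e'_def ip_scaleR_left ip_scaleR_right field_simps)
    moreover have "ip M (e' k) (e' j) = 0" "ip M (e' j) (e' k) = 0" if "j \<in> I" for j
      using orth[OF that] sym insert that by (auto simp: e'_def ip_scaleR_left ip_scaleR_right)
    moreover have "ip M (e' i) (e' j) = (if i = j then 1 else 0)" if "i \<in> I" "j \<in> I" for i j
      using e insert that by (auto simp: e'_def)
    ultimately show ?case
      using insert by (intro exI[of _ e']) auto
  qed simp
  from this[of UNIV] show ?thesis by (auto simp: orthonormal_frame_def)
qed

text \<open>Skewness moves one \<open>A\<close> across the inner product. If \<open>B\<close> has
  the frame as columns, \<open>transpose B ** M\<close> is its inverse, so what remains is minus the
  trace of a conjugate of \<open>A ** A\<close>, whichever frame was selected.\<close>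

lemma operator_norm_sq_skew:
  fixes M A :: "real^'n::finite^'n"
  assumes sym: "\<And>v w. ip M v w = ip M w v" and pos: "\<And>v. v \<noteq> 0 \<Longrightarrow> ip M v v > 0"
    and skew: "\<And>v w. ip M (A *v v) w = - ip M v (A *v w)"
  shows "operator_norm_sq M ((*v) A) = - trace (A ** A)"
proof -
  define e where "e = (SOME e. orthonormal_frame M e)"
  have e: "ip M (e i) (e j) = (if i = j then 1 else 0)" for i j
    using someI_ex[OF exists_orthonormal_frame[OF sym pos]] unfolding e_def orthonormal_frame_def by blast
  define B where "B = (\<chi> i j. e j $ i)"
  have B: "B *v axis i 1 = e i" for i
    by (simp add: matrix_vector_mult_basis column_def B_def vec_eq_iff)
  have ent: "(transpose B ** N ** B) $ i $ j = ip N (e i) (e j)" for N i j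
    unfolding B[symmetric] ip_matrix_left ip_matrix_right by (simp add: ip_axis matrix_mul_assoc)
  have "transpose B ** M ** B = mat 1"
    by (simp add: vec_eq_iff ent e mat_def)
  then have BM: "B ** (transpose B ** M) = mat 1"
    using matrix_left_right_inverse by blast
  have "operator_norm_sq M ((*v) A) = - (\<Sum>i\<in>UNIV. ip (M ** A ** A) (e i) (e i))"
    unfolding operator_norm_sq_def Let_def e_def[symmetric] skew
    unfolding ip_matrix_right by (simp add: sum_negf)
  also have "\<dots> = - trace (transpose B ** M ** (A ** A ** B))"
    unfolding ent[symmetric] by (simp add: trace_def matrix_mul_assoc)
  also have "\<dots> = - trace (A ** A ** (B ** (transpose B ** M)))"
    by (subst trace_mul_sym) (simp add: matrix_mul_assoc)
  finally show ?thesis by (simp add: BM)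
qed

context chart_metric begin

text \<open>The Ricci operator as a contraction of \<open>Rt\<close>; this form lets the Bianchi
  identity for \<open>E\<close> speak about derivatives of \<open>Q\<close>.\<close>

lemma Q_nth:
  assumes u: "u \<in> U" shows "Q u $ a $ j = (\<Sum>i\<in>UNIV. Rt i j u $ i $ a)"
proof -
  have H: "H u $ a $ m = H u $ m $ a" for m
    using arg_cong[OF transpose_H[OF u], of "\<lambda>M. M $ m $ a"] by (simp add: transpose_def)
  have "Q u $ a $ j = (\<Sum>m\<in>UNIV. \<Sum>i\<in>UNIV. H u $ a $ m * Riem i j u $ i $ m)"
    by (simp add: Q_def matrix_matrix_mult_def transpose_def Ric_def sum_distrib_left)
  also have "\<dots> = (\<Sum>i\<in>UNIV. \<Sum>m\<in>UNIV. H u $ a $ m * Riem i j u $ i $ m)"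
    by (rule sum.swap)
  finally show ?thesis
    by (simp add: Rt_def matrix_matrix_mult_def H mult.commute)
qed

lemma pd_nth_nth: "(F :: real^'n \<Rightarrow> real^'a::finite^'b::finite) differentiable (at u) \<Longrightarrow> pd l (\<lambda>u. F u $ a $ b) u = pd l F u $ a $ b"
  by (rule pd_bounded_linear[where L = "\<lambda>M. M $ a $ b", OF bounded_linear_matrix_nth])

lemma pd_nth: "F differentiable (at u) \<Longrightarrow> pd l (\<lambda>u. F u $ a) u = pd l F u $ a"
  by (rule pd_bounded_linear[OF bounded_linear_vec_nth])

lemma pd_Q_nth:
  assumes u: "u \<in> U" shows "pd l Q u $ a $ j = (\<Sum>i\<in>UNIV. pd l (Rt i j) u $ i $ a)"
proof -
  have sm: "smooth_on U (\<lambda>u. Rt i j u $ i $ a)" for i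
    by (rule smooth_on_bounded_linear[OF open_U bounded_linear_matrix_nth smooth_Rt])
  have "pd l Q u $ a $ j = pd l (\<lambda>u. Q u $ a $ j) u"
    using pd_nth_nth[OF differentiable_U[OF smooth_Q u]] by simp
  also have "\<dots> = pd l (\<lambda>u. \<Sum>i\<in>UNIV. Rt i j u $ i $ a) u"
    by (rule pd_cong[OF open_U u])
      (simp_all add: Q_nth differentiable_U[OF smooth_on_bounded_linear[OF open_U bounded_linear_matrix_nth smooth_Q] u])
  also have "\<dots> = (\<Sum>i\<in>UNIV. pd l (Rt i j) u $ i $ a)"
    using differentiable_U[OF sm u] by (subst pd_sum) (auto simp: pd_nth_nth differentiable_U[OF smooth_Rt u])
  finally show ?thesis .
qed

text \<open>The identity \<open>dS = 2 div Q\<close>: the trace over \<open>i, j\<close> of the cyclic identity for \<open>E\<close>.\<close>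

lemma contracted_bianchi:
  assumes u: "u \<in> U"
  shows "pd l (\<lambda>u. trace (Q u)) u = 2 * (\<Sum>k\<in>UNIV. (pd k Q u + Gam k u ** Q u - Q u ** Gam k u) $ k $ l)"
proof -
  let ?G = "\<lambda>i. Gam i u" and ?Q = "Q u" and ?R = "\<lambda>i j. Rt i j u"
  define T where "T = (\<Sum>i\<in>UNIV. \<Sum>j\<in>UNIV. E l i j u $ i $ j)"
  define N where "N = (\<Sum>i\<in>UNIV. \<Sum>j\<in>UNIV. E i j l u $ j $ i)"
  \<comment> \<open>The two skew symmetries of \<open>E\<close> turn the remaining cyclic terms into
    the summand of \<open>N\<close> and the same summand with i and j exchanged.\<close>
  have "T = 2 * N"
  proof -
    have b: "E l i j u $ i $ j - E i j l u $ j $ i - E j i l u $ i $ j = 0" for i j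
      using arg_cong[OF E_bianchi[OF u, of l i j], of "\<lambda>M. M $ i $ j"]
        E_nth_commute[OF u, of i j l j i] E_commute[OF u, of j l i] by simp
    have "(\<Sum>i\<in>UNIV. \<Sum>j\<in>UNIV. E l i j u $ i $ j - E i j l u $ j $ i - E j i l u $ i $ j) = 0"
      by (simp add: b)
    then have "T - N - (\<Sum>i\<in>UNIV. \<Sum>j\<in>UNIV. E j i l u $ i $ j) = 0"
      by (simp add: T_def N_def sum_subtractf)
    moreover have "(\<Sum>i\<in>UNIV. \<Sum>j\<in>UNIV. E j i l u $ i $ j) = N"
      unfolding N_def by (rule sum.swap)
    ultimately show ?thesis by simp
  qed
  \<comment> \<open>Both Christoffel terms of \<open>E\<close> contract to the same trace, since
    \<open>Rt\<close> is skew in each of its two pairs of indices.\<close>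
  moreover have "T = pd l (\<lambda>u. trace (Q u)) u + 2 * trace (?G l ** ?Q)"
  proof -
    have T1: "(\<Sum>i\<in>UNIV. \<Sum>j\<in>UNIV. pd l (Rt i j) u $ i $ j) = pd l (\<lambda>u. trace (Q u)) u"
      using pd_bounded_linear[OF bounded_linear_trace differentiable_U[OF smooth_Q u], of l]
      by (subst sum.swap) (simp add: trace_def pd_Q_nth[OF u])
    have R: "?R i j $ p $ j = ?R j i $ j $ p" for i j p
      using Rt_nth_commute[OF u, of i j p j] Rt_commute[of j i u] by simp
    have T2: "(\<Sum>i\<in>UNIV. \<Sum>j\<in>UNIV. \<Sum>p\<in>UNIV. ?G l $ i $ p * ?R i j $ p $ j) = trace (?G l ** ?Q)"
    proof -
      have "(\<Sum>i\<in>UNIV. \<Sum>j\<in>UNIV. \<Sum>p\<in>UNIV. ?G l $ i $ p * ?R i j $ p $ j)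
         = (\<Sum>i\<in>UNIV. \<Sum>j\<in>UNIV. \<Sum>p\<in>UNIV. ?G l $ i $ p * ?R j i $ j $ p)"
        by (intro sum.cong refl arg_cong2[where f = "(*)"] R)
      also have "\<dots> = (\<Sum>i\<in>UNIV. \<Sum>p\<in>UNIV. \<Sum>j\<in>UNIV. ?G l $ i $ p * ?R j i $ j $ p)"
        by (intro sum.cong refl sum.swap)
      finally show ?thesis
        by (simp add: trace_def matrix_matrix_mult_def Q_nth[OF u] sum_distrib_left)
    qed
    have "(\<Sum>i\<in>UNIV. \<Sum>j\<in>UNIV. \<Sum>p\<in>UNIV. ?R i j $ i $ p * ?G l $ j $ p)
       = (\<Sum>j\<in>UNIV. \<Sum>i\<in>UNIV. \<Sum>p\<in>UNIV. ?R i j $ i $ p * ?G l $ j $ p)" by (rule sum.swap)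
    also have "\<dots> = (\<Sum>j\<in>UNIV. \<Sum>p\<in>UNIV. \<Sum>i\<in>UNIV. ?R i j $ i $ p * ?G l $ j $ p)" by (intro sum.cong refl sum.swap)
    also have "\<dots> = trace (?G l ** ?Q)"
      by (simp add: trace_def matrix_matrix_mult_def Q_nth[OF u] sum_distrib_left mult.commute)
    finally have T3: "(\<Sum>i\<in>UNIV. \<Sum>j\<in>UNIV. \<Sum>p\<in>UNIV. ?R i j $ i $ p * ?G l $ j $ p) = trace (?G l ** ?Q)" .
    show ?thesis
      using T1 T2 T3 by (simp add: T_def E_def matrix_matrix_mult_def transpose_def sum.distrib)
  qed
  moreover have "N = (\<Sum>i\<in>UNIV. (pd i Q u + ?G i ** ?Q) $ i $ l)"
  proof -
    \<comment> \<open>The Christoffel symbol is symmetric in i and p, the curvature is skew in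
      them.\<close>
    have N2: "(\<Sum>i\<in>UNIV. \<Sum>j\<in>UNIV. \<Sum>p\<in>UNIV. ?G i $ j $ p * ?R j l $ p $ i) = 0"
    proof -
      have "(\<Sum>i\<in>UNIV. \<Sum>p\<in>UNIV. ?G i $ j $ p * ?R j l $ p $ i) = 0" for j
      proof -
        have "(\<Sum>i\<in>UNIV. \<Sum>p\<in>UNIV. ?G i $ j $ p * ?R j l $ p $ i) = (\<Sum>p\<in>UNIV. \<Sum>i\<in>UNIV. ?G i $ j $ p * ?R j l $ p $ i)"
          by (rule sum.swap)
        also have "\<dots> = (\<Sum>p\<in>UNIV. \<Sum>i\<in>UNIV. - (?G p $ j $ i * ?R j l $ i $ p))"
        proof (intro sum.cong refl)
          show "?G i $ j $ p * ?R j l $ p $ i = - (?G p $ j $ i * ?R j l $ i $ p)" for i p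
            using Gam_commute[OF u, of i j p] Rt_nth_commute[OF u, of j l p i] by simp
        qed
        finally show ?thesis by (simp add: sum_negf)
      qed
      then show ?thesis by (subst sum.swap) simp
    qed
    have N3: "(\<Sum>i\<in>UNIV. \<Sum>j\<in>UNIV. \<Sum>p\<in>UNIV. ?R j l $ j $ p * ?G i $ i $ p) = (\<Sum>i\<in>UNIV. (?G i ** ?Q) $ i $ l)"
      by (simp add: matrix_matrix_mult_def Q_nth[OF u] sum_distrib_left mult.commute) (intro sum.cong refl sum.swap)
    show ?thesis
      using N2 N3 by (simp add: N_def E_def matrix_matrix_mult_def transpose_def sum.distrib pd_Q_nth[OF u])
  qed
  \<comment> \<open>By symmetry of the lower indices this is the trace that \<open>T\<close> has in
    excess; it supplies the term with the minus sign that \<open>N\<close> lacks.\<close>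
  moreover have "(\<Sum>k\<in>UNIV. (?Q ** ?G k) $ k $ l) = trace (?G l ** ?Q)"
    using trace_mul_sym[of "?G l" ?Q] Gam_commute[OF u, of _ _ l] by (simp add: trace_def matrix_matrix_mult_def)
  ultimately show ?thesis
    by (simp add: sum.distrib sum_subtractf)
qed

text \<open>Leibniz rule: \<open>?M k\<close> is the covariant derivative of the endomorphism
  \<open>Q\<close>, and its contraction is half the differential of the scalar curvature by
  \<open>contracted_bianchi\<close>.\<close>

lemma divergence_Q:
  assumes u: "u \<in> U" and V: "smooth_on U V"
  shows "divergence (\<lambda>u. Q u *v V u) u
       = trace (Q u ** Dm V u) + 1/2 * frechet_derivative (\<lambda>u. trace (Q u)) (at u) (V u)"
proof -
  let ?M = "\<lambda>k. pd k Q u + Gam k u ** Q u - Q u ** Gam k u"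
  have tr: "trace (Q u ** Dm V u) = (\<Sum>k\<in>UNIV. (Q u *v cov k V u) $ k)"
    by (simp add: trace_def matrix_matrix_mult_def matrix_vector_mult_def Dm_def)
  have "cov k (\<lambda>u. Q u *v V u) u = Q u *v cov k V u + ?M k *v V u" for k
    using u V unfolding cov_def
    by (simp add: pd_matrix_vector_mult differentiable_U smooth_Q matrix_vector_distribs matrix_vector_mul_assoc)
  then have "divergence (\<lambda>u. Q u *v V u) u = trace (Q u ** Dm V u) + (\<Sum>k\<in>UNIV. (?M k *v V u) $ k)"
    by (simp add: divergence_def tr sum.distrib)
  also have "(\<Sum>k\<in>UNIV. (?M k *v V u) $ k) = (\<Sum>k\<in>UNIV. \<Sum>l\<in>UNIV. V u $ l * ?M k $ k $ l)"
    by (simp add: matrix_vector_mult_def mult.commute)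
  also have "\<dots> = (\<Sum>l\<in>UNIV. \<Sum>k\<in>UNIV. V u $ l * ?M k $ k $ l)" by (rule sum.swap)
  also have "\<dots> = (\<Sum>l\<in>UNIV. V u $ l * (1/2 * pd l (\<lambda>u. trace (Q u)) u))"
    unfolding contracted_bianchi[OF u] sum_distrib_left[symmetric] by simp
  also have "\<dots> = 1/2 * frechet_derivative (\<lambda>u. trace (Q u)) (at u) (V u)"
    using differentiable_U[OF smooth_on_bounded_linear[OF open_U bounded_linear_trace smooth_Q] u]
    by (simp add: frechet_derivative_sum_pd sum_divide_distrib)
  finally show ?thesis .
qed

lemma divergence_scaleR:
  assumes u: "u \<in> U" and "f differentiable (at u)" "V differentiable (at u)"
  shows "divergence (\<lambda>u. f u *\<^sub>R V u) u = frechet_derivative f (at u) (V u) + f u * divergence V u"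
  using assms by (simp add: divergence_def cov_scaleR frechet_derivative_sum_pd sum.distrib sum_distrib_left mult.commute)

lemma divergence_add:
  "u \<in> U \<Longrightarrow> V differentiable (at u) \<Longrightarrow> W differentiable (at u) \<Longrightarrow> divergence (\<lambda>u. V u + W u) u = divergence V u + divergence W u"
  by (simp add: divergence_def cov_add sum.distrib)

lemma divergence_cong:
  assumes "u \<in> U" "\<And>y. y \<in> U \<Longrightarrow> V y = W y" "V differentiable (at u)"
  shows "divergence V u = divergence W u"
  using assms pd_cong[OF open_U, of u V W] by (simp add: divergence_def cov_def)

text \<open>The field is expanded as the sum of V^i times \<open>cov i V\<close>. Because i is a
  mere label there, the product rule yields \<open>pd k V\<close> where the trace of the square
  needs \<open>cov k V\<close>; the missing Christoffel term appears when
  \<open>cov i (cov k V)\<close> is contracted to the derivative of the divergence.\<close>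

lemma divergence_Dm:
  assumes u: "u \<in> U" and V: "smooth_on U V"
  shows "divergence (\<lambda>u. Dm V u *v V u) u
       = trace (Dm V u ** Dm V u) + frechet_derivative (divergence V) (at u) (V u) + ricci G u (V u) (V u)"
proof -
  have smi: "smooth_on U (\<lambda>u. V u $ i)" for i
    by (rule smooth_on_bounded_linear[OF open_U bounded_linear_vec_nth V])
  note d = differentiable_U[OF _ u]
  have cc: "cov k (\<lambda>u. Dm V u *v V u) u = (\<Sum>i\<in>UNIV. pd k V u $ i *\<^sub>R cov i V u + V u $ i *\<^sub>R cov k (cov i V) u)" for k
  proof -
    have "cov k (\<lambda>u. \<Sum>i\<in>I. V u $ i *\<^sub>R cov i V u) u
        = (\<Sum>i\<in>I. pd k V u $ i *\<^sub>R cov i V u + V u $ i *\<^sub>R cov k (cov i V) u)" if "finite I" for I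
      using that
    proof induction
      case empty
      then show ?case by (simp add: cov_def pd_const)
    next
      case (insert i I)
      then show ?case
        by (simp add: cov_add[OF u] cov_scaleR[OF u] pd_nth d V smi smooth_cov
            smooth_on_sum[OF open_U] smooth_on_scaleR[OF open_U])
    qed
    from this[of UNIV] show ?thesis by (simp add: Dm_vector)
  qed
  have "cov k (\<lambda>u. Dm V u *v V u) u $ k = (\<Sum>i\<in>UNIV. pd k V u $ i * cov i V u $ k)
      + (\<Sum>i\<in>UNIV. V u $ i * cov i (cov k V) u $ k) + (\<Sum>i\<in>UNIV. V u $ i * (Riem k i u *v V u) $ k)" for k
    using cc[of k] unfolding cov_commutator[OF u V, of k] by (simp add: sum.distrib distrib_left add.assoc)
  then have "divergence (\<lambda>u. Dm V u *v V u) u = (\<Sum>k\<in>UNIV. \<Sum>i\<in>UNIV. pd k V u $ i * cov i V u $ k)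
      + (\<Sum>k\<in>UNIV. \<Sum>i\<in>UNIV. V u $ i * cov i (cov k V) u $ k)
      + (\<Sum>k\<in>UNIV. \<Sum>i\<in>UNIV. V u $ i * (Riem k i u *v V u) $ k)"
    by (simp add: divergence_def sum.distrib)
  also have "(\<Sum>k\<in>UNIV. \<Sum>i\<in>UNIV. V u $ i * (Riem k i u *v V u) $ k) = ricci G u (V u) (V u)"
    unfolding ricci_def riemann_Riem[OF u] by simp
  also have "(\<Sum>k\<in>UNIV. \<Sum>i\<in>UNIV. V u $ i * cov i (cov k V) u $ k)
     = frechet_derivative (divergence V) (at u) (V u) + (\<Sum>k\<in>UNIV. \<Sum>i\<in>UNIV. (Gam k u *v V u) $ i * cov i V u $ k)"
  proof -
    have "(\<Sum>k\<in>UNIV. \<Sum>i\<in>UNIV. V u $ i * cov i (cov k V) u $ k) = (\<Sum>i\<in>UNIV. \<Sum>k\<in>UNIV. V u $ i * cov i (cov k V) u $ k)"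
      by (rule sum.swap)
    also have "\<dots> = (\<Sum>i\<in>UNIV. V u $ i * (\<Sum>k\<in>UNIV. pd i (cov k V) u $ k))
        + (\<Sum>i\<in>UNIV. \<Sum>k\<in>UNIV. V u $ i * (Gam i u *v cov k V u) $ k)"
      by (simp add: cov_def[of _ "cov _ V"] sum.distrib sum_distrib_left distrib_left)
    also have "(\<Sum>i\<in>UNIV. V u $ i * (\<Sum>k\<in>UNIV. pd i (cov k V) u $ k)) = frechet_derivative (divergence V) (at u) (V u)"
    proof -
      have "pd i (divergence V) u = (\<Sum>k\<in>UNIV. pd i (cov k V) u $ k)" for i
        unfolding divergence_def[abs_def]
        by (subst pd_sum) (simp_all add: pd_nth d smooth_cov V smooth_on_bounded_linear[OF open_U bounded_linear_vec_nth])
      then show ?thesis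
        using d[OF smooth_divergence[OF V]] by (simp add: frechet_derivative_sum_pd)
    qed
    \<comment> \<open>Absence of torsion exchanges the roles of \<open>V\<close> and
      \<open>cov k V\<close> in the Christoffel symbol.\<close>
    also have "(\<Sum>i\<in>UNIV. \<Sum>k\<in>UNIV. V u $ i * (Gam i u *v cov k V u) $ k)
       = (\<Sum>k\<in>UNIV. \<Sum>i\<in>UNIV. (Gam k u *v V u) $ i * cov i V u $ k)"
    proof -
      have "(\<Sum>i\<in>UNIV. \<Sum>k\<in>UNIV. V u $ i * (Gam i u *v cov k V u) $ k) = (\<Sum>k\<in>UNIV. \<Sum>i\<in>UNIV. V u $ i * (Gam i u *v cov k V u) $ k)"
        by (rule sum.swap)
      also have "\<dots> = (\<Sum>k\<in>UNIV. christoffel G u (cov k V u) (V u) $ k)"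
        by (simp add: christoffel_commute[OF u, of _ "V u"] christoffel_Gam[OF u, of "V u"])
      also have "\<dots> = (\<Sum>k\<in>UNIV. \<Sum>i\<in>UNIV. cov k V u $ i * (Gam i u *v V u) $ k)"
        by (simp add: christoffel_Gam[OF u])
      also have "\<dots> = (\<Sum>i\<in>UNIV. \<Sum>k\<in>UNIV. cov k V u $ i * (Gam i u *v V u) $ k)" by (rule sum.swap)
      finally show ?thesis by (simp add: mult.commute)
    qed
    finally show ?thesis .
  qed
  also have "(\<Sum>k\<in>UNIV. \<Sum>i\<in>UNIV. pd k V u $ i * cov i V u $ k)
      + (frechet_derivative (divergence V) (at u) (V u) + (\<Sum>k\<in>UNIV. \<Sum>i\<in>UNIV. (Gam k u *v V u) $ i * cov i V u $ k))
      = frechet_derivative (divergence V) (at u) (V u) + (\<Sum>k\<in>UNIV. \<Sum>i\<in>UNIV. cov k V u $ i * cov i V u $ k)"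
    by (subst (3) cov_def) (simp add: sum.distrib distrib_right)
  also have "(\<Sum>k\<in>UNIV. \<Sum>i\<in>UNIV. cov k V u $ i * cov i V u $ k) = trace (Dm V u ** Dm V u)"
    by (simp add: trace_def matrix_matrix_mult_def Dm_def mult.commute)
  finally show ?thesis by simp
qed

end

section \<open>The soliton equation in a chart\<close>

lemma smooth_on_transpose: "open S \<Longrightarrow> smooth_on S F \<Longrightarrow> smooth_on S (\<lambda>u. transpose (F u :: real^'a::finite^'b::finite))"
  by (rule smooth_on_bounded_linear[OF _ bounded_linear_transpose])

lemma trace_scaleR: "trace (c *\<^sub>R A) = c * trace (A :: real^'n::finite^'n)"
  by (simp add: trace_def sum_distrib_left)

lemma trace_minus: "trace (- A) = - trace (A :: real^'n::finite^'n)"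
  by (simp add: trace_def sum_negf)

lemma trace_transpose: "trace (transpose A) = trace (A :: real^'n::finite^'n)"
  by (simp add: trace_def transpose_def)

context chart_metric begin

text \<open>The adjoint with respect to the metric, written with an asterisk in the
  overview.\<close>

definition adj :: "real^'n^'n \<Rightarrow> real^'n \<Rightarrow> real^'n^'n" where
  "adj A u = H u ** transpose A ** G u"

lemma ip_adj: "u \<in> U \<Longrightarrow> ip (G u) (adj A u *v v) w = ip (G u) v (A *v w)"
  by (simp add: ip_matrix_left ip_matrix_right adj_def matrix_transpose_mul transpose_G transpose_H
      matrix_mul_assoc[symmetric] H_G)

lemma trace_adj: "u \<in> U \<Longrightarrow> trace (adj A u) = trace A"
  unfolding adj_def by (subst trace_mul_sym) (simp add: matrix_mul_assoc G_H trace_transpose)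

definition Phi :: "(real^'n \<Rightarrow> real^'n) \<Rightarrow> real^'n \<Rightarrow> real^'n^'n" where
  "Phi V u = (1/2) *\<^sub>R (Dm V u - adj (Dm V u) u)"

lemma smooth_Phi: "smooth_on U V \<Longrightarrow> smooth_on U (Phi V)"
  unfolding Phi_def[abs_def] adj_def
  by (intro smooth_on_scaleR smooth_on_const smooth_on_diff smooth_on_matrix_mult smooth_on_transpose smooth_Dm smooth_G smooth_H open_U)

lemma phi_Phi:
  assumes u: "u \<in> U" and V: "V differentiable (at u)"
  shows "phi G V u v = Phi V u *v v"
  unfolding phi_def
proof (rule sharp_eqI[OF ip_pos[OF u]])
  show "ip (G u) (Phi V u *v v) w = 1/2 * d_eta G V u v w" for w
    using ip_commute[OF u, of v "Dm V u *v w"]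
    by (simp add: d_eta_def nabla_Dm[OF u V] Phi_def matrix_vector_distribs ip_scaleR_left ip_diff_left ip_adj[OF u])
qed

lemma Phi_skew:
  assumes u: "u \<in> U" shows "ip (G u) (Phi V u *v v) w = - ip (G u) v (Phi V u *v w)"
  using ip_commute[OF u, of v "adj (Dm V u) u *v w"] ip_adj[OF u, of "Dm V u" w v] ip_commute[OF u, of w "Dm V u *v v"]
  by (simp add: Phi_def matrix_vector_distribs ip_scaleR_left ip_diff_left ip_scaleR_right ip_diff_right ip_adj[OF u])
    (simp add: field_simps)

lemma operator_norm_sq_phi:
  assumes u: "u \<in> U" and V: "V differentiable (at u)"
  shows "operator_norm_sq (G u) (phi G V u) = - trace (Phi V u ** Phi V u)"
proof -
  have "phi G V u = (*v) (Phi V u)" using phi_Phi[OF u V] by blast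
  then show ?thesis
    using operator_norm_sq_skew[OF ip_commute[OF u] ip_pos[OF u] Phi_skew[OF u]] by simp
qed

text \<open>Symmetrising Koszul's formula in v and w leaves only the derivative of the metric along
  \<open>V\<close>, which is the first term of the Lie derivative; the brackets with constant fields
  supply the derivatives of \<open>V\<close>.\<close>

lemma lie_derivative_Dm:
  assumes u: "u \<in> U" and V: "V differentiable (at u)"
  shows "lie_derivative V G (\<lambda>_. v) (\<lambda>_. w) u = ip (transpose (Dm V u) ** G u + G u ** Dm V u) v w"
proof -
  let ?d = "frechet_derivative G (at u)"
  have Dv: "Dm V u *v v = frechet_derivative V (at u) v + christoffel G u v (V u)" for v
    using nabla_Dm[OF u V, of "\<lambda>_. v"] by (simp add: nabla_def)
  have "2 * ip (G u) (christoffel G u v (V u)) w + 2 * ip (G u) (christoffel G u w (V u)) v = 2 * ip (?d (V u)) v w"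
    unfolding koszul[OF u] using ip_dG_commute[OF u] by (smt (verit))
  then have "ip (G u) (christoffel G u v (V u)) w + ip (G u) (christoffel G u w (V u)) v = ip (?d (V u)) v w"
    by linarith
  moreover have "ip (transpose (Dm V u) ** G u + G u ** Dm V u) v w = ip (G u) (Dm V u *v v) w + ip (G u) v (Dm V u *v w)"
    by (simp only: ip_add_matrix ip_matrix_left ip_matrix_right)
  ultimately show ?thesis
    using ip_commute[OF u, of v]
    by (simp add: lie_derivative_def lie_bracket_def frechet_derivative_ip[OF u] Dv ip_add_left ip_add_right bounded_bilinear.minus_left[OF bounded_bilinear_ip]
        bounded_bilinear.minus_right[OF bounded_bilinear_ip])
qed

end

text \<open>\<open>f\<close> stands for \<lambda> + \<rho>S but is left arbitrary, without
  smoothness: that S is the local scalar curvature of every chart, and hence that \<open>f\<close>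
  is smooth, is itself deduced from \<open>scalar_eq\<close> in this locale. Smoothness therefore
  enters only as a hypothesis of \<open>divergence_Phi\<close>.\<close>

locale chart_soliton = chart_metric U G for U :: "(real^'n::finite) set" and G +
  fixes V :: "real^'n \<Rightarrow> real^'n" and f :: "real^'n \<Rightarrow> real"
  assumes smooth_V: "smooth_on U V"
    and soliton: "\<And>u v w. u \<in> U \<Longrightarrow>
      ricci G u v w + 1/2 * lie_derivative V G (\<lambda>_. v) (\<lambda>_. w) u = f u * ip (G u) v w"
begin

lemma diff_V: "u \<in> U \<Longrightarrow> V differentiable (at u)"
  by (rule differentiable_U[OF smooth_V])

lemma Ric_eq: "u \<in> U \<Longrightarrow> Ric u = f u *\<^sub>R G u - (1/2) *\<^sub>R (transpose (Dm V u) ** G u + G u ** Dm V u)"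
  unfolding ip_eq_iff[symmetric] ip_diff_matrix ip_scaleR_matrix
  using soliton by (simp add: ricci_Ric lie_derivative_Dm diff_V algebra_simps)

lemma Q_eq: "u \<in> U \<Longrightarrow> Q u = f u *\<^sub>R mat 1 - (1/2) *\<^sub>R (Dm V u + adj (Dm V u) u)"
  unfolding Q_def Ric_eq
  by (simp add: transpose_diff transpose_add transpose_scalar matrix_transpose_mul transpose_G matrix_mult_distribs
      H_G adj_def matrix_mul_assoc add.commute)

lemma Phi_eq: "u \<in> U \<Longrightarrow> Phi V u = Dm V u - f u *\<^sub>R mat 1 + Q u"
  by (simp add: Q_eq Phi_def scaleR_diff_right scaleR_add_right)

lemma scalar_eq: "u \<in> U \<Longrightarrow> scalar_local G u = real CARD('n) * f u - divergence V u"
  by (simp add: scalar_local_Q Q_eq trace_sub trace_add trace_scaleR trace_I trace_adj divergence_trace)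

text \<open>\<open>f - Q\<close> is self-adjoint by the soliton equation, and \<open>\<phi>\<close> is skew.\<close>

lemma trace_Phi_Q: "u \<in> U \<Longrightarrow> trace (Phi V u ** (f u *\<^sub>R mat 1 - Q u)) = 0"
proof -
  assume u: "u \<in> U"
  define B where "B = f u *\<^sub>R mat 1 - Q u"
  have B: "adj B u = B"
    unfolding B_def Q_eq[OF u] adj_def
    by (simp add: transpose_add transpose_scalar matrix_transpose_mul transpose_G transpose_H u matrix_mult_distribs
        matrix_mul_assoc H_G add.commute) (simp add: matrix_mul_assoc[symmetric] H_G G_H u matrix_mult_distribs add.commute)
  have P: "adj (Phi V u) u = - Phi V u"
    unfolding Phi_def adj_def
    by (simp add: transpose_diff transpose_scalar matrix_transpose_mul transpose_G transpose_H u matrix_mult_distribs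
        matrix_mul_assoc H_G) (simp add: matrix_mul_assoc[symmetric] H_G G_H u matrix_mult_distribs scaleR_diff_right)
  \<comment> \<open>Taking adjoints reverses a product and keeps its trace, so skew times
    self-adjoint has a trace equal to its own negative.\<close>
  have "trace (Phi V u ** B) = - trace (adj (Phi V u) u ** adj B u)"
    by (simp add: B P matrix_mult_distribs trace_minus)
  also have "adj (Phi V u) u ** adj B u = H u ** (transpose (Phi V u) ** (G u ** H u) ** transpose B ** G u)"
    by (simp add: adj_def matrix_mul_assoc)
  also have "trace \<dots> = trace (transpose (Phi V u) ** transpose B)"
    by (subst trace_mul_sym) (simp add: G_H u matrix_mul_assoc[symmetric])
  also have "\<dots> = trace (B ** Phi V u)"
    by (simp add: matrix_transpose_mul[symmetric] trace_transpose)
  also have "\<dots> = trace (Phi V u ** B)" by (rule trace_mul_sym)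
  finally show ?thesis by (simp add: B_def)
qed

lemma divergence_Phi:
  assumes u: "u \<in> U" and f: "smooth_on U f"
  shows "divergence (\<lambda>u. Phi V u *v V u) u
     = ricci G u (V u) (V u) - operator_norm_sq (G u) (phi G V u)
       + frechet_derivative (\<lambda>y. (real CARD('n) - 1) * f y - 1/2 * scalar_local G y) (at u) (V u)"
proof -
  note sm = smooth_on_matrix_vector_mult[OF open_U] smooth_V smooth_Q f smooth_Dm smooth_on_scaleR[OF open_U]
    smooth_on_add[OF open_U] smooth_on_diff[OF open_U] smooth_on_matrix_mult[OF open_U] smooth_on_const smooth_on_minus[OF open_U]
  note d = differentiable_U[OF _ u]
  have eq: "Phi V y *v V y = Dm V y *v V y + (- f y) *\<^sub>R V y + Q y *v V y" if "y \<in> U" for y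
    using that by (simp add: Phi_eq matrix_vector_distribs)
  let ?D = "\<lambda>h. frechet_derivative h (at u) (V u)"
  have tr: "smooth_on U (\<lambda>u. trace (Q u))"
    by (rule smooth_on_bounded_linear[OF open_U bounded_linear_trace smooth_Q])
  have "divergence (\<lambda>u. Phi V u *v V u) u = divergence (\<lambda>u. Dm V u *v V u + (- f u) *\<^sub>R V u + Q u *v V u) u"
    by (rule divergence_cong[OF u eq]) (auto intro!: d sm smooth_Phi)
  also have "\<dots> = divergence (\<lambda>u. Dm V u *v V u) u + divergence (\<lambda>u. (- f u) *\<^sub>R V u) u + divergence (\<lambda>u. Q u *v V u) u"
    by (simp add: divergence_add[OF u] d sm del: scaleR_minus_left)
  also have "\<dots> = trace (Dm V u ** Dm V u) + ?D (divergence V) + ricci G u (V u) (V u)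
      + (?D (\<lambda>u. - f u) - f u * divergence V u) + trace (Q u ** Dm V u) + 1/2 * ?D (\<lambda>u. trace (Q u))"
    by (simp add: divergence_Dm[OF u smooth_V] divergence_Q[OF u smooth_V] divergence_scaleR[OF u] d sm del: scaleR_minus_left)
  finally have h1: "divergence (\<lambda>u. Phi V u *v V u) u = trace (Dm V u ** Dm V u) + ?D (divergence V) + ricci G u (V u) (V u)
      + (?D (\<lambda>u. - f u) - f u * divergence V u) + trace (Q u ** Dm V u) + 1/2 * ?D (\<lambda>u. trace (Q u))" .
  have h2: "?D (\<lambda>u. - f u) = - ?D f"
    using fun_cong[OF frechet_derivative_at[OF has_derivative_minus[OF smooth_on_has_derivative[OF f u]]], of "V u"] by simp
  have h3: "?D (divergence V) = real CARD('n) * ?D f - ?D (\<lambda>u. trace (Q u))"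
  proof -
    have "frechet_derivative (divergence V) (at u) = frechet_derivative (\<lambda>u. real CARD('n) * f u - trace (Q u)) (at u)"
      using d[OF smooth_divergence[OF smooth_V]] scalar_eq scalar_local_Q
      by (intro frechet_derivative_transform_within_open[OF _ open_U u]) (auto simp: algebra_simps)
    also have "\<dots> = (\<lambda>v. real CARD('n) * frechet_derivative f (at u) v - frechet_derivative (\<lambda>u. trace (Q u)) (at u) v)"
      by (rule frechet_derivative_at[symmetric])
        (intro has_derivative_diff has_derivative_mult_right smooth_on_has_derivative[OF _ u] f tr)
    finally show ?thesis by simp
  qed
  \<comment> \<open>The operator f - Q equals A - \<phi>, so \<open>trace_Phi_Q\<close> says that
    \<phi>A and \<phi>\<phi> have the same trace, which is minus the squared norm of \<phi>.\<close>
  have h4: "trace (Dm V u ** Dm V u) = - operator_norm_sq (G u) (phi G V u) + f u * divergence V u - trace (Q u ** Dm V u)"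
  proof -
    have "0 = trace (Phi V u ** (Dm V u - Phi V u))"
      using trace_Phi_Q[OF u] by (simp add: Phi_eq[OF u])
    also have "\<dots> = trace (Phi V u ** Dm V u) + operator_norm_sq (G u) (phi G V u)"
      by (simp add: matrix_mult_distribs trace_sub operator_norm_sq_phi[OF u diff_V[OF u]])
    also have "trace (Phi V u ** Dm V u) = trace (Dm V u ** Dm V u) - f u * divergence V u + trace (Q u ** Dm V u)"
      by (simp add: Phi_eq[OF u] matrix_mult_distribs trace_sub trace_add trace_scaleR divergence_trace)
    finally show ?thesis by simp
  qed
  have h5: "?D (\<lambda>y. (real CARD('n) - 1) * f y - 1/2 * scalar_local G y)
      = (real CARD('n) - 1) * ?D f - 1/2 * ?D (\<lambda>u. trace (Q u))"
  proof -
    have "((\<lambda>y. (real CARD('n) - 1) * f y - 1/2 * trace (Q y)) has_derivative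
       (\<lambda>v. (real CARD('n) - 1) * frechet_derivative f (at u) v - 1/2 * frechet_derivative (\<lambda>u. trace (Q u)) (at u) v)) (at u)"
      by (intro has_derivative_diff has_derivative_mult_right smooth_on_has_derivative[OF _ u] f tr)
    then have "((\<lambda>y. (real CARD('n) - 1) * f y - 1/2 * scalar_local G y) has_derivative
       (\<lambda>v. (real CARD('n) - 1) * frechet_derivative f (at u) v - 1/2 * frechet_derivative (\<lambda>u. trace (Q u)) (at u) v)) (at u)"
      by (rule has_derivative_transform_within_open[OF _ open_U u]) (simp add: scalar_local_Q)
    then show ?thesis by (rule fun_cong[OF frechet_derivative_at[symmetric]])
  qed
  show ?thesis unfolding h1 h2 h3 h4 h5 by (simp add: algebra_simps)
qed

end

section \<open>Change of charts\<close>

text \<open>For two charts, \<open>U\<close> is their overlap and \<tau> the transition map.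
  Invertibility of its differential is a consequence of the isometry condition.\<close>

locale chart_change = chart_metric U G + M': chart_metric U' G'
  for U :: "(real^'n::finite) set" and G and U' :: "(real^'n) set" and G' +
  fixes \<tau> :: "real^'n \<Rightarrow> real^'n"
  assumes smooth_\<tau>: "smooth_on U \<tau>" and \<tau>: "\<And>u. u \<in> U \<Longrightarrow> \<tau> u \<in> U'"
    and isometry: "\<And>u v w. u \<in> U \<Longrightarrow>
      ip (G u) v w = ip (G' (\<tau> u)) (frechet_derivative \<tau> (at u) v) (frechet_derivative \<tau> (at u) w)"
begin

definition J :: "real^'n \<Rightarrow> real^'n^'n" where
  "J u = matrix (frechet_derivative \<tau> (at u))"

lemma J_vector: "u \<in> U \<Longrightarrow> J u *v v = frechet_derivative \<tau> (at u) v"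
  unfolding J_def using linear_frechet_derivative[OF differentiable_U[OF smooth_\<tau>]] by (simp add: matrix_works)

lemma smooth_J: "smooth_on U J"
  by (intro smooth_on_matrixI open_U)
    (simp add: J_def matrix_def smooth_on_bounded_linear[OF open_U bounded_linear_vec_nth] smooth_on_frechet_derivative smooth_\<tau>)

lemma J_isometry: "u \<in> U \<Longrightarrow> ip (G' (\<tau> u)) (J u *v v) (J u *v w) = ip (G u) v w"
  by (simp add: isometry J_vector)

lemma det_J: "u \<in> U \<Longrightarrow> det (J u) \<noteq> 0"
proof
  assume u: "u \<in> U" and "det (J u) = 0"
  then have "\<not> invertible (J u)" by (simp add: invertible_det_nz)
  then obtain v where "v \<noteq> 0" "J u *v v = 0"
    unfolding invertible_left_inverse matrix_left_invertible_ker by blast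
  then show False using ip_pos[OF u, of v] J_isometry[OF u, of v v] by (simp add: ip_def)
qed

lemma J_surj: "u \<in> U \<Longrightarrow> \<exists>w. z = J u *v w"
  by (metis det_J invertible_matrix_inv(1) matrix_vector_mul_assoc matrix_vector_mul_lid)

text \<open>The differential is onto, so testing against transported vectors determines a vector;
  all inner products can then be pulled back to \<open>U\<close>.\<close>

lemma eq_via_J:
  assumes u: "u \<in> U" and "\<And>w. ip (G' (\<tau> u)) a (J u *v w) = ip (G' (\<tau> u)) b (J u *v w)"
  shows "a = b"
proof (rule ip_nondegenerate[OF M'.ip_pos[OF \<tau>[OF u]]])
  show "ip (G' (\<tau> u)) a z = ip (G' (\<tau> u)) b z" for z
    using J_surj[OF u, of z] assms(2) by auto
qed

lemma dJ_commute:
  assumes u: "u \<in> U"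
  shows "frechet_derivative J (at u) v *v w = frechet_derivative J (at u) w *v v"
proof -
  have "frechet_derivative (\<lambda>y. frechet_derivative \<tau> (at y) w) (at u) v = frechet_derivative J (at u) v *v w" for v w
  proof -
    have "((\<lambda>y. J y *v w) has_derivative (\<lambda>v. frechet_derivative J (at u) v *v w)) (at u)"
      by (rule bounded_linear.has_derivative[OF bounded_bilinear.bounded_linear_left[OF bounded_bilinear_matrix_vector_mult]
            smooth_on_has_derivative[OF smooth_J u]])
    then have "((\<lambda>y. frechet_derivative \<tau> (at y) w) has_derivative (\<lambda>v. frechet_derivative J (at u) v *v w)) (at u)"
      by (rule has_derivative_transform_within_open[OF _ open_U u]) (rule J_vector)
    then show ?thesis by (rule fun_cong[OF frechet_derivative_at[symmetric]])
  qed
  then show ?thesis using second_derivative_symmetric[OF open_U u smooth_\<tau>] by metis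
qed

lemma \<tau>_has_derivative: "u \<in> U \<Longrightarrow> (\<tau> has_derivative (*v) (J u)) (at u)"
  using smooth_on_has_derivative[OF smooth_\<tau>] J_vector by (metis ext)

lemma dG_transform:
  assumes u: "u \<in> U"
  shows "ip (frechet_derivative G (at u) z) v w =
      ip (frechet_derivative G' (at (\<tau> u)) (J u *v z)) (J u *v v) (J u *v w)
    + ip (G' (\<tau> u)) (frechet_derivative J (at u) z *v v) (J u *v w)
    + ip (G' (\<tau> u)) (J u *v v) (frechet_derivative J (at u) z *v w)"
proof -
  have dG': "((\<lambda>y. G' (\<tau> y)) has_derivative (\<lambda>z. frechet_derivative G' (at (\<tau> u)) (J u *v z))) (at u)"
    by (rule has_derivative_compose[OF \<tau>_has_derivative[OF u] smooth_on_has_derivative[OF M'.smooth_G \<tau>[OF u]]])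
  have dJ: "((\<lambda>y. J y *v v) has_derivative (\<lambda>z. frechet_derivative J (at u) z *v v)) (at u)" for v
    by (rule bounded_linear.has_derivative[OF bounded_bilinear.bounded_linear_left[OF bounded_bilinear_matrix_vector_mult]
          smooth_on_has_derivative[OF smooth_J u]])
  have "((\<lambda>y. (J y *v v) \<bullet> (G' (\<tau> y) *v (J y *v w))) has_derivative
     (\<lambda>z. (J u *v v) \<bullet> (G' (\<tau> u) *v (frechet_derivative J (at u) z *v w) + frechet_derivative G' (at (\<tau> u)) (J u *v z) *v (J u *v w))
       + (frechet_derivative J (at u) z *v v) \<bullet> (G' (\<tau> u) *v (J u *v w)))) (at u)"
    by (rule has_derivative_inner[OF dJ bounded_bilinear.FDERIV[OF bounded_bilinear_matrix_vector_mult dG' dJ]])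
  then have "((\<lambda>y. ip (G y) v w) has_derivative
     (\<lambda>z. (J u *v v) \<bullet> (G' (\<tau> u) *v (frechet_derivative J (at u) z *v w) + frechet_derivative G' (at (\<tau> u)) (J u *v z) *v (J u *v w))
       + (frechet_derivative J (at u) z *v v) \<bullet> (G' (\<tau> u) *v (J u *v w)))) (at u)"
    by (rule has_derivative_transform_within_open[OF _ open_U u]) (use J_isometry in \<open>auto simp: ip_def\<close>)
  from fun_cong[OF frechet_derivative_at[OF this], of z] show ?thesis
    unfolding frechet_derivative_ip[OF u] by (simp add: ip_def inner_add_right)
qed

text \<open>By Koszul's formula; the second derivatives of \<open>\<tau>\<close> drop out since they are symmetric.\<close>

lemma Dm_transform:
  assumes u: "u \<in> U" and V: "V differentiable (at u)" and V': "V' differentiable (at (\<tau> u))"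
    and VV': "\<And>y. y \<in> U \<Longrightarrow> V' (\<tau> y) = J y *v V y"
  shows "M'.Dm V' (\<tau> u) ** J u = J u ** Dm V u"
proof -
  let ?dJ = "frechet_derivative J (at u)" and ?G' = "G' (\<tau> u)" and ?dG' = "frechet_derivative G' (at (\<tau> u))"
  have dV: "frechet_derivative V' (at (\<tau> u)) (J u *v v) = J u *v frechet_derivative V (at u) v + ?dJ v *v V u" for v
  proof -
    have "((\<lambda>y. V' (\<tau> y)) has_derivative (\<lambda>v. frechet_derivative V' (at (\<tau> u)) (J u *v v))) (at u)"
      by (rule has_derivative_compose[OF \<tau>_has_derivative[OF u]]) (use V' frechet_derivative_works in blast)
    moreover have "((\<lambda>y. J y *v V y) has_derivative (\<lambda>v. J u *v frechet_derivative V (at u) v + ?dJ v *v V u)) (at u)"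
      by (rule bounded_bilinear.FDERIV[OF bounded_bilinear_matrix_vector_mult smooth_on_has_derivative[OF smooth_J u]])
        (use V frechet_derivative_works in blast)
    then have "((\<lambda>y. V' (\<tau> y)) has_derivative (\<lambda>v. J u *v frechet_derivative V (at u) v + ?dJ v *v V u)) (at u)"
      by (rule has_derivative_transform_within_open[OF _ open_U u]) (simp add: VV')
    ultimately have "(\<lambda>v. frechet_derivative V' (at (\<tau> u)) (J u *v v)) = (\<lambda>v. J u *v frechet_derivative V (at u) v + ?dJ v *v V u)"
      by (rule has_derivative_unique)
    then show ?thesis by (rule fun_cong)
  qed
  \<comment> \<open>Koszul's formula is inserted in both charts, so that no transformation law for
    the Christoffel symbols has to be stated.\<close>
  have A: "2 * ip (G u) (Dm V u *v v) w = 2 * ip (G u) (frechet_derivative V (at u) v) w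
      + ip (frechet_derivative G (at u) v) (V u) w + ip (frechet_derivative G (at u) (V u)) v w - ip (frechet_derivative G (at u) w) v (V u)"
    for v w
    unfolding nabla_Dm[OF u V, of "\<lambda>_. v", symmetric] using koszul[OF u, of v "V u" w] by (simp add: nabla_def ip_add_left)
  have A': "2 * ip ?G' (M'.Dm V' (\<tau> u) *v v) w = 2 * ip ?G' (frechet_derivative V' (at (\<tau> u)) v) w
      + ip (?dG' v) (J u *v V u) w + ip (?dG' (J u *v V u)) v w - ip (?dG' w) v (J u *v V u)" for v w
    unfolding M'.nabla_Dm[OF \<tau>[OF u] V', of "\<lambda>_. v", symmetric] using M'.koszul[OF \<tau>[OF u], of v "V' (\<tau> u)" w]
    by (simp add: nabla_def ip_add_left VV'[OF u])
  have "M'.Dm V' (\<tau> u) *v (J u *v v) = J u *v (Dm V u *v v)" for v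
  proof (rule eq_via_J[OF u])
    fix w
    have "2 * ip ?G' (M'.Dm V' (\<tau> u) *v (J u *v v)) (J u *v w) = 2 * ip ?G' (J u *v (Dm V u *v v)) (J u *v w)"
      unfolding A' J_isometry[OF u] A dG_transform[OF u] dV ip_add_left
      using dJ_commute[OF u, of v "V u"] dJ_commute[OF u, of v w] dJ_commute[OF u, of w "V u"]
        M'.ip_commute[OF \<tau>[OF u]] by (simp add: J_isometry[OF u])
    then show "ip ?G' (M'.Dm V' (\<tau> u) *v (J u *v v)) (J u *v w) = ip ?G' (J u *v (Dm V u *v v)) (J u *v w)" by simp
  qed
  then show ?thesis
    by (simp add: matrix_eq flip: matrix_vector_mul_assoc)
qed

lemma trace_conjugate: "u \<in> U \<Longrightarrow> A' ** J u = J u ** A \<Longrightarrow> trace A' = trace A"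
proof -
  assume u: "u \<in> U" and e: "A' ** J u = J u ** A"
  have "A' = J u ** (A ** matrix_inv (J u))"
    by (metis e det_J[OF u] invertible_matrix_inv(1) matrix_mul_assoc matrix_mul_rid)
  then have "trace A' = trace (A ** matrix_inv (J u) ** J u)" by (metis trace_mul_sym)
  then show ?thesis
    by (simp add: matrix_mul_assoc[symmetric] invertible_matrix_inv(2)[OF det_J[OF u]])
qed

lemma divergence_transform:
  assumes "u \<in> U" "V differentiable (at u)" "V' differentiable (at (\<tau> u))"
    "\<And>y. y \<in> U \<Longrightarrow> V' (\<tau> y) = J y *v V y"
  shows "M'.divergence V' (\<tau> u) = divergence V u"
  unfolding divergence_trace M'.divergence_trace by (rule trace_conjugate[OF assms(1) Dm_transform[OF assms]])

text \<open>An isometry carries adjoints to adjoints, so the law for \<open>Dm\<close> passes to its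
  skew part; this is what makes \<phi>\<xi> a vector field.\<close>

lemma Phi_transform:
  assumes u: "u \<in> U" and "V differentiable (at u)" "V' differentiable (at (\<tau> u))"
    "\<And>y. y \<in> U \<Longrightarrow> V' (\<tau> y) = J y *v V y"
  shows "M'.Phi V' (\<tau> u) *v (J u *v v) = J u *v (Phi V u *v v)"
proof (rule eq_via_J[OF u])
  fix w
  have D: "M'.Dm V' (\<tau> u) *v (J u *v v) = J u *v (Dm V u *v v)" for v
    using Dm_transform[OF assms] by (simp add: matrix_vector_mul_assoc)
  show "ip (G' (\<tau> u)) (M'.Phi V' (\<tau> u) *v (J u *v v)) (J u *v w) = ip (G' (\<tau> u)) (J u *v (Phi V u *v v)) (J u *v w)"
    by (simp add: M'.Phi_def Phi_def matrix_vector_distribs ip_scaleR_left ip_diff_left M'.ip_adj \<tau> u ip_adj D J_isometry)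
qed

end

section \<open>Divergence theorem in a chart\<close>

text \<open>By translation invariance the difference quotients of \<open>F\<close> integrate to \<open>0\<close>; then dominated convergence.\<close>

lemma has_bochner_integral_frechet_derivative_compact_support:
  fixes F :: "'a::euclidean_space \<Rightarrow> real"
  assumes F: "Ck_on 1 UNIV F" and K: "compact K" and F0: "\<And>x. x \<notin> K \<Longrightarrow> F x = 0"
  shows "has_bochner_integral lborel (\<lambda>x. frechet_derivative F (at x) v) 0"
proof -
  define d where "d x = frechet_derivative F (at x) v" for x
  have dF: "(F has_derivative frechet_derivative F (at x)) (at x)" for x
    using F by (simp add: frechet_derivative_works[symmetric])
  have contF: "continuous_on UNIV F" using Ck_on_SucD[of 0 UNIV F] F by simp
  have contd: "continuous_on UNIV d" using F by (simp add: d_def[abs_def])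
  have d0: "d x = 0" if "x \<notin> K" for x
  proof -
    have "(F has_derivative (\<lambda>_. 0)) (at x)"
      by (rule has_derivative_transform_within_open[OF has_derivative_const[of 0] open_Compl[OF compact_imp_closed[OF K]]])
        (use that F0 in auto)
    then show ?thesis unfolding d_def by (metis frechet_derivative_at)
  qed
  have int: "integrable lborel \<phi>" if "continuous_on UNIV \<phi>" "\<And>x. x \<notin> K \<Longrightarrow> \<phi> x = 0" for \<phi> :: "'a \<Rightarrow> real"
  proof -
    have "integrable lborel (\<lambda>x. indicator K x *\<^sub>R \<phi> x)"
      by (rule borel_integrable_compact[OF K continuous_on_subset[OF that(1)]]) simp
    moreover have "(\<lambda>x. indicator K x *\<^sub>R \<phi> x) = \<phi>" by (rule ext) (use that(2) in \<open>auto simp: indicator_def\<close>)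
    ultimately show ?thesis by simp
  qed
  obtain R where R: "K \<subseteq> cball 0 R" using compact_imp_bounded[OF K] unfolding bounded_iff by (metis mem_cball_0 subsetI)
  have "bounded (d ` K)"
    by (intro compact_imp_bounded compact_continuous_image K continuous_on_subset[OF contd]) simp
  then obtain B where B: "\<And>x. x \<in> K \<Longrightarrow> \<bar>d x\<bar> \<le> B" unfolding bounded_iff by auto
  \<comment> \<open>For empty \<open>K\<close> the bound \<open>B\<close> may be negative, hence its
    absolute value.\<close>
  have B': "\<bar>d x\<bar> \<le> \<bar>B\<bar>" for x using B[of x] d0[of x] by fastforce
  \<comment> \<open>The successor keeps the step positive and at most 1; the latter confines the
    supports of all difference quotients to one ball.\<close>
  define h where "h n = 1 / real (Suc n)" for n
  have h: "h n > 0" "h n \<le> 1" for n by (simp_all add: h_def)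
  define s where "s n x = (F (x + h n *\<^sub>R v) - F x) / h n" for n x
  have line: "((\<lambda>t. F (x + t *\<^sub>R v)) has_real_derivative d (x + t *\<^sub>R v)) (at t)" for x t
  proof -
    have "((\<lambda>t. F (x + t *\<^sub>R v)) has_derivative (\<lambda>k. frechet_derivative F (at (x + t *\<^sub>R v)) (k *\<^sub>R v))) (at t)"
      by (rule has_derivative_compose[OF _ dF]) (auto intro!: derivative_eq_intros)
    then show ?thesis
      unfolding has_field_derivative_def
      by (rule has_derivative_eq_rhs) (simp add: fun_eq_iff d_def linear_cmul[OF has_derivative_linear[OF dF]])
  qed
  \<comment> \<open>By the mean value theorem a difference quotient is a value of the derivative, so
    it inherits the bound \<open>B'\<close>.\<close>
  have s_eq: "\<exists>y. s n x = d y" for n x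
    using MVT2[OF h(1)[of n], of "\<lambda>t. F (x + t *\<^sub>R v)" "\<lambda>t. d (x + t *\<^sub>R v)"] line h(1)[of n]
    by (auto simp: s_def field_simps)
  have lim: "(\<lambda>n. s n x) \<longlonglongrightarrow> d x" for x
  proof -
    have "((\<lambda>k. (F (x + k *\<^sub>R v) - F x) / k) \<longlongrightarrow> d x) (at 0)"
      using line[of x 0] by (simp add: DERIV_def)
    moreover have "filterlim h (at 0) sequentially"
      unfolding filterlim_at using h(1) LIMSEQ_inverse_real_of_nat less_imp_neq[OF h(1), symmetric]
      by (auto simp: h_def[abs_def] inverse_eq_divide intro!: always_eventually)
    ultimately show ?thesis unfolding s_def by (rule filterlim_compose)
  qed
  have intF: "integrable lborel F" by (rule int[OF contF F0])
  have shift: "has_bochner_integral lborel (\<lambda>x. F (x + w)) (integral\<^sup>L lborel F)" for w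
  proof -
    have "has_bochner_integral (distr lborel borel ((+) w)) F (integral\<^sup>L lborel F)"
      using intF by (simp add: lborel_distr_plus has_bochner_integral_integrable)
    then show ?thesis
      using integrable_distr_eq[of "(+) w" lborel borel F] integral_distr[of "(+) w" lborel borel F]
        borel_measurable_continuous_onI[OF contF]
      by (simp add: has_bochner_integral_iff add.commute)
  qed
  have s0: "has_bochner_integral lborel (s n) 0" for n
  proof -
    have "has_bochner_integral lborel (\<lambda>x. (F (x + h n *\<^sub>R v) - F x) / h n) ((integral\<^sup>L lborel F - integral\<^sup>L lborel F) / h n)"
      using intF by (intro has_bochner_integral_divide_zero has_bochner_integral_diff shift has_bochner_integral_integrable)
    then show ?thesis by (simp add: s_def[abs_def])
  qed
  have bd: "norm (s n x) \<le> indicator (cball 0 (R + norm v)) x * \<bar>B\<bar>" for n x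
  proof (cases "x \<in> cball 0 (R + norm v)")
    case True
    then show ?thesis using s_eq[of n x] B' by auto
  next
    case False
    have "norm (h n *\<^sub>R v) \<le> norm v" using h[of n] by (simp add: mult_left_le_one_le)
    then have "norm (x + h n *\<^sub>R v) > R" using False norm_triangle_ineq4[of "x + h n *\<^sub>R v" "h n *\<^sub>R v"] by auto
    moreover have "norm x > R" using False by (simp add: not_le) (smt (verit) norm_ge_zero)
    ultimately have "F (x + h n *\<^sub>R v) = 0" "F x = 0" using R F0 by (meson mem_cball_0 not_less subset_eq)+
    then show ?thesis by (simp add: s_def)
  qed
  have m: "d \<in> borel_measurable lborel" using borel_measurable_continuous_onI[OF contd] by simp
  have w: "integrable lborel (\<lambda>x. indicator (cball 0 (R + norm v)) x * \<bar>B\<bar> :: real)"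
    using borel_integrable_compact[OF compact_cball[of 0 "R + norm v"], of "\<lambda>_. \<bar>B\<bar>"] by simp
  have ms: "s n \<in> borel_measurable lborel" for n
    using s0[of n] by (auto simp: has_bochner_integral_iff)
  have "(\<lambda>n. integral\<^sup>L lborel (s n)) \<longlonglongrightarrow> integral\<^sup>L lborel d"
    by (rule integral_dominated_convergence[OF m ms w]) (use lim bd in auto)
  moreover have "integral\<^sup>L lborel (s n) = 0" for n
    using s0 by (simp add: has_bochner_integral_iff)
  ultimately have "integral\<^sup>L lborel d = 0" by (simp add: LIMSEQ_const_iff)
  then show ?thesis
    using int[OF contd d0] by (simp add: has_bochner_integral_iff flip: d_def)
qed

lemma Ck_on_open_Un:
  assumes "open S" "open T" "Ck_on k S f" "Ck_on k T f"
  shows "Ck_on k (S \<union> T) f"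
  using assms(3,4)
proof (induction k arbitrary: f)
  case 0
  then show ?case using assms(1,2) by (simp add: continuous_on_open_Un)
next
  case (Suc k)
  then show ?case by auto
qed

context chart_metric begin

definition vol :: "real^'n \<Rightarrow> real" where
  "vol u = sqrt (det (G u))"

lemma vol_pos: "u \<in> U \<Longrightarrow> vol u > 0"
  by (simp add: vol_def det_G_pos)

lemma vol_has_derivative:
  assumes u: "u \<in> U"
  shows "(vol has_derivative (\<lambda>v. vol u * (1/2 * trace (H u ** frechet_derivative G (at u) v)))) (at u)"
proof -
  have d: "((\<lambda>u. det (G u)) has_derivative (\<lambda>v. det (G u) * trace (H u ** frechet_derivative G (at u) v))) (at u)"
    by (rule has_derivative_compose[OF smooth_on_has_derivative[OF smooth_G u] det_has_derivative[OF det_G_neq_0[OF u]]])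
  have e: "det (G u) = vol u * vol u" using det_G_pos[OF u] by (simp add: vol_def)
  have "(vol has_derivative (\<lambda>v. det (G u) * trace (H u ** frechet_derivative G (at u) v) * (inverse (vol u) / 2))) (at u)"
    using has_derivative_real_sqrt[OF det_G_pos[OF u] d] unfolding vol_def[abs_def] by (simp add: mult.assoc)
  then show ?thesis
    unfolding e using vol_pos[OF u] by (simp add: field_simps)
qed

text \<open>Jacobi's formula gives half the trace of the inverse metric times its derivative; by
  \<open>pd_G\<close> that derivative is two mutually transposed Christoffel terms of equal
  trace.\<close>

lemma pd_vol:
  assumes u: "u \<in> U" shows "pd k vol u = vol u * trace (Gam k u)"
proof -
  have "trace (H u ** pd k G u) = 2 * trace (Gam k u)"
    using trace_mul_sym[of "H u" "transpose (Gam k u) ** G u"]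
    by (simp add: pd_G[OF u] matrix_mult_distribs trace_add matrix_mul_assoc H_G[OF u])
      (simp add: matrix_mul_assoc[symmetric] G_H[OF u] trace_transpose)
  then show ?thesis
    using pd_eqI[OF vol_has_derivative[OF u], of k] by (simp add: pd_def)
qed

lemma Ck_on_vol: "Ck_on 1 U vol"
proof -
  have "smooth_on U (\<lambda>u. trace (H u ** frechet_derivative G (at u) v))" for v
    by (intro smooth_on_bounded_linear[OF open_U bounded_linear_trace] smooth_on_matrix_mult smooth_H
        smooth_on_frechet_derivative smooth_G open_U)
  moreover have "continuous_on U vol"
    using vol_has_derivative has_derivative_continuous by (blast intro: continuous_at_imp_continuous_on)
  ultimately have "continuous_on U (\<lambda>u. vol u * (1/2 * trace (H u ** frechet_derivative G (at u) v)))" for v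
    by (intro continuous_intros) (auto intro: smooth_on_continuous_on)
  then show ?thesis
    using Ck_on_Suc_has_derivativeI[OF open_U vol_has_derivative, of 0] by simp
qed

text \<open>The density of the volume turns the covariant divergence into the Euclidean one:
  \<open>\<Sum>\<^sub>k \<partial>\<^sub>k (vol \<cdot> f \<cdot> W\<^sup>k) = vol \<cdot> (f \<cdot> div W + df(W))\<close>.\<close>

lemma divergence_theorem_compact_support:
  assumes W: "smooth_on U W" and f: "Ck_on 1 U f" and K: "compact K" "K \<subseteq> U"
    and f0: "\<And>u. u \<in> U \<Longrightarrow> u \<notin> K \<Longrightarrow> f u = 0"
  shows "has_bochner_integral lborel
    (\<lambda>u. indicator U u * (vol u * (f u * divergence W u + frechet_derivative f (at u) (W u)))) 0"
proof -
  \<comment> \<open>Cut off outside \<open>U\<close>, where \<open>vol\<close>, \<open>f\<close> and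
    \<open>W\<close> are arbitrary. The result is C1 on \<open>U\<close> and on the complement of
    \<open>K\<close>, which together cover the space.\<close>
  define F where "F k u = (if u \<in> U then vol u * f u * W u $ k else 0)" for k u
  have Wk: "smooth_on U (\<lambda>u. W u $ k)" for k
    by (rule smooth_on_bounded_linear[OF open_U bounded_linear_vec_nth W])
  have FU: "Ck_on 1 U (\<lambda>u. vol u * f u * W u $ k)" for k
    using Ck_on_vol f Wk by (intro Ck_on_bilinear[OF open_U bounded_bilinear_mult]) (auto simp: smooth_on_def)
  have "Ck_on 1 UNIV (F k)" for k
  proof -
    have "Ck_on 1 U (F k)"
      by (rule Ck_on_cong_imp[OF open_U _ FU[of k]]) (simp add: F_def)
    moreover have "Ck_on 1 (- K) (F k)"
      by (rule Ck_on_cong_imp[OF open_Compl[OF compact_imp_closed[OF K(1)]] _ Ck_on_const[of 1 _ 0]]) (use f0 in \<open>auto simp: F_def\<close>)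
    ultimately have "Ck_on 1 (U \<union> - K) (F k)"
      using compact_imp_closed[OF K(1)] open_U by (intro Ck_on_open_Un) auto
    moreover have "U \<union> - K = UNIV" using K by auto
    ultimately show ?thesis by simp
  qed
  then have "has_bochner_integral lborel (\<lambda>u. pd k (F k) u) 0" for k
    unfolding pd_def using f0 by (intro has_bochner_integral_frechet_derivative_compact_support[OF _ K(1)]) (auto simp: F_def)
  then have "has_bochner_integral lborel (\<lambda>u. \<Sum>k\<in>UNIV. pd k (F k) u) (\<Sum>k\<in>(UNIV :: 'n set). 0)"
    by (intro has_bochner_integral_sum)
  moreover have "(\<Sum>k\<in>UNIV. pd k (F k) u) = indicator U u * (vol u * (f u * divergence W u + frechet_derivative f (at u) (W u)))" for u
  proof (cases "u \<in> U")
    case True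
    have d: "vol differentiable (at u)" "f differentiable (at u)" "(\<lambda>u. W u $ k) differentiable (at u)" "W differentiable (at u)" for k
      using Ck_on_vol f True differentiable_U[OF Wk] differentiable_U[OF W] by auto
    have "pd k (F k) u = pd k (\<lambda>u. vol u * f u * W u $ k) u" for k
      using pd_cong[OF open_U True, of "\<lambda>u. vol u * f u * W u $ k" "F k"] FU True by (auto simp: F_def)
    also have "\<dots> k = vol u * f u * pd k W u $ k + vol u * pd k f u * W u $ k + vol u * trace (Gam k u) * f u * W u $ k" for k
      using d by (simp add: pd_bilinear[OF bounded_bilinear_mult] pd_nth pd_vol[OF True] distrib_right)
    finally have "(\<Sum>k\<in>UNIV. pd k (F k) u) = vol u * f u * (\<Sum>k\<in>UNIV. pd k W u $ k)
        + vol u * (\<Sum>k\<in>UNIV. W u $ k * pd k f u) + vol u * f u * (\<Sum>k\<in>UNIV. W u $ k * trace (Gam k u))"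
      by (simp add: sum.distrib sum_distrib_left mult_ac)
    also have "(\<Sum>k\<in>UNIV. W u $ k * pd k f u) = frechet_derivative f (at u) (W u)"
      using d by (simp add: frechet_derivative_sum_pd)
    \<comment> \<open>The derivative of the density is the Christoffel term of the divergence, by
      symmetry of the lower indices.\<close>
    also have "(\<Sum>k\<in>UNIV. W u $ k * trace (Gam k u)) = (\<Sum>j\<in>UNIV. (Gam j u *v W u) $ j)"
    proof -
      have "(\<Sum>k\<in>UNIV. W u $ k * trace (Gam k u)) = (\<Sum>k\<in>UNIV. \<Sum>j\<in>UNIV. Gam j u $ j $ k * W u $ k)"
        unfolding trace_def sum_distrib_left
        by (intro sum.cong refl) (simp add: Gam_commute[OF True, of _ _ _] mult.commute)
      also have "\<dots> = (\<Sum>j\<in>UNIV. \<Sum>k\<in>UNIV. Gam j u $ j $ k * W u $ k)" by (rule sum.swap)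
      finally show ?thesis by (simp add: matrix_vector_mult_def)
    qed
    finally show ?thesis
      using True by (simp add: divergence_def cov_def sum.distrib algebra_simps)
  next
    case False
    have "(F k has_derivative (\<lambda>_. 0)) (at u)" for k
      by (rule has_derivative_transform_within_open[OF has_derivative_const[of 0] open_Compl[OF compact_imp_closed[OF K(1)]]])
        (use False K f0 in \<open>auto simp: F_def\<close>)
    then have "pd k (F k) u = 0" for k using pd_eqI[of "F k" "\<lambda>_. 0" u k] by simp
    then show ?thesis using False by simp
  qed
  ultimately show ?thesis by simp
qed

end

section \<open>The Riemannian volume\<close>

lemma Ck_on_subset: "Ck_on k S f \<Longrightarrow> T \<subseteq> S \<Longrightarrow> Ck_on k T f"
proof (induction k arbitrary: f)
  case 0
  then show ?case using continuous_on_subset by auto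
next
  case (Suc k)
  then show ?case by auto
qed

lemma smooth_on_subset: "smooth_on S f \<Longrightarrow> T \<subseteq> S \<Longrightarrow> smooth_on T f"
  using Ck_on_subset unfolding smooth_on_def by blast

locale atlas_metric =
  fixes \<A> :: "('a::{t2_space, second_countable_topology}, 'n::finite) chart set" and g :: "('a, 'n) metric"
  assumes atlas: "smooth_atlas \<A>" and metric: "riemannian_metric \<A> g"
begin

lemma open_dom: "c \<in> \<A> \<Longrightarrow> open (chart_dom c)"
  and open_img: "c \<in> \<A> \<Longrightarrow> open (chart_img c)"
  and chart_homeomorphism: "c \<in> \<A> \<Longrightarrow> homeomorphism (chart_dom c) (chart_img c) (chart_map c) (chart_inv c)"
  using atlas unfolding smooth_atlas_def by blast+

lemma inv_map: "c \<in> \<A> \<Longrightarrow> p \<in> chart_dom c \<Longrightarrow> chart_inv c (chart_map c p) = p"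
  using chart_homeomorphism homeomorphism_apply1 by blast

lemma map_inv: "c \<in> \<A> \<Longrightarrow> u \<in> chart_img c \<Longrightarrow> chart_map c (chart_inv c u) = u"
  using chart_homeomorphism homeomorphism_apply2 by blast

lemma map_in: "p \<in> chart_dom c \<Longrightarrow> chart_map c p \<in> chart_img c"
  by (simp add: chart_img_def)

lemma inv_in: "c \<in> \<A> \<Longrightarrow> u \<in> chart_img c \<Longrightarrow> chart_inv c u \<in> chart_dom c"
  using chart_homeomorphism homeomorphism_image2 by blast

lemma continuous_on_map: "c \<in> \<A> \<Longrightarrow> continuous_on (chart_dom c) (chart_map c)"
  and continuous_on_inv: "c \<in> \<A> \<Longrightarrow> continuous_on (chart_img c) (chart_inv c)"
  using chart_homeomorphism homeomorphism_cont1 homeomorphism_cont2 by blast+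

lemma chart_at: "chart_at \<A> p \<in> \<A>" "p \<in> chart_dom (chart_at \<A> p)"
proof -
  have "\<exists>c. c \<in> \<A> \<and> p \<in> chart_dom c" using atlas unfolding smooth_atlas_def by blast
  from someI_ex[OF this] show "chart_at \<A> p \<in> \<A>" "p \<in> chart_dom (chart_at \<A> p)"
    unfolding chart_at_def by auto
qed

lemma overlap_iff: "c \<in> \<A> \<Longrightarrow> u \<in> overlap c d \<longleftrightarrow> u \<in> chart_img c \<and> chart_inv c u \<in> chart_dom d"
proof
  assume "c \<in> \<A>" "u \<in> overlap c d"
  then show "u \<in> chart_img c \<and> chart_inv c u \<in> chart_dom d"
    by (auto simp: overlap_def inv_map map_in)
next
  assume "c \<in> \<A>" "u \<in> chart_img c \<and> chart_inv c u \<in> chart_dom d"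
  then show "u \<in> overlap c d"
    unfolding overlap_def by (intro image_eqI[of _ _ "chart_inv c u"]) (auto simp: map_inv inv_in)
qed

lemma map_overlap: "p \<in> chart_dom c \<Longrightarrow> p \<in> chart_dom d \<Longrightarrow> chart_map c p \<in> overlap c d"
  by (simp add: overlap_def)

lemma overlap_subset: "overlap c d \<subseteq> chart_img c"
  by (auto simp: overlap_def chart_img_def)

lemma open_inv_vimage: "c \<in> \<A> \<Longrightarrow> open B \<Longrightarrow> open {u \<in> chart_img c. chart_inv c u \<in> B}"
  using continuous_open_preimage[OF continuous_on_inv open_img] by (simp add: vimage_def Int_def)

lemma open_map_vimage: "c \<in> \<A> \<Longrightarrow> open B \<Longrightarrow> open {p \<in> chart_dom c. chart_map c p \<in> B}"
  using continuous_open_preimage[OF continuous_on_map open_dom] by (simp add: vimage_def Int_def)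

lemma open_overlap: "c \<in> \<A> \<Longrightarrow> d \<in> \<A> \<Longrightarrow> open (overlap c d)"
proof -
  assume "c \<in> \<A>" "d \<in> \<A>"
  moreover from this have "overlap c d = {u \<in> chart_img c. chart_inv c u \<in> chart_dom d}"
    using overlap_iff by blast
  ultimately show ?thesis using open_inv_vimage open_dom by simp
qed

lemma transition_in:
  assumes "c \<in> \<A>" "d \<in> \<A>" "u \<in> overlap c d"
  shows "transition c d u \<in> overlap d c" "chart_inv d (transition c d u) = chart_inv c u"
    "transition d c (transition c d u) = u" "transition c d u \<in> chart_img d"
  using assms inv_map map_inv map_in[of _ d] inv_in by (auto simp: overlap_iff transition_def)

lemma transition_map: "c \<in> \<A> \<Longrightarrow> p \<in> chart_dom c \<Longrightarrow> transition c d (chart_map c p) = chart_map d p"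
  by (simp add: transition_def inv_map)

lemma chart_metric: "c \<in> \<A> \<Longrightarrow> chart_metric (chart_img c) (g c)"
  using metric open_img unfolding riemannian_metric_def chart_metric_def by blast

lemma chart_change:
  assumes c: "c \<in> \<A>" and d: "d \<in> \<A>"
  shows "chart_change (overlap c d) (g c) (chart_img d) (g d) (transition c d)"
proof -
  have "chart_metric (overlap c d) (g c)"
    using chart_metric[OF c] open_overlap[OF c d] overlap_subset[of c d] smooth_on_subset
    unfolding chart_metric_def by blast
  moreover have "chart_change_axioms (overlap c d) (g c) (chart_img d) (g d) (transition c d)"
    using atlas metric c d transition_in(4)[OF c d]
    unfolding chart_change_axioms_def smooth_atlas_def riemannian_metric_def by blast
  ultimately show ?thesis
    using chart_metric[OF d] by (simp add: chart_change_def)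
qed

definition density_on :: "('a, 'n) chart \<Rightarrow> real^'n \<Rightarrow> real" where
  "density_on c u = indicator (chart_img c) u * sqrt (det (g c u))"

text \<open>Made total so that it is Borel on the whole coordinate space. The default value carries
  no mass, as \<open>density_on c\<close> vanishes outside the image of the chart.\<close>

definition total_inv :: "('a, 'n) chart \<Rightarrow> real^'n \<Rightarrow> 'a" where
  "total_inv c u = (if u \<in> chart_img c then chart_inv c u else undefined)"

definition chart_measure :: "('a, 'n) chart \<Rightarrow> 'a measure" where
  "chart_measure c = distr (density lborel (density_on c)) borel (total_inv c)"

lemma density_on_nonneg: "c \<in> \<A> \<Longrightarrow> 0 \<le> density_on c u"
  using chart_metric.det_G_pos[OF chart_metric] by (auto simp: density_on_def indicator_def less_imp_le)

lemma measurable_density_on: "c \<in> \<A> \<Longrightarrow> density_on c \<in> borel_measurable borel"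
proof -
  assume c: "c \<in> \<A>"
  have "continuous_on (chart_img c) (\<lambda>u. sqrt (det (g c u)))"
    using Ck_on_SucD[OF chart_metric.Ck_on_vol[OF chart_metric[OF c], unfolded One_nat_def]]
      chart_metric.vol_def[OF chart_metric[OF c]] by (simp cong: continuous_on_cong)
  from borel_measurable_continuous_on_indicator[OF _ this] open_img[OF c] show ?thesis
    by (simp add: density_on_def[abs_def])
qed

lemma measurable_total_inv: "c \<in> \<A> \<Longrightarrow> total_inv c \<in> borel \<rightarrow>\<^sub>M borel"
proof -
  assume c: "c \<in> \<A>"
  have "chart_inv c \<in> borel_measurable (restrict_space borel (chart_img c))"
    by (rule borel_measurable_continuous_on_restrict[OF continuous_on_inv[OF c]])
  then show ?thesis
    using open_img[OF c] by (subst (asm) measurable_restrict_space_iff[where c = undefined]) (auto simp: total_inv_def[abs_def])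
qed

lemma sets_chart_measure [simp]: "sets (chart_measure c) = sets borel"
  and space_chart_measure [simp]: "space (chart_measure c) = UNIV"
  by (simp_all add: chart_measure_def)

lemma emeasure_chart_measure:
  assumes c: "c \<in> \<A>" and B: "B \<in> sets borel"
  shows "emeasure (chart_measure c) B =
    (\<integral>\<^sup>+u. ennreal (indicator (chart_map c ` (B \<inter> chart_dom c)) u * sqrt (det (g c u))) \<partial>lborel)"
proof -
  note m = measurable_total_inv[OF c] measurable_density_on[OF c]
  have "emeasure (chart_measure c) B = emeasure (density lborel (density_on c)) (total_inv c -` B)"
    using m B by (simp add: chart_measure_def emeasure_distr)
  also have "\<dots> = (\<integral>\<^sup>+u. ennreal (density_on c u) * indicator (total_inv c -` B) u \<partial>lborel)"
    using m(2) measurable_sets[OF m(1) B] by (subst emeasure_density) auto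
  also have "\<dots> = (\<integral>\<^sup>+u. ennreal (indicator (chart_map c ` (B \<inter> chart_dom c)) u * sqrt (det (g c u))) \<partial>lborel)"
  proof (intro nn_integral_cong)
    fix u
    have "u \<in> chart_map c ` (B \<inter> chart_dom c) \<longleftrightarrow> u \<in> chart_img c \<and> total_inv c u \<in> B"
      using inv_map[OF c] map_inv[OF c] inv_in[OF c] map_in[of _ c] by (force simp: total_inv_def image_iff)
    then show "ennreal (density_on c u) * indicator (total_inv c -` B) u
      = ennreal (indicator (chart_map c ` (B \<inter> chart_dom c)) u * sqrt (det (g c u)))"
      by (auto simp: density_on_def indicator_def)
  qed
  finally show ?thesis .
qed

lemma emeasure_chart_measure_Int_dom:
  assumes c: "c \<in> \<A>" and B: "B \<in> sets borel"
  shows "emeasure (chart_measure c) (B \<inter> chart_dom c) = emeasure (chart_measure c) B"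
  using assms open_dom[OF c] by (simp add: emeasure_chart_measure)

lemma sets_map_image: "c \<in> \<A> \<Longrightarrow> B \<in> sets borel \<Longrightarrow> B \<subseteq> chart_dom c \<Longrightarrow> chart_map c ` B \<in> sets borel"
proof -
  assume c: "c \<in> \<A>" and B: "B \<in> sets borel" "B \<subseteq> chart_dom c"
  have "chart_map c ` B = chart_img c \<inter> total_inv c -` B"
    using B inv_map[OF c] map_inv[OF c] inv_in[OF c] map_in[of _ c] by (force simp: total_inv_def image_iff)
  then show ?thesis
    using open_img[OF c] measurable_sets[OF measurable_total_inv[OF c] B(1)] by auto
qed

text \<open>The change of variables is available for finite integrals only; the general case follows by exhaustion.\<close>

lemma chart_measure_compat_finite:
  assumes c: "c \<in> \<A>" and d: "d \<in> \<A>" and B: "B \<in> sets borel" "B \<subseteq> chart_dom c" "B \<subseteq> chart_dom d"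
    and fin: "emeasure (chart_measure c) B < \<infinity>"
  shows "emeasure (chart_measure d) B = emeasure (chart_measure c) B"
proof -
  interpret cd: chart_change "overlap c d" "g c" "chart_img d" "g d" "transition c d" by (rule chart_change[OF c d])
  interpret dc: chart_change "overlap d c" "g d" "chart_img c" "g c" "transition d c" by (rule chart_change[OF d c])
  let ?S = "chart_map c ` B" and ?T = "chart_map d ` B"
  have S: "?S \<in> sets borel" "?S \<subseteq> overlap c d" and T: "?T \<in> sets borel" "?T \<subseteq> overlap d c"
    using B c d sets_map_image map_overlap[of _ c d] map_overlap[of _ d c] by (auto simp: subset_iff)
  have Bc: "B \<inter> chart_dom c = B" "B \<inter> chart_dom d = B" using B by auto
  have meas: "(\<lambda>u. indicator (chart_map b ` B) u * sqrt (det (g b u))) \<in> borel_measurable borel"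
    if "b \<in> \<A>" "B \<subseteq> chart_dom b" for b
  proof -
    have "(\<lambda>u. indicator (chart_map b ` B) u * density_on b u) \<in> borel_measurable borel"
      using sets_map_image[OF that(1) B(1) that(2)] measurable_density_on[OF that(1)] by measurable
    moreover have "(\<lambda>u. indicator (chart_map b ` B) u * density_on b u) = (\<lambda>u. indicator (chart_map b ` B) u * sqrt (det (g b u)))"
      using that(2) map_in[of _ b] by (auto simp: density_on_def indicator_def fun_eq_iff)
    ultimately show ?thesis by simp
  qed
  have "(\<integral>\<^sup>+y. ennreal (indicator ?T y * sqrt (det (g d y))) \<partial>lborel) = (\<integral>\<^sup>+x. ennreal (indicator ?S x * sqrt (det (g c x))) \<partial>lborel)"
  proof (rule nn_integral_change_of_variables[where g = "transition c d" and h = "transition d c"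
        and g' = "\<lambda>u. (*v) (cd.J u)" and h' = "\<lambda>u. (*v) (dc.J u)"])
    show "(transition c d has_derivative (*v) (cd.J x)) (at x within ?S)" if "x \<in> ?S" for x
      using cd.\<tau>_has_derivative S that has_derivative_at_withinI by blast
    show "(transition d c has_derivative (*v) (dc.J x)) (at x within ?T)" if "x \<in> ?T" for x
      using dc.\<tau>_has_derivative T that has_derivative_at_withinI by blast
    show "transition c d x \<in> ?T \<and> transition d c (transition c d x) = x" if "x \<in> ?S" for x
      using that S transition_in(3)[OF c d] transition_map[OF c, of _ d] B by auto
    show "transition d c x \<in> ?S \<and> transition c d (transition d c x) = x" if "x \<in> ?T" for x
      using that T transition_in(3)[OF d c] transition_map[OF d, of _ c] B by auto
    show "(*v) (dc.J y) \<circ> (*v) (cd.J (transition d c y)) = id" if "y \<in> ?T" for y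
    proof -
      let ?x = "transition d c y"
      have y: "y \<in> overlap d c" using that T by auto
      have x: "?x \<in> overlap c d" "transition c d ?x = y" using transition_in[OF d c y] by auto
      have "((\<lambda>u. transition d c (transition c d u)) has_derivative (\<lambda>v. dc.J y *v (cd.J ?x *v v))) (at ?x)"
        by (rule has_derivative_compose[OF cd.\<tau>_has_derivative[OF x(1)]]) (simp add: x(2) dc.\<tau>_has_derivative[OF y])
      moreover have "((\<lambda>u. transition d c (transition c d u)) has_derivative (\<lambda>v. v)) (at ?x)"
        by (rule has_derivative_transform_within_open[OF has_derivative_ident open_overlap[OF c d] x(1)])
          (simp add: transition_in(3)[OF c d])
      ultimately have "(\<lambda>v. dc.J y *v (cd.J ?x *v v)) = (\<lambda>v. v)" by (rule has_derivative_unique)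
      then show ?thesis by (simp add: o_def id_def)
    qed
    \<comment> \<open>By isometry the two Gram matrices differ by \<open>J\<close> on the right and
      its transpose on the left, so the determinants differ by the square of that of
      \<open>J\<close>.\<close>
    show "sqrt (det (g c x)) = \<bar>det (matrix ((*v) (cd.J x)))\<bar> * sqrt (det (g d (transition c d x)))" if "x \<in> ?S" for x
    proof -
      have x: "x \<in> overlap c d" using that S by auto
      have "g c x = transpose (cd.J x) ** g d (transition c d x) ** cd.J x"
        unfolding ip_eq_iff[symmetric] using cd.J_isometry[OF x]
        by (simp only: ip_matrix_left ip_matrix_right matrix_mul_assoc simp_thms)
      then have "det (g c x) = (det (cd.J x))\<^sup>2 * det (g d (transition c d x))"
        by (simp add: det_mul power2_eq_square)
      then show ?thesis by (simp add: real_sqrt_mult)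
    qed
    show "(\<integral>\<^sup>+x. ennreal (indicator ?S x * sqrt (det (g c x))) \<partial>lborel) < \<infinity>"
      using fin emeasure_chart_measure[OF c B(1)] Bc by simp
    show "0 \<le> sqrt (det (g d y))" if "y \<in> ?T" for y
      using that dc.det_G_pos T by (auto intro: less_imp_le)
  qed (use S T B c d meas in auto)
  then show ?thesis
    using emeasure_chart_measure[OF c B(1)] emeasure_chart_measure[OF d B(1)] Bc by simp
qed

lemma chart_measure_compat:
  assumes c: "c \<in> \<A>" and d: "d \<in> \<A>" and B: "B \<in> sets borel" "B \<subseteq> chart_dom c" "B \<subseteq> chart_dom d"
  shows "emeasure (chart_measure d) B = emeasure (chart_measure c) B"
proof -
  \<comment> \<open>Bounding both position and density makes each piece \<open>A k\<close> of finite
    volume, while every point of \<open>B\<close> lies in some piece.\<close>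
  define Z where "Z k = {u \<in> chart_img c. norm u \<le> real k \<and> density_on c u \<le> real k}" for k :: nat
  define A where "A k = {p \<in> B. chart_map c p \<in> Z k}" for k
  have mc: "chart_map c \<in> borel_measurable (restrict_space borel (chart_dom c))"
    by (rule borel_measurable_continuous_on_restrict[OF continuous_on_map[OF c]])
  have Zk: "Z k \<in> sets borel" for k
  proof -
    have "Z k = chart_img c \<inter> (cball 0 (real k) \<inter> {u. density_on c u \<le> real k})" by (auto simp: Z_def)
    then show ?thesis
      using open_img[OF c] measurable_density_on[OF c] by simp
  qed
  have Ak: "A k \<in> sets borel" for k
  proof -
    have "chart_map c -` Z k \<inter> chart_dom c \<in> sets (restrict_space borel (chart_dom c))"
      using measurable_sets[OF mc Zk] by (simp add: space_restrict_space)
    then have "chart_map c -` Z k \<inter> chart_dom c \<in> sets borel"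
      using open_dom[OF c] by (simp add: sets_restrict_space_iff)
    moreover have "A k = B \<inter> (chart_map c -` Z k \<inter> chart_dom c)" using B by (auto simp: A_def)
    ultimately show ?thesis using B by auto
  qed
  have sub: "A k \<subseteq> chart_dom c" "A k \<subseteq> chart_dom d" for k using B by (auto simp: A_def)
  have inc: "incseq A" by (auto simp: incseq_def A_def Z_def)
  have un: "(\<Union>k. A k) = B"
  proof -
    have "\<exists>k. p \<in> A k" if "p \<in> B" for p
    proof -
      obtain k where "max (norm (chart_map c p)) (density_on c (chart_map c p)) \<le> real k" using real_arch_simple by blast
      then show ?thesis using that B map_in[of p c] by (auto simp: A_def Z_def)
    qed
    then show ?thesis by (auto simp: A_def)
  qed
  have fin: "emeasure (chart_measure c) (A k) < \<infinity>" for k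
  proof -
    have "emeasure (chart_measure c) (A k) \<le> (\<integral>\<^sup>+u. ennreal (real k) * indicator (cball 0 (real k)) (u :: real^'n) \<partial>lborel)"
      unfolding emeasure_chart_measure[OF c Ak]
    proof (intro nn_integral_mono)
      fix u :: "real^'n"
      show "ennreal (indicator (chart_map c ` (A k \<inter> chart_dom c)) u * sqrt (det (g c u)))
        \<le> ennreal (real k) * indicator (cball 0 (real k)) u"
        by (auto simp: A_def Z_def density_on_def indicator_def ennreal_leI split: if_splits)
    qed
    also have "\<dots> = ennreal (real k) * emeasure lborel (cball 0 (real k) :: (real^'n) set)"
      by (simp add: nn_integral_cmult_indicator)
    also have "\<dots> < \<infinity>"
      using emeasure_lborel_cball_finite[of "0 :: real^'n" "real k"] by (simp add: ennreal_mult_less_top)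
    finally show ?thesis .
  qed
  have "emeasure (chart_measure d) B = (SUP k. emeasure (chart_measure d) (A k))"
    unfolding un[symmetric] using Ak inc by (subst SUP_emeasure_incseq) auto
  also have "\<dots> = (SUP k. emeasure (chart_measure c) (A k))"
    using chart_measure_compat_finite[OF c d Ak sub fin] by simp
  also have "\<dots> = emeasure (chart_measure c) B"
    unfolding un[symmetric] using Ak inc by (subst SUP_emeasure_incseq) auto
  finally show ?thesis .
qed

end

section \<open>Existence and uniqueness of the volume\<close>

context atlas_metric begin

text \<open>The domains of a finite subcover made disjoint. A Borel measure with prescribed values
  inside charts is both determined by these pieces and assembled from them.\<close>

lemma chart_pieces:
  assumes "compact (UNIV :: 'a set)"
  obtains n :: nat and cs D where "\<And>i. i < n \<Longrightarrow> cs i \<in> \<A>" "\<And>i. i < n \<Longrightarrow> D i \<in> sets borel"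
    "\<And>i. i < n \<Longrightarrow> D i \<subseteq> chart_dom (cs i)" "disjoint_family_on D {..<n}" "(\<Union>i<n. D i) = UNIV"
proof -
  have "UNIV \<subseteq> (\<Union>c\<in>\<A>. chart_dom c)" using chart_at by blast
  then obtain C where C: "C \<subseteq> \<A>" "finite C" "UNIV \<subseteq> (\<Union>c\<in>C. chart_dom c)"
    using compactE_image[OF assms, of \<A> chart_dom] open_dom by blast
  obtain h where h: "bij_betw h {0..<card C} C" using ex_bij_betw_nat_finite[OF C(2)] by blast
  define n where "n = card C"
  define X where "X i = (if i < n then chart_dom (h i) else {})" for i
  have hC: "h i \<in> \<A>" if "i < n" for i using h that C(1) bij_betwE by (fastforce simp: n_def)
  have X: "range X \<subseteq> sets borel" using hC open_dom by (simp add: X_def image_subset_iff)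
  have e: "disjointed X i = {}" if "i \<in> - {..<n}" for i
    using disjointed_subset[of X i] that by (simp add: X_def)
  have "(\<Union>i. disjointed X i) = (\<Union>i<n. disjointed X i) \<union> (\<Union>i\<in>- {..<n}. disjointed X i)"
    by blast
  then have "(\<Union>i<n. disjointed X i) = (\<Union>i. disjointed X i)" by (simp add: e del: SUP_eq_const UN_disjointed_eq)
  also have "\<dots> = (\<Union>i. X i)" by (rule UN_disjointed_eq)
  also have "\<dots> = UNIV"
  proof -
    have "\<exists>i. p \<in> X i" for p
    proof -
      obtain c where "c \<in> C" "p \<in> chart_dom c" using C(3) by blast
      then have "c \<in> h ` {0..<card C}" using h by (simp add: bij_betw_def)
      then obtain i where "i < n" "h i = c" by (auto simp: n_def)
      then show ?thesis using \<open>p \<in> chart_dom c\<close> by (auto simp: X_def)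
    qed
    then show ?thesis by blast
  qed
  finally have "(\<Union>i<n. disjointed X i) = UNIV" .
  moreover have "disjoint_family_on (disjointed X) {..<n}"
    using disjoint_family_disjointed[of X] by (rule disjoint_family_on_mono[rotated]) simp
  moreover have "disjointed X i \<subseteq> chart_dom (h i)" if "i < n" for i
    using disjointed_subset[of X i] that by (simp add: X_def)
  moreover have "disjointed X i \<in> sets borel" for i
    using sets.range_disjointed_sets[OF X] by blast
  ultimately show thesis using that[of n h "disjointed X"] hC by blast
qed

text \<open>The property inside the definite description \<open>riemannian_volume\<close>, named so
  that existence and uniqueness can be stated.\<close>

definition is_volume :: "'a measure \<Rightarrow> bool" where
  "is_volume \<mu> \<longleftrightarrow> sets \<mu> = sets borel \<and> (\<forall>c\<in>\<A>. \<forall>B\<in>sets borel. B \<subseteq> chart_dom c \<longrightarrow>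
        emeasure \<mu> B = (\<integral>\<^sup>+u\<in>chart_map c ` B. ennreal (sqrt (det (g c u))) \<partial>lborel))"

lemma is_volume_iff:
  "is_volume \<mu> \<longleftrightarrow> sets \<mu> = sets borel \<and>
    (\<forall>c\<in>\<A>. \<forall>B\<in>sets borel. B \<subseteq> chart_dom c \<longrightarrow> emeasure \<mu> B = emeasure (chart_measure c) B)"
proof -
  have "emeasure (chart_measure c) B = (\<integral>\<^sup>+u\<in>chart_map c ` B. ennreal (sqrt (det (g c u))) \<partial>lborel)"
    if "c \<in> \<A>" "B \<in> sets borel" "B \<subseteq> chart_dom c" for c B
  proof -
    have "B \<inter> chart_dom c = B" using that by auto
    then show ?thesis
      unfolding emeasure_chart_measure[OF that(1,2)]
      by (intro nn_integral_cong) (auto simp: indicator_def)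
  qed
  then show ?thesis by (auto simp: is_volume_def)
qed

lemma is_volume_unique:
  assumes "compact (UNIV :: 'a set)" "is_volume \<mu>" "is_volume \<mu>'"
  shows "\<mu> = \<mu>'"
proof (rule chart_pieces[OF assms(1)])
  fix n :: nat and cs D assume D: "\<And>i. i < n \<Longrightarrow> cs i \<in> \<A>" "\<And>i. i < n \<Longrightarrow> D i \<in> sets borel"
    "\<And>i. i < n \<Longrightarrow> D i \<subseteq> chart_dom (cs i)" "disjoint_family_on D {..<n}" "(\<Union>i<n. D i) = UNIV"
  have em: "emeasure \<nu> B = (\<Sum>i<n. emeasure (chart_measure (cs i)) (B \<inter> D i))" if \<nu>: "is_volume \<nu>" and B: "B \<in> sets borel" for \<nu> B
  proof -
    have "emeasure \<nu> B = (\<Sum>i<n. emeasure \<nu> (B \<inter> D i))"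
      using \<nu> B D by (intro sum_emeasure_cover) (auto simp: is_volume_iff)
    also have "\<dots> = (\<Sum>i<n. emeasure (chart_measure (cs i)) (B \<inter> D i))"
      using \<nu> B D(1,2,3) by (intro sum.cong refl) (simp add: is_volume_iff le_infI2)
    finally show ?thesis .
  qed
  show ?thesis
  proof (rule measure_eqI)
    show "sets \<mu> = sets \<mu>'" using assms(2,3) by (simp add: is_volume_iff)
    fix B assume "B \<in> sets \<mu>"
    then have "B \<in> sets borel" using assms(2) by (simp add: is_volume_iff)
    then show "emeasure \<mu> B = emeasure \<mu>' B" using em assms(2,3) by simp
  qed
qed

text \<open>Each piece is measured in its own chart. For a set inside another chart
  \<open>c\<close>, its part in each piece lies in both domains, and
  \<open>chart_measure_compat\<close> lets \<open>c\<close> measure it instead.\<close>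

lemma is_volume_exists:
  assumes "compact (UNIV :: 'a set)"
  shows "\<exists>\<mu>. is_volume \<mu>"
proof (rule chart_pieces[OF assms(1)])
  fix n :: nat and cs D assume D: "\<And>i. i < n \<Longrightarrow> cs i \<in> \<A>" "\<And>i. i < n \<Longrightarrow> D i \<in> sets borel"
    "\<And>i. i < n \<Longrightarrow> D i \<subseteq> chart_dom (cs i)" "disjoint_family_on D {..<n}" "(\<Union>i<n. D i) = UNIV"
  define m where "m B = (\<Sum>i<n. emeasure (chart_measure (cs i)) (B \<inter> D i))" for B
  define \<mu> where "\<mu> = measure_of UNIV (sets borel) m"
  have sets: "sets \<mu> = sets borel"
    using sets.sigma_sets_eq[of "borel :: 'a measure"] by (simp add: \<mu>_def)
  have ca: "countably_additive (sets borel) m"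
    unfolding countably_additive_def
  proof (intro allI impI)
    fix A :: "nat \<Rightarrow> 'a set" assume A: "range A \<subseteq> sets borel" "disjoint_family A"
    have "(\<Sum>k. m (A k)) = (\<Sum>i<n. \<Sum>k. emeasure (chart_measure (cs i)) (A k \<inter> D i))"
      unfolding m_def by (rule suminf_sum) (rule summableI)
    also have "\<dots> = (\<Sum>i<n. emeasure (chart_measure (cs i)) (\<Union>k. A k \<inter> D i))"
      using A D(2) by (intro sum.cong refl suminf_emeasure) (auto simp: disjoint_family_on_def)
    also have "\<dots> = m (\<Union>k. A k)" by (simp add: m_def Int_UN_distrib2)
    finally show "(\<Sum>k. m (A k)) = m (\<Union>k. A k)" .
  qed
  have em: "emeasure \<mu> B = m B" if "B \<in> sets borel" for B
    unfolding \<mu>_def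
    by (rule emeasure_measure_of_sigma[OF _ _ ca that])
      (use sets.sigma_algebra_axioms[of "borel :: 'a measure"] in \<open>auto simp: positive_def m_def\<close>)
  have "is_volume \<mu>"
    unfolding is_volume_iff
  proof (intro conjI ballI impI sets)
    fix c B assume c: "c \<in> \<A>" and B: "B \<in> sets borel" "B \<subseteq> chart_dom c"
    have "emeasure \<mu> B = (\<Sum>i<n. emeasure (chart_measure c) (B \<inter> D i))"
      unfolding em[OF B(1)] m_def
      using B D by (intro sum.cong refl chart_measure_compat[OF c]) (auto dest: subsetD[OF D(3)])
    also have "\<dots> = emeasure (chart_measure c) B"
      using B D by (intro sum_emeasure_cover[symmetric]) auto
    finally show "emeasure \<mu> B = emeasure (chart_measure c) B" .
  qed
  then show ?thesis by blast
qed

lemma is_volume_riemannian_volume: "compact (UNIV :: 'a set) \<Longrightarrow> is_volume (riemannian_volume \<A> g)"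
proof -
  assume cp: "compact (UNIV :: 'a set)"
  have "\<exists>!\<mu>. is_volume \<mu>"
    by (rule ex_ex1I[OF is_volume_exists[OF cp] is_volume_unique[OF cp]])
  from theI'[OF this] show ?thesis
    unfolding is_volume_def[abs_def] riemannian_volume_def .
qed

text \<open>The bridge from the volume to coordinates: cut down to the domain of \<open>c\<close>,
  the volume is \<open>chart_measure c\<close>, and \<open>f\<close> does not notice the cut because
  it vanishes elsewhere.\<close>

lemma has_bochner_integral_volume:
  fixes f :: "'a \<Rightarrow> real"
  assumes cp: "compact (UNIV :: 'a set)" and c: "c \<in> \<A>" and f: "f \<in> borel_measurable borel"
    and f0: "\<And>p. p \<notin> chart_dom c \<Longrightarrow> f p = 0"
    and I: "has_bochner_integral lborel (\<lambda>u. density_on c u * f (chart_inv c u)) x"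
  shows "has_bochner_integral (riemannian_volume \<A> g) f x"
proof -
  let ?\<mu> = "riemannian_volume \<A> g"
  note \<mu> = is_volume_riemannian_volume[OF cp, unfolded is_volume_iff]
  have dc: "chart_dom c \<in> sets borel" using open_dom[OF c] by simp
  have \<mu>b: "sets ?\<mu> = sets borel" using \<mu> by simp
  have md: "(\<lambda>p. ennreal (indicator (chart_dom c) p)) \<in> borel_measurable ?\<mu>"
    unfolding measurable_cong_sets[OF \<mu>b refl] using dc by simp
  have "density ?\<mu> (\<lambda>p. ennreal (indicator (chart_dom c) p)) = chart_measure c"
  proof (rule measure_eqI)
    fix B assume "B \<in> sets (density ?\<mu> (\<lambda>p. ennreal (indicator (chart_dom c) p)))"
    then have B: "B \<in> sets borel" using \<mu> by simp
    have "emeasure (density ?\<mu> (\<lambda>p. ennreal (indicator (chart_dom c) p))) B = (\<integral>\<^sup>+p. indicator (B \<inter> chart_dom c) p \<partial>?\<mu>)"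
      unfolding emeasure_density[OF md B[folded \<mu>b]]
      by (intro nn_integral_cong) (auto simp: indicator_def)
    also have "\<dots> = emeasure (chart_measure c) (B \<inter> chart_dom c)"
      using B \<mu> dc c by simp
    finally show "emeasure (density ?\<mu> (\<lambda>p. ennreal (indicator (chart_dom c) p))) B = emeasure (chart_measure c) B"
      using emeasure_chart_measure_Int_dom[OF c B] by simp
  qed (use \<mu> in simp)
  moreover have "has_bochner_integral (chart_measure c) f x"
    unfolding chart_measure_def
  proof (rule has_bochner_integral_distr[OF f])
    show "total_inv c \<in> density lborel (density_on c) \<rightarrow>\<^sub>M borel" using measurable_total_inv[OF c] by simp
    show "has_bochner_integral (density lborel (density_on c)) (\<lambda>u. f (total_inv c u)) x"
    proof (rule has_bochner_integral_density)
      show "(\<lambda>u. f (total_inv c u)) \<in> borel_measurable lborel"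
        using measurable_compose[OF measurable_total_inv[OF c] f] by simp
      show "density_on c \<in> borel_measurable lborel" using measurable_density_on[OF c] by simp
      have "(\<lambda>u. density_on c u * f (chart_inv c u)) = (\<lambda>u. density_on c u *\<^sub>R f (total_inv c u))"
        by (auto simp: density_on_def total_inv_def indicator_def fun_eq_iff)
      then show "has_bochner_integral lborel (\<lambda>u. density_on c u *\<^sub>R f (total_inv c u)) x" using I by simp
    qed (use density_on_nonneg[OF c] in simp)
  qed
  moreover have "f = (\<lambda>p. indicator (chart_dom c) p *\<^sub>R f p)"
    using f0 by (auto simp: indicator_def fun_eq_iff)
  moreover have m: "f \<in> borel_measurable ?\<mu>" "(\<lambda>p. indicator (chart_dom c) p :: real) \<in> borel_measurable ?\<mu>"
    unfolding measurable_cong_sets[OF \<mu>b refl] using f dc by simp_all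
  ultimately show ?thesis
    using integrable_density[OF m] integral_density[OF m] unfolding has_bochner_integral_iff by auto
qed

end

section \<open>Partitions of unity\<close>

text \<open>The outer derivative is applied to a vector that itself varies with the point; expanding
  in partial derivatives splits this into sums of products of continuous functions.\<close>

lemma Ck_on_1_compose:
  fixes b :: "real^'n::finite \<Rightarrow> real" and \<tau> :: "real^'n \<Rightarrow> real^'n"
  assumes S: "open S" and b: "Ck_on 1 T b" and \<tau>: "smooth_on S \<tau>" "\<And>u. u \<in> S \<Longrightarrow> \<tau> u \<in> T"
  shows "Ck_on 1 S (\<lambda>u. b (\<tau> u))"
proof -
  have db: "(b has_derivative frechet_derivative b (at y)) (at y)" if "y \<in> T" for y
    using b that by (simp add: frechet_derivative_works[symmetric])
  have d: "((\<lambda>u. b (\<tau> u)) has_derivative (\<lambda>v. frechet_derivative b (at (\<tau> u)) (frechet_derivative \<tau> (at u) v))) (at u)"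
    if "u \<in> S" for u
    by (rule has_derivative_compose[OF smooth_on_has_derivative[OF \<tau>(1) that] db[OF \<tau>(2)[OF that]]])
  have "continuous_on S (\<lambda>u. \<Sum>i\<in>UNIV. frechet_derivative \<tau> (at u) v $ i * pd i b (\<tau> u))" for v
  proof (intro continuous_intros)
    show "continuous_on S (\<lambda>u. frechet_derivative \<tau> (at u) v)"
      by (rule smooth_on_continuous_on[OF smooth_on_frechet_derivative[OF \<tau>(1)]])
    have "continuous_on T (pd i b)" for i using b by (simp add: pd_def[abs_def])
    then show "continuous_on S (\<lambda>u. pd i b (\<tau> u))" for i
      by (rule continuous_on_compose2[OF _ smooth_on_continuous_on[OF \<tau>(1)]]) (use \<tau>(2) in auto)
  qed
  moreover have "frechet_derivative b (at (\<tau> u)) (frechet_derivative \<tau> (at u) v)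
      = (\<Sum>i\<in>UNIV. frechet_derivative \<tau> (at u) v $ i * pd i b (\<tau> u))" if "u \<in> S" for u v
    using frechet_derivative_sum_pd[of b "\<tau> u"] db[OF \<tau>(2)[OF that]] by (auto simp: differentiable_def)
  ultimately have "continuous_on S (\<lambda>u. frechet_derivative b (at (\<tau> u)) (frechet_derivative \<tau> (at u) v))" for v
    by (simp cong: continuous_on_cong)
  then show ?thesis
    using Ck_on_Suc_has_derivativeI[OF S d, of 0] by simp
qed

lemma Ck_on_1_divide:
  fixes f h :: "'b::real_normed_vector \<Rightarrow> real"
  assumes S: "open S" and f: "Ck_on 1 S f" and h: "Ck_on 1 S h" and nz: "\<And>u. u \<in> S \<Longrightarrow> h u \<noteq> 0"
  shows "Ck_on 1 S (\<lambda>u. f u / h u)"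
proof -
  have dh: "(h has_derivative frechet_derivative h (at u)) (at u)" if "u \<in> S" for u
    using h that by (simp add: frechet_derivative_works[symmetric])
  have ch: "continuous_on S h" "\<And>v. continuous_on S (\<lambda>u. frechet_derivative h (at u) v)"
    using h Ck_on_SucD[of 0 S h] by simp_all
  have d: "((\<lambda>u. inverse (h u)) has_derivative (\<lambda>v. - (inverse (h u) * frechet_derivative h (at u) v * inverse (h u)))) (at u)"
    if "u \<in> S" for u
    by (rule Deriv.has_derivative_inverse[OF nz[OF that] dh[OF that]])
  have "continuous_on S (\<lambda>u. - (inverse (h u) * frechet_derivative h (at u) v * inverse (h u)))" for v
    using ch nz by (intro continuous_intros) auto
  then have "Ck_on 1 S (\<lambda>u. inverse (h u))"
    using Ck_on_Suc_has_derivativeI[OF S d, of 0] by simp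
  then show ?thesis
    using Ck_on_bilinear[OF S bounded_bilinear_mult f] by (simp add: divide_inverse)
qed

text \<open>Squaring smooths the kink of the positive part to class C1, which gives an elementary
  cut-off function.\<close>

lemma has_real_derivative_max_power2: "((\<lambda>t. (max 0 t)\<^sup>2) has_real_derivative 2 * max 0 t) (at (t::real))"
proof -
  consider "t > 0" | "t < 0" | "t = 0" by linarith
  then show ?thesis
  proof cases
    case 1
    have "((\<lambda>t. t\<^sup>2) has_real_derivative 2 * max 0 t) (at t)"
      using 1 by (auto intro!: derivative_eq_intros)
    then show ?thesis
      by (rule has_field_derivative_transform_within_open[of _ _ _ "{0<..}"]) (use 1 in auto)
  next
    case 2
    have "((\<lambda>t. 0) has_real_derivative 2 * max 0 t) (at t)"
      using 2 by (auto intro!: derivative_eq_intros)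
    then show ?thesis
      by (rule has_field_derivative_transform_within_open[of _ _ _ "{..<0}"]) (use 2 in auto)
  next
    case 3
    have "((\<lambda>h. ((max 0 h)\<^sup>2) / h) \<longlongrightarrow> 0) (at (0::real))"
    proof (rule Lim_null_comparison)
      show "\<forall>\<^sub>F h in at (0::real). norm ((max 0 h)\<^sup>2 / h) \<le> \<bar>h\<bar>"
        by (rule always_eventually) (auto simp: power2_eq_square max_def)
      show "((\<lambda>h. \<bar>h\<bar>) \<longlongrightarrow> 0) (at (0::real))"
        using tendsto_rabs[OF tendsto_ident_at, of "0::real" UNIV] by simp
    qed
    then show ?thesis using 3 by (simp add: DERIV_def)
  qed
qed

lemma Ck_on_1_bump:
  fixes u0 :: "'b::real_inner"
  shows "Ck_on 1 UNIV (\<lambda>u. (max 0 (r\<^sup>2 - (u - u0) \<bullet> (u - u0)))\<^sup>2)"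
proof -
  have "((\<lambda>u. r\<^sup>2 - (u - u0) \<bullet> (u - u0)) has_derivative (\<lambda>v. - (2 * ((u - u0) \<bullet> v)))) (at u)" for u
    by (auto intro!: derivative_eq_intros simp: inner_commute)
  then have d: "((\<lambda>u. (max 0 (r\<^sup>2 - (u - u0) \<bullet> (u - u0)))\<^sup>2) has_derivative
     (\<lambda>v. 2 * max 0 (r\<^sup>2 - (u - u0) \<bullet> (u - u0)) * (- (2 * ((u - u0) \<bullet> v))))) (at u)" for u
    using has_derivative_compose[of "\<lambda>u. r\<^sup>2 - (u - u0) \<bullet> (u - u0)" _ u UNIV "\<lambda>t. (max 0 t)\<^sup>2"]
      has_real_derivative_max_power2 unfolding has_field_derivative_def by blast
  have "continuous_on UNIV (\<lambda>u. 2 * max 0 (r\<^sup>2 - (u - u0) \<bullet> (u - u0)) * (- (2 * ((u - u0) \<bullet> v))))" for v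
    by (intro continuous_intros)
  then show ?thesis
    using Ck_on_Suc_has_derivativeI[OF open_UNIV d, of 0] by simp
qed

context atlas_metric begin

definition C1_function :: "('a \<Rightarrow> real) \<Rightarrow> bool" where
  "C1_function h \<longleftrightarrow> (\<forall>c\<in>\<A>. Ck_on 1 (chart_img c) (\<lambda>u. h (chart_inv c u)))"

text \<open>In any other chart the bump is a composition with the transition map on the overlap, and
  zero off the image \<open>KM\<close> of the closed ball. These two open sets cover that chart
  because \<open>KM\<close> lies in the domain of \<open>c\<close>.\<close>

lemma exists_bump:
  assumes c: "c \<in> \<A>" and p: "p \<in> chart_dom c"
  shows "\<exists>b K. C1_function b \<and> (\<forall>q. 0 \<le> b q) \<and> b p > 0 \<and> open {q. b q > 0} \<and> compact K \<and> K \<subseteq> chart_img c \<and>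
    (\<forall>u\<in>chart_img c - K. b (chart_inv c u) = 0) \<and> (\<forall>q. q \<notin> chart_dom c \<longrightarrow> b q = 0)"
proof -
  let ?u0 = "chart_map c p"
  obtain r where r: "r > 0" "cball ?u0 r \<subseteq> chart_img c"
    using open_contains_cball open_img[OF c] map_in[OF p] by blast
  let ?K = "cball ?u0 r"
  define b0 where "b0 u = (max 0 (r\<^sup>2 - (u - ?u0) \<bullet> (u - ?u0)))\<^sup>2" for u
  define b where "b q = (if q \<in> chart_dom c then b0 (chart_map c q) else 0)" for q
  have b0_pos: "b0 u > 0 \<longleftrightarrow> u \<in> ball ?u0 r" for u
    using r(1) by (auto simp: b0_def dist_norm norm_minus_commute dot_square_norm max_def abs_square_less_1
        power_strict_mono dest: power2_less_imp_less intro!: power_strict_mono)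
  have b0_nonneg: "b0 u \<ge> 0" for u by (simp add: b0_def)
  have b0_K: "b0 u = 0" if "u \<notin> ?K" for u
    using b0_pos[of u] b0_nonneg[of u] that by (auto simp: less_eq_real_def)
  \<comment> \<open>Compact, hence closed because the manifold is Hausdorff.\<close>
  define KM where "KM = chart_inv c ` ?K"
  have KM: "closed KM" "KM \<subseteq> chart_dom c"
    using compact_continuous_image[OF continuous_on_subset[OF continuous_on_inv[OF c] r(2)] compact_cball] inv_in[OF c] r(2)
    by (auto simp: KM_def compact_imp_closed)
  have b_KM: "b q = 0" if "q \<notin> KM" for q
  proof (cases "q \<in> chart_dom c")
    case True
    then have "chart_map c q \<notin> ?K" using that inv_map[OF c True] by (force simp: KM_def)
    then show ?thesis using b0_K by (simp add: b_def)
  qed (simp add: b_def)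
  have "C1_function b"
    unfolding C1_function_def
  proof
    fix d assume d: "d \<in> \<A>"
    interpret dc: chart_change "overlap d c" "g d" "chart_img c" "g c" "transition d c" by (rule chart_change[OF d c])
    let ?Z = "{u \<in> chart_img d. chart_inv d u \<in> - KM}"
    have oZ: "open ?Z" using KM(1) by (intro open_inv_vimage[OF d]) (auto simp: open_Compl)
    have "Ck_on 1 (overlap d c) (\<lambda>u. b0 (transition d c u))"
      unfolding b0_def by (rule Ck_on_1_compose[OF open_overlap[OF d c] Ck_on_1_bump dc.smooth_\<tau>]) simp
    then have "Ck_on 1 (overlap d c) (\<lambda>u. b (chart_inv d u))"
      by (rule Ck_on_cong_imp[OF open_overlap[OF d c], rotated]) (use overlap_iff[OF d, of _ c] in \<open>auto simp: b_def transition_def\<close>)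
    moreover have "Ck_on 1 ?Z (\<lambda>u. b (chart_inv d u))"
      by (rule Ck_on_cong_imp[OF oZ _ Ck_on_const[of 1 _ 0]]) (simp add: b_KM)
    ultimately have "Ck_on 1 (overlap d c \<union> ?Z) (\<lambda>u. b (chart_inv d u))"
      by (rule Ck_on_open_Un[OF open_overlap[OF d c] oZ])
    moreover have "overlap d c \<union> ?Z = chart_img d"
      using KM(2) overlap_iff[OF d, of _ c] by auto
    ultimately show "Ck_on 1 (chart_img d) (\<lambda>u. b (chart_inv d u))" by simp
  qed
  moreover have "open {q. b q > 0}"
  proof -
    have "{q. b q > 0} = {q \<in> chart_dom c. chart_map c q \<in> ball ?u0 r}" using b0_pos by (auto simp: b_def)
    then show ?thesis using open_map_vimage[OF c open_ball] by simp
  qed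
  moreover have "b p > 0" using p r(1) b0_pos by (simp add: b_def)
  moreover have "\<forall>u\<in>chart_img c - ?K. b (chart_inv c u) = 0"
    using map_inv[OF c] inv_in[OF c] b0_K by (simp add: b_def)
  moreover have "\<forall>q. q \<notin> chart_dom c \<longrightarrow> b q = 0" by (simp add: b_def)
  moreover have "\<forall>q. 0 \<le> b q" using b0_nonneg by (simp add: b_def)
  ultimately show ?thesis
    by (intro exI[of _ b] exI[of _ ?K] conjI) (assumption | rule r(2) compact_cball)+
qed

text \<open>Finitely many bumps whose positivity sets cover the compact manifold are divided by
  their sum; each is indexed by the point at which it was centred, which also names its
  chart.\<close>

lemma partition_of_unity:
  assumes cp: "compact (UNIV :: 'a set)"
  obtains I :: "'a set" and f K where "finite I" "\<And>p. p \<in> I \<Longrightarrow> C1_function (f p)"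
    "\<And>p. compact (K p)" "\<And>p. K p \<subseteq> chart_img (chart_at \<A> p)"
    "\<And>p u. u \<in> chart_img (chart_at \<A> p) \<Longrightarrow> u \<notin> K p \<Longrightarrow> f p (chart_inv (chart_at \<A> p) u) = 0"
    "\<And>p q. q \<notin> chart_dom (chart_at \<A> p) \<Longrightarrow> f p q = 0" "\<And>q. (\<Sum>p\<in>I. f p q) = 1"
proof -
  define P where "P p b K \<longleftrightarrow> C1_function b \<and> (\<forall>q. 0 \<le> b q) \<and> b p > 0 \<and> open {q. b q > 0} \<and> compact K \<and> K \<subseteq> chart_img (chart_at \<A> p) \<and>
    (\<forall>u\<in>chart_img (chart_at \<A> p) - K. b (chart_inv (chart_at \<A> p) u) = 0) \<and> (\<forall>q. q \<notin> chart_dom (chart_at \<A> p) \<longrightarrow> b q = 0)"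
    for p b K
  have "\<exists>x. P p (fst x) (snd x)" for p
    using exists_bump[OF chart_at, of p] unfolding P_def[symmetric] by auto
  then obtain x where x: "P p (fst (x p)) (snd (x p))" for p by metis
  define b K where "b p = fst (x p)" and "K p = snd (x p)" for p
  have b: "C1_function (b p)" "0 \<le> b p q" "b p p > 0" "open {q. b p q > 0}"
    and K: "compact (K p)" "K p \<subseteq> chart_img (chart_at \<A> p)"
      "u \<in> chart_img (chart_at \<A> p) \<Longrightarrow> u \<notin> K p \<Longrightarrow> b p (chart_inv (chart_at \<A> p) u) = 0"
    and b0: "q \<notin> chart_dom (chart_at \<A> p) \<Longrightarrow> b p q = 0" for p q u
    using x[of p, unfolded P_def, folded b_def K_def] by simp_all
  obtain I where I: "finite I" "UNIV \<subseteq> (\<Union>p\<in>I. {q. b p q > 0})"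
  proof (rule compactE_image[OF cp, of UNIV "\<lambda>p. {q. b p q > 0}"])
    show "UNIV \<subseteq> (\<Union>p. {q. b p q > 0})" using b(3) by auto
  qed (use b(4) that in auto)
  define s where "s q = (\<Sum>p\<in>I. b p q)" for q
  have s: "s q > 0" for q
  proof -
    obtain p where "p \<in> I" "b p q > 0" using I(2) by blast
    then show ?thesis unfolding s_def using I(1) b(2) by (intro sum_pos2) auto
  qed
  have Cs: "Ck_on 1 (chart_img c) (\<lambda>u. s (chart_inv c u))" if "c \<in> \<A>" for c
  proof -
    have "Ck_on 1 (chart_img c) (\<lambda>u. \<Sum>p\<in>J. b p (chart_inv c u))" if "finite J" for J
      using that
    proof induction
      case empty
      show ?case using Ck_on_const[of 1 _ "0::real"] by simp
    next
      case (insert p J)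
      then show ?case
        using Ck_on_add[OF open_img[OF \<open>c \<in> \<A>\<close>], of 1 "\<lambda>u. b p (chart_inv c u)"] b(1)[of p] \<open>c \<in> \<A>\<close>
        by (simp del: Ck_on.simps One_nat_def add: C1_function_def)
    qed
    from this[OF I(1)] show ?thesis by (simp add: s_def)
  qed
  have "C1_function (\<lambda>q. b p q / s q)" for p
    unfolding C1_function_def
  proof
    fix c assume c: "c \<in> \<A>"
    show "Ck_on 1 (chart_img c) (\<lambda>u. b p (chart_inv c u) / s (chart_inv c u))"
      by (rule Ck_on_1_divide[OF open_img[OF c] _ Cs[OF c]]) (use b(1)[of p] c s in \<open>auto simp: C1_function_def less_imp_neq[symmetric] simp del: Ck_on.simps One_nat_def\<close>)
  qed
  moreover have "(\<Sum>p\<in>I. b p q / s q) = 1" for q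
    using s[of q] by (simp add: sum_divide_distrib[symmetric] s_def[symmetric])
  ultimately show thesis
    using that[of I "\<lambda>p q. b p q / s q" K] I(1) K b0 by simp
qed

end

section \<open>Almost Ricci-Bourguignon solitons\<close>

locale rb_soliton = atlas_metric \<A> g
  for \<A> :: "('a::{t2_space, second_countable_topology}, 'n::finite) chart set" and g :: "('a, 'n) metric" +
  fixes \<xi> :: "('a, 'n) vfield" and lam :: "'a \<Rightarrow> real" and \<rho> :: real
  assumes rb: "almost_RB_soliton \<A> g \<xi> lam \<rho>"
begin

abbreviation "S \<equiv> scalar_curvature \<A> g"

definition F :: "('a, 'n) chart \<Rightarrow> real^'n \<Rightarrow> real" where
  "F c u = lam (chart_inv c u) + \<rho> * S (chart_inv c u)"

text \<open>The vector field \<open>\<phi>\<xi>\<close>.\<close>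

definition W :: "('a, 'n) vfield" where
  "W c u = chart_metric.Phi (g c) (\<xi> c) u *v \<xi> c u"

lemma smooth_\<xi>: "c \<in> \<A> \<Longrightarrow> smooth_on (chart_img c) (\<xi> c)"
  using rb unfolding almost_RB_soliton_def smooth_vector_field_def by blast

lemma chart_soliton: "c \<in> \<A> \<Longrightarrow> chart_soliton (chart_img c) (g c) (\<xi> c) (F c)"
proof -
  assume c: "c \<in> \<A>"
  have "ricci (g c) u v w + 1/2 * lie_derivative (\<xi> c) (g c) (\<lambda>_. v) (\<lambda>_. w) u = F c u * ip (g c u) v w"
    if u: "u \<in> chart_img c" for u v w
  proof -
    have "\<forall>p\<in>chart_dom c. \<forall>v w. ricci (g c) (chart_map c p) v w
        + 1/2 * lie_derivative (\<xi> c) (g c) (\<lambda>_. v) (\<lambda>_. w) (chart_map c p)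
        = (lam p + \<rho> * S p) * ip (g c (chart_map c p)) v w"
      using rb c unfolding almost_RB_soliton_def by blast
    from bspec[OF this inv_in[OF c u]] show ?thesis by (simp add: map_inv[OF c u] F_def)
  qed
  then show ?thesis
    using chart_metric[OF c] smooth_\<xi>[OF c] by (simp add: chart_soliton_def chart_soliton_axioms_def)
qed

lemma \<xi>_transform:
  assumes "c \<in> \<A>" "d \<in> \<A>" "u \<in> overlap c d"
  shows "\<xi> d (transition c d u) = chart_change.J (transition c d) u *v \<xi> c u"
  unfolding chart_change.J_vector[OF chart_change[OF assms(1,2)] assms(3)]
  using rb assms unfolding almost_RB_soliton_def smooth_vector_field_def by blast

lemma differentiable_img: "c \<in> \<A> \<Longrightarrow> smooth_on (chart_img c) V \<Longrightarrow> u \<in> overlap c d \<Longrightarrow> V differentiable (at u)"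
  using smooth_on_differentiable overlap_subset by blast

lemma divergence_transform:
  assumes c: "c \<in> \<A>" and d: "d \<in> \<A>" and u: "u \<in> overlap c d"
    and V: "\<And>c. c \<in> \<A> \<Longrightarrow> smooth_on (chart_img c) (V c)"
    and tr: "\<And>y. y \<in> overlap c d \<Longrightarrow> V d (transition c d y) = chart_change.J (transition c d) y *v V c y"
  shows "chart_metric.divergence (g d) (V d) (transition c d u) = chart_metric.divergence (g c) (V c) u"
  using smooth_on_differentiable[OF V[OF d] transition_in(4)[OF c d u]] differentiable_img[OF c V[OF c] u]
  by (intro chart_change.divergence_transform[OF chart_change[OF c d] u] tr)

lemma S_chart:
  assumes c: "c \<in> \<A>" and u: "u \<in> chart_img c"
  shows "S (chart_inv c u) = scalar_local (g c) u"
proof -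
  let ?p = "chart_inv c u"
  let ?d = "chart_at \<A> ?p"
  note d = chart_at[of ?p]
  have uo: "u \<in> overlap c ?d" using overlap_iff[OF c] u d by blast
  let ?v = "transition c ?d u"
  have v: "chart_map ?d ?p = ?v" by (simp add: transition_def)
  have "S ?p = scalar_local (g ?d) ?v"
    by (simp add: scalar_curvature_def Let_def v)
  also have "\<dots> = real CARD('n) * F ?d ?v - chart_metric.divergence (g ?d) (\<xi> ?d) ?v"
    by (rule chart_soliton.scalar_eq[OF chart_soliton[OF d(1)] transition_in(4)[OF c d(1) uo]])
  also have "chart_metric.divergence (g ?d) (\<xi> ?d) ?v = chart_metric.divergence (g c) (\<xi> c) u"
    by (rule divergence_transform[OF c d(1) uo smooth_\<xi> \<xi>_transform[OF c d(1)]])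
  also have "F ?d ?v = F c u"
    by (simp add: F_def transition_in(2)[OF c d(1) uo])
  also have "real CARD('n) * F c u - chart_metric.divergence (g c) (\<xi> c) u = scalar_local (g c) u"
    by (rule chart_soliton.scalar_eq[OF chart_soliton[OF c] u, symmetric])
  finally show ?thesis .
qed

lemma smooth_scalar_local: "c \<in> \<A> \<Longrightarrow> smooth_on (chart_img c) (scalar_local (g c))"
proof -
  assume c: "c \<in> \<A>"
  interpret chart_metric "chart_img c" "g c" by (rule chart_metric[OF c])
  have "smooth_on (chart_img c) (\<lambda>u. trace (Q u))"
    by (rule smooth_on_bounded_linear[OF open_U bounded_linear_trace smooth_Q])
  then show ?thesis
    using smooth_on_cong[OF open_U, of "scalar_local (g c)" "\<lambda>u. trace (Q u)"] scalar_local_Q by simp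
qed

lemma smooth_F: "c \<in> \<A> \<Longrightarrow> smooth_on (chart_img c) (F c)"
proof -
  assume c: "c \<in> \<A>"
  have "smooth_on (chart_img c) (\<lambda>u. lam (chart_inv c u) + \<rho> * scalar_local (g c) u)"
    using rb c unfolding almost_RB_soliton_def smooth_function_def
    by (intro smooth_on_add smooth_on_mult smooth_on_const smooth_scalar_local open_img c) auto
  then show ?thesis
    using smooth_on_cong[OF open_img[OF c], of "F c" "\<lambda>u. lam (chart_inv c u) + \<rho> * scalar_local (g c) u"] S_chart[OF c]
    by (simp add: F_def)
qed

lemma smooth_W: "c \<in> \<A> \<Longrightarrow> smooth_on (chart_img c) (W c)"
  unfolding W_def[abs_def]
  by (intro smooth_on_matrix_vector_mult open_img chart_metric.smooth_Phi[OF chart_metric] smooth_\<xi>)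

lemma W_transform:
  assumes c: "c \<in> \<A>" and d: "d \<in> \<A>" and u: "u \<in> overlap c d"
  shows "W d (transition c d u) = chart_change.J (transition c d) u *v W c u"
  unfolding W_def \<xi>_transform[OF assms]
  using smooth_on_differentiable[OF smooth_\<xi>[OF d] transition_in(4)[OF c d u]] differentiable_img[OF c smooth_\<xi>[OF c] u]
  by (intro chart_change.Phi_transform[OF chart_change[OF c d] u] \<xi>_transform[OF c d])

definition integrand :: "'a \<Rightarrow> real" where
  "integrand p = ricci_field \<A> g \<xi> \<xi> p - phi_norm_sq \<A> g \<xi> p
     + deriv_along \<A> \<xi> (\<lambda>q. (real CARD('n) - 1) * (lam q + \<rho> * S q) - 1/2 * S q) p"

lemma integrand_chart:
  assumes c: "c \<in> \<A>" and p: "p \<in> chart_dom c"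
  shows "integrand p = chart_metric.divergence (g c) (W c) (chart_map c p)"
proof -
  let ?d = "chart_at \<A> p" and ?n = "real CARD('n) - 1"
  note d = chart_at[of p]
  let ?v = "chart_map ?d p" and ?u = "chart_map c p"
  have v: "?v \<in> chart_img ?d" by (rule map_in[OF d(2)])
  \<comment> \<open>\<open>integrand\<close> differentiates the global S,
    \<open>divergence_Phi\<close> the local scalar curvature; they agree on the whole open image,
    hence have equal derivatives.\<close>
  have "frechet_derivative (\<lambda>y. ?n * F ?d y - 1/2 * scalar_local (g ?d) y) (at ?v)
      = frechet_derivative (\<lambda>y. ?n * (lam (chart_inv ?d y) + \<rho> * S (chart_inv ?d y)) - 1/2 * S (chart_inv ?d y)) (at ?v)"
  proof (rule frechet_derivative_transform_within_open[OF _ open_img[OF d(1)] v])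
    have "smooth_on (chart_img ?d) (\<lambda>y. ?n * F ?d y - 1/2 * scalar_local (g ?d) y)"
      by (intro smooth_on_diff smooth_on_mult smooth_on_const smooth_F smooth_scalar_local open_img d(1))
    then show "(\<lambda>y. ?n * F ?d y - 1/2 * scalar_local (g ?d) y) differentiable (at ?v)"
      using v by (rule smooth_on_differentiable)
  qed (simp add: F_def S_chart[OF d(1)])
  then have "integrand p = ricci (g ?d) ?v (\<xi> ?d ?v) (\<xi> ?d ?v) - operator_norm_sq (g ?d ?v) (phi (g ?d) (\<xi> ?d) ?v)
      + frechet_derivative (\<lambda>y. ?n * F ?d y - 1/2 * scalar_local (g ?d) y) (at ?v) (\<xi> ?d ?v)"
    by (simp add: integrand_def ricci_field_def phi_norm_sq_def deriv_along_def Let_def)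
  also have "\<dots> = chart_metric.divergence (g ?d) (\<lambda>u. chart_metric.Phi (g ?d) (\<xi> ?d) u *v \<xi> ?d u) ?v"
    by (rule chart_soliton.divergence_Phi[OF chart_soliton[OF d(1)] v smooth_F[OF d(1)], symmetric])
  also have "\<dots> = chart_metric.divergence (g ?d) (W ?d) (transition c ?d ?u)"
    by (simp add: W_def[abs_def] transition_map[OF c p])
  also have "\<dots> = chart_metric.divergence (g c) (W c) ?u"
    by (rule divergence_transform[OF c d(1) map_overlap[OF p d(2)] smooth_W W_transform[OF c d(1)]])
  finally show ?thesis .
qed

lemma deriv_along_chart:
  assumes h: "C1_function h" and c: "c \<in> \<A>" and p: "p \<in> chart_dom c"
  shows "deriv_along \<A> W h p = frechet_derivative (\<lambda>y. h (chart_inv c y)) (at (chart_map c p)) (W c (chart_map c p))"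
proof -
  let ?d = "chart_at \<A> p"
  note d = chart_at[of p]
  let ?v = "chart_map ?d p" and ?u = "chart_map c p"
  interpret cd: chart_change "overlap c ?d" "g c" "chart_img ?d" "g ?d" "transition c ?d" by (rule chart_change[OF c d(1)])
  have u: "?u \<in> overlap c ?d" by (rule map_overlap[OF p d(2)])
  have v: "transition c ?d ?u = ?v" by (rule transition_map[OF c p])
  have "((\<lambda>y. h (chart_inv ?d y)) has_derivative frechet_derivative (\<lambda>y. h (chart_inv ?d y)) (at ?v)) (at ?v)"
    using h d(1) map_in[OF d(2)] by (auto simp: C1_function_def frechet_derivative_works[symmetric])
  then have "((\<lambda>y. h (chart_inv ?d (transition c ?d y))) has_derivative
      (\<lambda>w. frechet_derivative (\<lambda>y. h (chart_inv ?d y)) (at ?v) (cd.J ?u *v w))) (at ?u)"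
    by (intro has_derivative_compose[OF cd.\<tau>_has_derivative[OF u]]) (simp add: v)
  then have "((\<lambda>y. h (chart_inv c y)) has_derivative
      (\<lambda>w. frechet_derivative (\<lambda>y. h (chart_inv ?d y)) (at ?v) (cd.J ?u *v w))) (at ?u)"
    by (rule has_derivative_transform_within_open[OF _ open_overlap[OF c d(1)] u]) (simp add: transition_in(2)[OF c d(1)])
  from fun_cong[OF frechet_derivative_at[OF this], of "W c ?u"] show ?thesis
    by (simp add: deriv_along_def Let_def W_transform[OF c d(1) u, symmetric] v)
qed

text \<open>The function is the divergence of hW, whose support is compact inside one chart, so the
  Euclidean divergence theorem applies there.\<close>

lemma has_bochner_integral_localized:
  assumes cp: "compact (UNIV :: 'a set)" and c: "c \<in> \<A>" and h: "C1_function h"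
    and K: "compact K" "K \<subseteq> chart_img c"
    and hK: "\<And>u. u \<in> chart_img c \<Longrightarrow> u \<notin> K \<Longrightarrow> h (chart_inv c u) = 0"
    and h0: "\<And>q. q \<notin> chart_dom c \<Longrightarrow> h q = 0"
  shows "has_bochner_integral (riemannian_volume \<A> g) (\<lambda>q. h q * integrand q + deriv_along \<A> W h q) 0"
proof (rule has_bochner_integral_volume[OF cp c])
  interpret chart_metric "chart_img c" "g c" by (rule chart_metric[OF c])
  let ?h = "\<lambda>u. h (chart_inv c u)"
  let ?k = "\<lambda>u. ?h u * divergence (W c) u + frechet_derivative ?h (at u) (W c u)"
  have Ch: "Ck_on 1 (chart_img c) ?h" using h c by (simp add: C1_function_def del: Ck_on.simps One_nat_def)
  have eq: "h q * integrand q + deriv_along \<A> W h q = ?k (chart_map c q)" if "q \<in> chart_dom c" for q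
    using integrand_chart[OF c that] deriv_along_chart[OF h c that] inv_map[OF c that] by simp
  \<comment> \<open>Here \<open>deriv_along\<close> is computed in another chart, so h(q) = 0 does
    not suffice: h must vanish near q, which holds because its support lies in a closed subset of
    the domain of \<open>c\<close>.\<close>
  show out: "h q * integrand q + deriv_along \<A> W h q = 0" if q: "q \<notin> chart_dom c" for q
  proof -
    let ?d = "chart_at \<A> q"
    note d = chart_at[of q]
    let ?KM = "chart_inv c ` K"
    have KM: "closed ?KM" "?KM \<subseteq> chart_dom c"
      using compact_continuous_image[OF continuous_on_subset[OF continuous_on_inv[OF c] K(2)] K(1)] inv_in[OF c] K(2)
      by (auto simp: compact_imp_closed)
    have h_KM: "h q = 0" if "q \<notin> ?KM" for q
    proof (cases "q \<in> chart_dom c")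
      case True
      then have "chart_map c q \<notin> K" using that inv_map[OF c True] by force
      then show ?thesis using hK[OF map_in[OF True]] inv_map[OF c True] by simp
    qed (rule h0)
    have o: "open {u \<in> chart_img ?d. chart_inv ?d u \<in> - ?KM}"
      using KM(1) by (intro open_inv_vimage[OF d(1)]) auto
    have "((\<lambda>y. h (chart_inv ?d y)) has_derivative (\<lambda>_. 0)) (at (chart_map ?d q))"
      by (rule has_derivative_transform_within_open[OF has_derivative_const[of 0] o])
        (use h_KM KM(2) q map_in[OF d(2)] inv_map[OF d] in auto)
    from frechet_derivative_at[OF this] show ?thesis
      using h0[OF q] by (simp add: deriv_along_def Let_def fun_eq_iff)
  qed
  \<comment> \<open>The charts \<open>chart_at\<close> may change arbitrarily from point to point,
    so measurability is taken from the continuous expression in \<open>c\<close>, extended by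
    zero.\<close>
  show "(\<lambda>q. h q * integrand q + deriv_along \<A> W h q) \<in> borel_measurable borel"
  proof -
    have "continuous_on (chart_img c) ?k"
    proof (intro continuous_on_add continuous_on_mult)
      show "continuous_on (chart_img c) ?h" using Ck_on_SucD[of 0 _ ?h] Ch by simp
      show "continuous_on (chart_img c) (divergence (W c))" by (rule smooth_on_continuous_on[OF smooth_divergence[OF smooth_W[OF c]]])
      have "continuous_on (chart_img c) (\<lambda>u. \<Sum>i\<in>UNIV. W c u $ i *\<^sub>R pd i ?h u)"
        using Ch smooth_on_continuous_on[OF smooth_W[OF c]] by (intro continuous_intros) (auto simp: pd_def)
      moreover have "frechet_derivative ?h (at u) (W c u) = (\<Sum>i\<in>UNIV. W c u $ i *\<^sub>R pd i ?h u)" if "u \<in> chart_img c" for u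
        using Ch that by (intro frechet_derivative_sum_pd) simp
      ultimately show "continuous_on (chart_img c) (\<lambda>u. frechet_derivative ?h (at u) (W c u))"
        by (simp cong: continuous_on_cong)
    qed
    then have "continuous_on (chart_dom c) (\<lambda>q. ?k (chart_map c q))"
      by (rule continuous_on_compose2[OF _ continuous_on_map[OF c]]) (auto intro: map_in)
    then have "(\<lambda>q. indicator (chart_dom c) q *\<^sub>R ?k (chart_map c q)) \<in> borel_measurable borel"
      using open_dom[OF c] by (intro borel_measurable_continuous_on_indicator) auto
    moreover have "(\<lambda>q. indicator (chart_dom c) q *\<^sub>R ?k (chart_map c q)) = (\<lambda>q. h q * integrand q + deriv_along \<A> W h q)"
    proof
      show "indicator (chart_dom c) q *\<^sub>R ?k (chart_map c q) = h q * integrand q + deriv_along \<A> W h q" for q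
        by (cases "q \<in> chart_dom c") (simp_all add: eq out)
    qed
    ultimately show ?thesis by simp
  qed
  have "has_bochner_integral lborel (\<lambda>u. indicator (chart_img c) u * (vol u * ?k u)) 0"
    by (rule divergence_theorem_compact_support[OF smooth_W[OF c] Ch K hK])
  moreover have "density_on c u * (h (chart_inv c u) * integrand (chart_inv c u) + deriv_along \<A> W h (chart_inv c u))
      = indicator (chart_img c) u * (vol u * ?k u)" for u
    using eq[OF inv_in[OF c], of u] map_inv[OF c, of u]
    by (cases "u \<in> chart_img c") (simp_all add: density_on_def vol_def)
  ultimately show "has_bochner_integral lborel (\<lambda>u. density_on c u *
      (h (chart_inv c u) * integrand (chart_inv c u) + deriv_along \<A> W h (chart_inv c u))) 0"
    by simp
qed

lemma has_bochner_integral_integrand: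
  assumes cp: "compact (UNIV :: 'a set)"
  shows "has_bochner_integral (riemannian_volume \<A> g) integrand 0"
proof (rule partition_of_unity[OF cp])
  fix I :: "'a set" and f K
  assume I: "finite I" and f: "\<And>p. p \<in> I \<Longrightarrow> C1_function (f p)"
    and K: "\<And>p. compact (K p)" "\<And>p. K p \<subseteq> chart_img (chart_at \<A> p)"
    and fK: "\<And>p u. u \<in> chart_img (chart_at \<A> p) \<Longrightarrow> u \<notin> K p \<Longrightarrow> f p (chart_inv (chart_at \<A> p) u) = 0"
    and f0: "\<And>p q. q \<notin> chart_dom (chart_at \<A> p) \<Longrightarrow> f p q = 0" and sum1: "\<And>q. (\<Sum>p\<in>I. f p q) = 1"
  have "has_bochner_integral (riemannian_volume \<A> g) (\<lambda>q. \<Sum>p\<in>I. f p q * integrand q + deriv_along \<A> W (f p) q) (\<Sum>p\<in>I. 0)"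
    using has_bochner_integral_localized[OF cp chart_at(1) f K fK f0]
    by (intro has_bochner_integral_sum) blast
  moreover have "(\<Sum>p\<in>I. f p q * integrand q + deriv_along \<A> W (f p) q) = integrand q" for q
  proof -
    let ?d = "chart_at \<A> q"
    note d = chart_at[of q]
    \<comment> \<open>The weights add up to a constant, so their derivatives along W add up to zero
      and only the integrand survives.\<close>
    have "((\<lambda>y. \<Sum>p\<in>I. f p (chart_inv ?d y)) has_derivative
       (\<lambda>v. \<Sum>p\<in>I. frechet_derivative (\<lambda>y. f p (chart_inv ?d y)) (at (chart_map ?d q)) v)) (at (chart_map ?d q))"
      using f d(1) map_in[OF d(2)]
      by (intro has_derivative_sum) (simp add: C1_function_def frechet_derivative_works[symmetric])
    then have "(\<lambda>v. \<Sum>p\<in>I. frechet_derivative (\<lambda>y. f p (chart_inv ?d y)) (at (chart_map ?d q)) v) = (\<lambda>v. 0)"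
      unfolding sum1 by (rule has_derivative_unique[OF _ has_derivative_const])
    from fun_cong[OF this] have "(\<Sum>p\<in>I. deriv_along \<A> W (f p) q) = 0"
      by (simp add: deriv_along_def Let_def)
    then show ?thesis
      by (simp add: sum.distrib sum_distrib_right[symmetric] sum1)
  qed
  ultimately show ?thesis by simp
qed

end

text \<open>\<open>has_bochner_integral\<close> asserts integrability along with the value, so the
  zero is not the default value of a divergent integral.\<close>

theorem lemma2p5:
  fixes \<A> :: "('a::{t2_space, second_countable_topology}, 'n::finite) chart set"
    and g :: "('a, 'n) metric"
    and \<xi> :: "('a, 'n) vfield"
    and lam :: "'a \<Rightarrow> real"
    and \<rho> :: real
  assumes "compact (UNIV :: 'a set)"
    and "almost_RB_soliton \<A> g \<xi> lam \<rho>"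
  defines "S \<equiv> scalar_curvature \<A> g"
  shows "has_bochner_integral (riemannian_volume \<A> g)
           (\<lambda>p. ricci_field \<A> g \<xi> \<xi> p - phi_norm_sq \<A> g \<xi> p
              + deriv_along \<A> \<xi>
                  (\<lambda>q. (real CARD('n) - 1) * (lam q + \<rho> * S q) - 1/2 * S q) p) 0"
proof -
  interpret rb_soliton \<A> g \<xi> lam \<rho>
    using assms(2) by unfold_locales (simp_all add: almost_RB_soliton_def)
  show ?thesis
    using has_bochner_integral_integrand[OF assms(1)] unfolding integrand_def[abs_def] S_def .
qed

end
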